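(* Let $\mathcal{X}=(X,E)$ be a crystal lattice for the action of a finitely generated abelian group $G$, of dimension $d=\dim\mathcal{X}$, and let $(S,\phi)$ be an interaction which is irreducibly quantified. Assume in addition that $(S,\phi)$ is simple if $d=1$. Let $$\mathcal{C}:=Z^1_{\mathrm{unif}}(S^X)^G,\qquad \mathcal{E}:=\partial_{\mathcal{X}}\bigl(C_{\mathrm{unif}}(S^X)^G\bigr),\qquad \partial_{\mathcal{X}}\mathcal{V}:=\mathrm{Span}_{\mathbb{R}}\{\partial_{\mathcal{X}}\mathfrak{A}^j_\xi \mid \xi\in\mathrm{Consv}^\phi(S),\ j=1,\dots,d\}.$$ Then $\partial_{\mathcal X}\mathcal V$ is a subspace of $\mathcal C$ of dimension $c_\phi d$, where $c_\phi=\dim_{\mathbb R}\mathrm{Consv}^\phi(S)$, and there is a decomposition $$\mathcal{C}=\mathcal{E}\oplus\partial_{\mathcal{X}}\mathcal{V}.$$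
   Context: Graphs. A multi-graph $\mathcal{X}=(X,E)$ consists of sets $X$ (vertices), $E$ (edges), maps $o,t\colon E\to X$ (origin, target), and a bijection $\iota\colon E\to E$, $e\mapsto\bar e$ (inversion) with $\bar{\bar e}=e$, $o(\bar e)=t(e)$, $t(\bar e)=o(e)$. It is strictly symmetric if $\bar e\ne e$ for all $e$; locally finite if $\{e\in E\mid o(e)=x\}$ is finite for every $x$; finite if $X,E$ are finite. A path from $x$ to $x'$ is a finite sequence of edges $(e^1,\dots,e^N)$ with $o(e^1)=x$, $t(e^N)=x'$, $t(e^i)=o(e^{i+1})$; $d_{\mathcal X}(x,x')$ is the infimum of the lengths $N$ of such paths ($d_{\mathcal X}(x,x)=0$, and $\infty$ if there is no path). A subset $Y\subset X$ is connected if any two elements of $Y$ are joined by a path of edges with origins and targets in $Y$; $\mathcal X$ is connected if $X$ is. A locale is a connected locally finite multi-graph. An action of a group $G$ on $\mathcal X$ is a homomorphism $G\to\mathrm{Aut}(\mathcal X)$ (automorphisms: pairs of bijections of $X$ and $E$ compatible with $o,t,\iota$); it is free if $\sigma(x)=x$ for some $x\in X$ implies $\sigma=\mathrm{id}$. The quotient is $\mathcal X/G=(X/G,E/G)$ (orbit sets with induced $o,t,\iota$). A crystal lattice is a connected multi-graph $\mathcal X$ with a free action of a finitely generated abelian group $G$ of rank $>0$ such that $\mathcal X/G$ is a strictly symmetric finite multi-graph; it is then automatically locally finite. Its dimension $\dim\mathcal X$ is the rank of $G$. Interactions. An interaction is a pair $(S,\phi)$ of a set $S$ and a map $\phi\colon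 S\times S\to S\times S$ such that $\bar\phi\circ\phi(s_1,s_2)=(s_1,s_2)$ whenever $\phi(s_1,s_2)\neq(s_1,s_2)$, where $\bar\phi$ is $\phi$ conjugated by the swap of components. A base state $*\in S$ is fixed. For a multi-graph $(X,E)$, $\eta=(\eta_x)\in S^X$ and $e\in E$, the configuration $\eta^e\in S^X$ is: if $o(e)\ne t(e)$, $(\eta^e_{o(e)},\eta^e_{t(e)})=\phi(\eta_{o(e)},\eta_{t(e)})$ and $\eta^e_x=\eta_x$ for other $x$; if $o(e)=t(e)$, $\eta^e=\eta$. A path from $\eta$ to $\eta'$ is a sequence $\eta=\eta_0,\dots,\eta_N=\eta'$ with $\eta_i=\eta_{i-1}^{e_i}$ for edges $e_i$. A conserved quantity is a map $\xi\colon S\to\mathbb R$ with $\xi( * )=0$ and $\xi(s_1)+\xi(s_2)=\xi(s_1')+\xi(s_2')$ whenever $(s_1',s_2')=\phi(s_1,s_2)$; they form the $\mathbb R$-linear space $\mathrm{Consv}^\phi(S)$, and $c_\phi=\dim_{\mathbb R}\mathrm{Consv}^\phi(S)$. The interaction is irreducibly quantified if for every finite locale $(\Lambda,E_\Lambda)$ and $\eta,\eta'\in S^\Lambda$ with $\sum_{x\in\Lambda}\xi(\eta_x)=\sum_{x\in\Lambda}\xi(\eta'_x)$ for all $\xi\in\mathrm{Consv}^\phi(S)$, there is a path from $\eta$ to $\eta'$ in $S^\Lambda$. It is simple if $c_\phi=1$ and for every nonzero $\xi\in\mathrm{Consv}^\phi(S)$ the additive submonoid of $\mathbb R$ generated by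 $\xi(S)$ is isomorphic to $\mathbb N$ or $\mathbb Z$. Uniform functions and forms. $S^X_*\subset S^X$ is the set of $\eta$ with $\eta_x=*$ for all but finitely many $x$; $C(A)$ is the space of maps $A\to\mathbb R$. For $\Lambda\subset X$ finite, $C(S^\Lambda)\subset C(S^X_* )$ via projection, and $C_\Lambda(S^X)$ is the set of $f\in C(S^\Lambda)$ with $f(\eta)=0$ whenever $\eta_x=*$ for some $x\in\Lambda$. A function $f\in C(S^X_* )$ is uniform if there is $R\ge0$ with $f=\sum_\Lambda f_\Lambda$, the sum over finite $\Lambda\subset X$ of diameter $\le R$ for $d_{\mathcal X}$, with $f_\Lambda\in C_\Lambda(S^X)$ (the sum is finite at each $\eta\in S^X_*$); $C_{\mathrm{unif}}(S^X)$ is the space of uniform functions. A form is a family $\omega=(\omega_e)_{e\in E}$, $\omega_e\in C(S^X_* )$, with $\omega_e(\eta)=-\omega_{\bar e}(\eta^e)$ if $\eta^e\ne\eta$ and $\omega_e(\eta)=0$ if $\eta^e=\eta$. It is closed if $\sum_{i=1}^N\omega_{e_i}(\eta_{i-1})=0$ for every closed path $\eta_0,\dots,\eta_N=\eta_0$ in $S^X_*$, $\eta_i=\eta_{i-1}^{e_i}$. It is uniform if for some $R\geq 0$ every $\omega_e$ depends only on the components of $\eta$ in the ball $B(o(e),R)=\{x\mid d_{\mathcal X}(o(e),x)\le R\}$. $Z^1_{\mathrm{unif}}(S^X)$ is the space of closed uniform forms. The differential is $\partial_{\mathcal X}f=(\nabla_ef)_{e\in E}$, $\nabla_ef(\eta)=f(\eta^e)-f(\eta)$;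 it maps $C_{\mathrm{unif}}(S^X)$ to $Z^1_{\mathrm{unif}}(S^X)$. Group action. $G$ acts on $S^X_*$ by $(\sigma\eta)_x=\eta_{\sigma^{-1}(x)}$, on functions by $(\sigma f)(\eta)=f(\sigma^{-1}\eta)$, on forms by $(\sigma\omega)_e(\eta)=\omega_{\sigma^{-1}(e)}(\sigma^{-1}\eta)$; the superscript $G$ denotes invariants. The functions $\mathfrak A^j_\xi$. Fix a free part $F\subset G$ (a free abelian complement of the torsion subgroup) with free generators $\sigma_1,\dots,\sigma_d$, giving $F\cong\mathbb Z^d$, extended to a surjection $G\to\mathbb Z^d$, $\tau\mapsto(n_1(\tau),\dots,n_d(\tau))$, killing the torsion subgroup. Fix a fundamental domain $\Lambda_0\subset X$ for $G$: a connected subset containing exactly one element of each $G$-orbit. For $\xi\in\mathrm{Consv}^\phi(S)$ put $\xi_x(\eta)=\xi(\eta_x)$, $\xi_\Lambda=\sum_{x\in\Lambda}\xi_x$, and $\mathfrak A^j_\xi:=\sum_{\tau\in G}n_j(\tau)\,\xi_{\tau(\Lambda_0)}\in C_{\mathrm{unif}}(S^X)$. *)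

theory Defs
  imports
    "HOL-Analysis.Analysis"
    "HOL-Library.Function_Algebras"
    "HOL-Library.Equipollence"
    "HOL-Library.Extended_Nat"
    "HOL-Algebra.FiniteProduct"
    "HOL-Algebra.Group_Action"
    "HOL-Algebra.Generated_Groups"
    "HOL-Algebra.Elementary_Groups"
    "Graph_Theory.Graph_Theory"
begin

section \<open>Linear structure on spaces of functions\<close>

text \<open>
  Pointwise scalar multiplication, complementing HOL-Library's pointwise addition. It makes
  the types of functions on configurations, of forms, and of maps on the set of states real
  vector spaces, so that \<^const>\<open>subspace\<close>, \<^const>\<open>span\<close>, \<^const>\<open>independent\<close> and \<^const>\<open>dim\<close> apply.
\<close>

instantiation "fun" :: (type, real_vector) real_vector
begin

definition scaleR_fun :: "real \<Rightarrow> ('a \<Rightarrow> 'b) \<Rightarrow> 'a \<Rightarrow> 'b"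
  where "scaleR_fun r f = (\<lambda>x. r *\<^sub>R f x)"

instance
  by standard (auto simp: scaleR_fun_def fun_eq_iff scaleR_add_right scaleR_add_left)

end

lemma scaleR_fun_apply [simp]: "(r *\<^sub>R f) x = r *\<^sub>R f x"
  by (simp add: scaleR_fun_def)

definition direct_sum_decomposition :: "'v::real_vector set \<Rightarrow> 'v set \<Rightarrow> 'v set \<Rightarrow> bool"
  where "direct_sum_decomposition C U V \<longleftrightarrow>
    subspace C \<and> subspace U \<and> subspace V \<and>
    C = {u + v |u v. u \<in> U \<and> v \<in> V} \<and> U \<inter> V = {0}"

text \<open>Unlike \<^const>\<open>dim\<close>, which is 0 for every infinite-dimensional space, this treats the dimension
  as a cardinal, namely that of the set \<open>I\<close>.\<close>

definition has_dimension_of :: "'v::real_vector set \<Rightarrow> 'i set \<Rightarrow> bool"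
  where "has_dimension_of V I \<longleftrightarrow> (\<exists>B. independent B \<and> span B = V \<and> B \<approx> I)"


section \<open>Multi-graphs and crystal lattices\<close>

text \<open>The vertex and edge sets, the origin and the target maps are the components \<^const>\<open>verts\<close>,
  \<^const>\<open>arcs\<close>, \<^const>\<open>tail\<close> and \<^const>\<open>head\<close> of a digraph; \<open>\<iota>\<close> is the inversion.\<close>

locale multigraph = wf_digraph X for X :: "('x, 'e) pre_digraph" +
  fixes \<iota> :: "'e \<Rightarrow> 'e"
  assumes inversion_closed: "e \<in> arcs X \<Longrightarrow> \<iota> e \<in> arcs X"
    and inversion_inversion: "e \<in> arcs X \<Longrightarrow> \<iota> (\<iota> e) = e"
    and tail_inversion: "e \<in> arcs X \<Longrightarrow> tail X (\<iota> e) = head X e"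
    and head_inversion: "e \<in> arcs X \<Longrightarrow> head X (\<iota> e) = tail X e"

definition strictly_symmetric :: "('x, 'e) pre_digraph \<Rightarrow> ('e \<Rightarrow> 'e) \<Rightarrow> bool"
  where "strictly_symmetric X \<iota> \<longleftrightarrow> (\<forall>e \<in> arcs X. \<iota> e \<noteq> e)"

definition locally_finite_graph :: "('x, 'e) pre_digraph \<Rightarrow> bool"
  where "locally_finite_graph X \<longleftrightarrow> (\<forall>x \<in> verts X. finite {e \<in> arcs X. tail X e = x})"

definition gdist :: "('x, 'e) pre_digraph \<Rightarrow> 'x \<Rightarrow> 'x \<Rightarrow> enat"
  where "gdist X x y = (INF p \<in> {p. pre_digraph.awalk X x p y}. enat (length p))"

definition connected_subset :: "('x, 'e) pre_digraph \<Rightarrow> 'x set \<Rightarrow> bool"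
  where "connected_subset X Y \<longleftrightarrow>
    Y \<subseteq> verts X \<and> (\<forall>x \<in> Y. \<forall>y \<in> Y. \<exists>p. pre_digraph.awalk (X \<restriction> Y) x p y)"

text \<open>As usual, the graph without vertices does not count as connected.\<close>

definition connected_graph :: "('x, 'e) pre_digraph \<Rightarrow> bool"
  where "connected_graph X \<longleftrightarrow> verts X \<noteq> {} \<and> connected_subset X (verts X)"

text \<open>A ``locale'' in the sense of large scale interacting systems, not of Isabelle.\<close>

definition graph_locale :: "('x, 'e) pre_digraph \<Rightarrow> ('e \<Rightarrow> 'e) \<Rightarrow> bool"
  where "graph_locale X \<iota> \<longleftrightarrow> multigraph X \<iota> \<and> connected_graph X \<and> locally_finite_graph X"

locale multigraph_action =
  multigraph X \<iota> + vertex_action: group_action G "verts X" aV + edge_action: group_action G "arcs X" aE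
  for X :: "('x, 'e) pre_digraph" and \<iota> :: "'e \<Rightarrow> 'e" and G :: "'g monoid"
    and aV :: "'g \<Rightarrow> 'x \<Rightarrow> 'x" and aE :: "'g \<Rightarrow> 'e \<Rightarrow> 'e" +
  assumes tail_act: "g \<in> carrier G \<Longrightarrow> e \<in> arcs X \<Longrightarrow> tail X (aE g e) = aV g (tail X e)"
    and head_act: "g \<in> carrier G \<Longrightarrow> e \<in> arcs X \<Longrightarrow> head X (aE g e) = aV g (head X e)"
    and inversion_act: "g \<in> carrier G \<Longrightarrow> e \<in> arcs X \<Longrightarrow> \<iota> (aE g e) = aE g (\<iota> e)"

text \<open>The image under \<^term>\<open>tail X\<close> of an orbit of edges is the orbit of the origin of any of its
  members; likewise for the target and the inversion, the latter being \<^term>\<open>\<lambda>Q. \<iota> ` Q\<close>.\<close>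

definition quotient_graph ::
    "('x, 'e) pre_digraph \<Rightarrow> 'g monoid \<Rightarrow> ('g \<Rightarrow> 'x \<Rightarrow> 'x) \<Rightarrow> ('g \<Rightarrow> 'e \<Rightarrow> 'e)
      \<Rightarrow> ('x set, 'e set) pre_digraph"
  where "quotient_graph X G aV aE =
    \<lparr> verts = orbits G (verts X) aV, arcs = orbits G (arcs X) aE,
      tail = (\<lambda>Q. tail X ` Q), head = (\<lambda>Q. head X ` Q) \<rparr>"

definition finitely_generated_group :: "'g monoid \<Rightarrow> bool"
  where "finitely_generated_group G \<longleftrightarrow>
    (\<exists>A. finite A \<and> A \<subseteq> carrier G \<and> generate G A = carrier G)"

definition Z_independent :: "'g monoid \<Rightarrow> nat \<Rightarrow> (nat \<Rightarrow> 'g) \<Rightarrow> bool"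
  where "Z_independent G d \<sigma> \<longleftrightarrow>
    (\<forall>j \<in> {1..d}. \<sigma> j \<in> carrier G) \<and>
    (\<forall>k :: nat \<Rightarrow> int. finprod G (\<lambda>j. \<sigma> j [^]\<^bsub>G\<^esub> k j) {1..d} = \<one>\<^bsub>G\<^esub> \<longrightarrow> (\<forall>j \<in> {1..d}. k j = 0))"

definition abelian_rank :: "'g monoid \<Rightarrow> nat"
  where "abelian_rank G = (GREATEST d. \<exists>\<sigma>. Z_independent G d \<sigma>)"

locale crystal_lattice =
  multigraph_action X \<iota> G aV aE + comm_group G
  for X :: "('x, 'e) pre_digraph" and \<iota> :: "'e \<Rightarrow> 'e" and G :: "'g monoid"
    and aV :: "'g \<Rightarrow> 'x \<Rightarrow> 'x" and aE :: "'g \<Rightarrow> 'e \<Rightarrow> 'e" +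
  assumes connected: "connected_graph X"
    and finitely_generated: "finitely_generated_group G"
    and rank_pos: "abelian_rank G > 0"
    and free: "g \<in> carrier G \<Longrightarrow> x \<in> verts X \<Longrightarrow> aV g x = x \<Longrightarrow> g = \<one>\<^bsub>G\<^esub>"
    and quotient_finite: "fin_digraph (quotient_graph X G aV aE)"
    and quotient_multigraph: "multigraph (quotient_graph X G aV aE) (\<lambda>Q. \<iota> ` Q)"
    and quotient_strictly_symmetric: "strictly_symmetric (quotient_graph X G aV aE) (\<lambda>Q. \<iota> ` Q)"

definition fundamental_domain ::
    "('x, 'e) pre_digraph \<Rightarrow> 'g monoid \<Rightarrow> ('g \<Rightarrow> 'x \<Rightarrow> 'x) \<Rightarrow> 'x set \<Rightarrow> bool"
  where "fundamental_domain X G aV \<Lambda>0 \<longleftrightarrow>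
    connected_subset X \<Lambda>0 \<and> (\<forall>Q \<in> orbits G (verts X) aV. \<exists>!x. x \<in> \<Lambda>0 \<and> x \<in> Q)"

definition torsion_subgroup :: "'g monoid \<Rightarrow> 'g set"
  where "torsion_subgroup G = {g \<in> carrier G. \<exists>n :: nat. n > 0 \<and> g [^]\<^bsub>G\<^esub> n = \<one>\<^bsub>G\<^esub>}"

definition free_part :: "'g monoid \<Rightarrow> 'g set \<Rightarrow> nat \<Rightarrow> (nat \<Rightarrow> 'g) \<Rightarrow> bool"
  where "free_part G F d \<sigma> \<longleftrightarrow>
    subgroup F G \<and>
    F \<inter> torsion_subgroup G = {\<one>\<^bsub>G\<^esub>} \<and> F <#>\<^bsub>G\<^esub> torsion_subgroup G = carrier G \<and>
    Z_independent G d \<sigma> \<and> generate G (\<sigma> ` {1..d}) = F"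

text \<open>The homomorphism \<open>(n\<^sub>1, \<dots>, n\<^sub>d) : G \<rightarrow> \<int>\<^sup>d\<close> given on the free part by the basis \<open>\<sigma>\<close> and
  killing torsion; it is uniquely determined by these conditions.\<close>

definition free_coordinates :: "'g monoid \<Rightarrow> nat \<Rightarrow> (nat \<Rightarrow> 'g) \<Rightarrow> (nat \<Rightarrow> 'g \<Rightarrow> int) \<Rightarrow> bool"
  where "free_coordinates G d \<sigma> n \<longleftrightarrow>
    (\<forall>j \<in> {1..d}. n j \<in> hom G integer_group \<and>
      (\<forall>i \<in> {1..d}. n j (\<sigma> i) = (if i = j then 1 else 0)) \<and>
      (\<forall>g \<in> torsion_subgroup G. n j g = 0))"


section \<open>Interactions\<close>

text \<open>The set of states is the type \<open>'s\<close>; \<open>b\<close> is the base state.\<close>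

definition is_interaction :: "('s \<times> 's \<Rightarrow> 's \<times> 's) \<Rightarrow> bool"
  where "is_interaction \<phi> \<longleftrightarrow>
    (\<forall>s. \<phi> s \<noteq> s \<longrightarrow> ((prod.swap \<circ> \<phi> \<circ> prod.swap) \<circ> \<phi>) s = s)"

definition Consv :: "('s \<times> 's \<Rightarrow> 's \<times> 's) \<Rightarrow> 's \<Rightarrow> ('s \<Rightarrow> real) set"
  where "Consv \<phi> b = {\<xi>. \<xi> b = 0 \<and>
    (\<forall>s1 s2 s1' s2'. (s1', s2') = \<phi> (s1, s2) \<longrightarrow> \<xi> s1 + \<xi> s2 = \<xi> s1' + \<xi> s2')}"

definition c_dim :: "('s \<times> 's \<Rightarrow> 's \<times> 's) \<Rightarrow> 's \<Rightarrow> nat"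
  where "c_dim \<phi> b = dim (Consv \<phi> b)"

text \<open>Elements of \<open>S\<^sup>X\<close> are represented by functions that are \<^const>\<open>undefined\<close> off the vertex set.\<close>

definition configs :: "('x, 'e) pre_digraph \<Rightarrow> ('x \<Rightarrow> 's) set"
  where "configs X = (verts X \<rightarrow>\<^sub>E UNIV)"

definition transition ::
    "('x, 'e) pre_digraph \<Rightarrow> ('s \<times> 's \<Rightarrow> 's \<times> 's) \<Rightarrow> ('x \<Rightarrow> 's) \<Rightarrow> 'e \<Rightarrow> ('x \<Rightarrow> 's)"
  where "transition X \<phi> \<eta> e =
    (if tail X e = head X e then \<eta>
     else \<eta>(tail X e := fst (\<phi> (\<eta> (tail X e), \<eta> (head X e))),
            head X e := snd (\<phi> (\<eta> (tail X e), \<eta> (head X e)))))"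

text \<open>A path of configurations is given by its initial configuration and its list of edges; this is
  its final configuration.\<close>

definition transitions ::
    "('x, 'e) pre_digraph \<Rightarrow> ('s \<times> 's \<Rightarrow> 's \<times> 's) \<Rightarrow> ('x \<Rightarrow> 's) \<Rightarrow> 'e list \<Rightarrow> ('x \<Rightarrow> 's)"
  where "transitions X \<phi> \<eta> es = foldl (transition X \<phi>) \<eta> es"

text \<open>Every finite multi-graph is isomorphic to one whose vertices and edges are natural numbers.\<close>

definition irreducibly_quantified :: "('s \<times> 's \<Rightarrow> 's \<times> 's) \<Rightarrow> 's \<Rightarrow> bool"
  where "irreducibly_quantified \<phi> b \<longleftrightarrow>
    (\<forall>(L :: (nat, nat) pre_digraph) \<iota>. graph_locale L \<iota> \<and> fin_digraph L \<longrightarrow>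
      (\<forall>\<eta> \<in> configs L. \<forall>\<eta>' \<in> configs L.
        (\<forall>\<xi> \<in> Consv \<phi> b. (\<Sum>x \<in> verts L. \<xi> (\<eta> x)) = (\<Sum>x \<in> verts L. \<xi> (\<eta>' x))) \<longrightarrow>
        (\<exists>es. set es \<subseteq> arcs L \<and> transitions L \<phi> \<eta> es = \<eta>')))"

definition additive_monoid :: "'a::monoid_add set \<Rightarrow> 'a monoid"
  where "additive_monoid M = \<lparr> carrier = M, monoid.mult = (+), one = 0 \<rparr>"

definition generated_submonoid :: "real set \<Rightarrow> real set"
  where "generated_submonoid A = (\<lambda>M. submonoid M (additive_monoid UNIV)) hull A"

definition simple_interaction :: "('s \<times> 's \<Rightarrow> 's \<times> 's) \<Rightarrow> 's \<Rightarrow> bool"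
  where "simple_interaction \<phi> b \<longleftrightarrow>
    c_dim \<phi> b = 1 \<and>
    (\<forall>\<xi> \<in> Consv \<phi> b. \<xi> \<noteq> 0 \<longrightarrow>
      additive_monoid (generated_submonoid (range \<xi>)) \<cong> additive_monoid (UNIV :: nat set) \<or>
      additive_monoid (generated_submonoid (range \<xi>)) \<cong> additive_monoid (UNIV :: int set))"


section \<open>Uniform functions and forms\<close>

definition fin_configs :: "('x, 'e) pre_digraph \<Rightarrow> 's \<Rightarrow> ('x \<Rightarrow> 's) set"
  where "fin_configs X b = {\<eta> \<in> configs X. finite {x \<in> verts X. \<eta> x \<noteq> b}}"

text \<open>Functions on \<open>S\<^sup>X\<^sub>*\<close> are extended by 0 to the whole type, so that equality of elements of
  \<open>C(S\<^sup>X\<^sub>*)\<close> is equality in HOL. The same is done for forms, and for the operations below.\<close>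

definition config_functions :: "('x, 'e) pre_digraph \<Rightarrow> 's \<Rightarrow> (('x \<Rightarrow> 's) \<Rightarrow> real) set"
  where "config_functions X b = {f. \<forall>\<eta>. \<eta> \<notin> fin_configs X b \<longrightarrow> f \<eta> = 0}"

definition depends_on ::
    "('x, 'e) pre_digraph \<Rightarrow> 's \<Rightarrow> 'x set \<Rightarrow> (('x \<Rightarrow> 's) \<Rightarrow> real) \<Rightarrow> bool"
  where "depends_on X b \<Lambda> f \<longleftrightarrow>
    (\<forall>\<eta> \<in> fin_configs X b. \<forall>\<eta>' \<in> fin_configs X b. (\<forall>x \<in> \<Lambda>. \<eta> x = \<eta>' x) \<longrightarrow> f \<eta> = f \<eta>')"

definition local_functions :: "('x, 'e) pre_digraph \<Rightarrow> 's \<Rightarrow> 'x set \<Rightarrow> (('x \<Rightarrow> 's) \<Rightarrow> real) set"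
  where "local_functions X b \<Lambda> = {f \<in> config_functions X b. depends_on X b \<Lambda> f \<and>
    (\<forall>\<eta> \<in> fin_configs X b. (\<exists>x \<in> \<Lambda>. \<eta> x = b) \<longrightarrow> f \<eta> = 0)}"

definition small_subsets :: "('x, 'e) pre_digraph \<Rightarrow> nat \<Rightarrow> 'x set set"
  where "small_subsets X R = {\<Lambda>. \<Lambda> \<subseteq> verts X \<and> finite \<Lambda> \<and> (\<forall>x \<in> \<Lambda>. \<forall>y \<in> \<Lambda>. gdist X x y \<le> enat R)}"

text \<open>The sum ranges over the nonzero summands only. There are finitely many of them, since
  \<open>f\<^sub>\<Lambda>(\<eta>) \<noteq> 0\<close> forces \<open>\<Lambda>\<close> to be contained in the finite set of all \<open>x\<close> with \<open>\<eta>\<^sub>x \<noteq> *\<close>.\<close>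

definition uniform_functions :: "('x, 'e) pre_digraph \<Rightarrow> 's \<Rightarrow> (('x \<Rightarrow> 's) \<Rightarrow> real) set"
  where "uniform_functions X b = {f \<in> config_functions X b. \<exists>(R :: nat) F.
    (\<forall>\<Lambda> \<in> small_subsets X R. F \<Lambda> \<in> local_functions X b \<Lambda>) \<and>
    (\<forall>\<eta> \<in> fin_configs X b. f \<eta> = (\<Sum>\<Lambda> \<in> {\<Lambda> \<in> small_subsets X R. F \<Lambda> \<eta> \<noteq> 0}. F \<Lambda> \<eta>))}"

definition forms ::
    "('x, 'e) pre_digraph \<Rightarrow> ('e \<Rightarrow> 'e) \<Rightarrow> ('s \<times> 's \<Rightarrow> 's \<times> 's) \<Rightarrow> 's
      \<Rightarrow> ('e \<Rightarrow> ('x \<Rightarrow> 's) \<Rightarrow> real) set"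
  where "forms X \<iota> \<phi> b = {\<omega>.
    (\<forall>e. e \<notin> arcs X \<longrightarrow> \<omega> e = 0) \<and>
    (\<forall>e \<in> arcs X. \<omega> e \<in> config_functions X b) \<and>
    (\<forall>e \<in> arcs X. \<forall>\<eta> \<in> fin_configs X b.
      (transition X \<phi> \<eta> e \<noteq> \<eta> \<longrightarrow> \<omega> e \<eta> = - \<omega> (\<iota> e) (transition X \<phi> \<eta> e)) \<and>
      (transition X \<phi> \<eta> e = \<eta> \<longrightarrow> \<omega> e \<eta> = 0))}"

definition closed_form ::
    "('x, 'e) pre_digraph \<Rightarrow> ('s \<times> 's \<Rightarrow> 's \<times> 's) \<Rightarrow> 's \<Rightarrow> ('e \<Rightarrow> ('x \<Rightarrow> 's) \<Rightarrow> real) \<Rightarrow> bool"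
  where "closed_form X \<phi> b \<omega> \<longleftrightarrow>
    (\<forall>\<eta> \<in> fin_configs X b. \<forall>es. set es \<subseteq> arcs X \<and> transitions X \<phi> \<eta> es = \<eta> \<longrightarrow>
      (\<Sum>i < length es. \<omega> (es ! i) (transitions X \<phi> \<eta> (take i es))) = 0)"

definition uniform_form ::
    "('x, 'e) pre_digraph \<Rightarrow> 's \<Rightarrow> ('e \<Rightarrow> ('x \<Rightarrow> 's) \<Rightarrow> real) \<Rightarrow> bool"
  where "uniform_form X b \<omega> \<longleftrightarrow> (\<exists>R :: nat. \<forall>e \<in> arcs X.
    depends_on X b {x \<in> verts X. gdist X (tail X e) x \<le> enat R} (\<omega> e))"

definition closed_uniform_forms ::
    "('x, 'e) pre_digraph \<Rightarrow> ('e \<Rightarrow> 'e) \<Rightarrow> ('s \<times> 's \<Rightarrow> 's \<times> 's) \<Rightarrow> 's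
      \<Rightarrow> ('e \<Rightarrow> ('x \<Rightarrow> 's) \<Rightarrow> real) set"
  where "closed_uniform_forms X \<iota> \<phi> b =
    {\<omega> \<in> forms X \<iota> \<phi> b. closed_form X \<phi> b \<omega> \<and> uniform_form X b \<omega>}"

definition differential ::
    "('x, 'e) pre_digraph \<Rightarrow> ('s \<times> 's \<Rightarrow> 's \<times> 's) \<Rightarrow> 's
      \<Rightarrow> (('x \<Rightarrow> 's) \<Rightarrow> real) \<Rightarrow> ('e \<Rightarrow> ('x \<Rightarrow> 's) \<Rightarrow> real)"
  where "differential X \<phi> b f = (\<lambda>e \<eta>.
    if e \<in> arcs X \<and> \<eta> \<in> fin_configs X b then f (transition X \<phi> \<eta> e) - f \<eta> else 0)"


section \<open>The action on functions and forms\<close>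

definition act_config ::
    "('x, 'e) pre_digraph \<Rightarrow> 'g monoid \<Rightarrow> ('g \<Rightarrow> 'x \<Rightarrow> 'x) \<Rightarrow> 'g \<Rightarrow> ('x \<Rightarrow> 's) \<Rightarrow> ('x \<Rightarrow> 's)"
  where "act_config X G aV g \<eta> = (\<lambda>x \<in> verts X. \<eta> (aV (inv\<^bsub>G\<^esub> g) x))"

definition act_function ::
    "('x, 'e) pre_digraph \<Rightarrow> 'g monoid \<Rightarrow> ('g \<Rightarrow> 'x \<Rightarrow> 'x) \<Rightarrow> 's \<Rightarrow> 'g
      \<Rightarrow> (('x \<Rightarrow> 's) \<Rightarrow> real) \<Rightarrow> (('x \<Rightarrow> 's) \<Rightarrow> real)"
  where "act_function X G aV b g f = (\<lambda>\<eta>.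
    if \<eta> \<in> fin_configs X b then f (act_config X G aV (inv\<^bsub>G\<^esub> g) \<eta>) else 0)"

definition act_form ::
    "('x, 'e) pre_digraph \<Rightarrow> 'g monoid \<Rightarrow> ('g \<Rightarrow> 'x \<Rightarrow> 'x) \<Rightarrow> ('g \<Rightarrow> 'e \<Rightarrow> 'e) \<Rightarrow> 's \<Rightarrow> 'g
      \<Rightarrow> ('e \<Rightarrow> ('x \<Rightarrow> 's) \<Rightarrow> real) \<Rightarrow> ('e \<Rightarrow> ('x \<Rightarrow> 's) \<Rightarrow> real)"
  where "act_form X G aV aE b g \<omega> = (\<lambda>e \<eta>.
    if e \<in> arcs X \<and> \<eta> \<in> fin_configs X b
    then \<omega> (aE (inv\<^bsub>G\<^esub> g) e) (act_config X G aV (inv\<^bsub>G\<^esub> g) \<eta>) else 0)"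

definition invariant_uniform_functions ::
    "('x, 'e) pre_digraph \<Rightarrow> 'g monoid \<Rightarrow> ('g \<Rightarrow> 'x \<Rightarrow> 'x) \<Rightarrow> 's \<Rightarrow> (('x \<Rightarrow> 's) \<Rightarrow> real) set"
  where "invariant_uniform_functions X G aV b =
    {f \<in> uniform_functions X b. \<forall>g \<in> carrier G. act_function X G aV b g f = f}"

definition invariant_closed_uniform_forms ::
    "('x, 'e) pre_digraph \<Rightarrow> ('e \<Rightarrow> 'e) \<Rightarrow> 'g monoid \<Rightarrow> ('g \<Rightarrow> 'x \<Rightarrow> 'x) \<Rightarrow> ('g \<Rightarrow> 'e \<Rightarrow> 'e)
      \<Rightarrow> ('s \<times> 's \<Rightarrow> 's \<times> 's) \<Rightarrow> 's \<Rightarrow> ('e \<Rightarrow> ('x \<Rightarrow> 's) \<Rightarrow> real) set"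
  where "invariant_closed_uniform_forms X \<iota> G aV aE \<phi> b =
    {\<omega> \<in> closed_uniform_forms X \<iota> \<phi> b. \<forall>g \<in> carrier G. act_form X G aV aE b g \<omega> = \<omega>}"


section \<open>The functions spanning the complement\<close>

definition xi_sum :: "('s \<Rightarrow> real) \<Rightarrow> 'x set \<Rightarrow> ('x \<Rightarrow> 's) \<Rightarrow> real"
  where "xi_sum \<xi> \<Lambda> \<eta> = (\<Sum>x \<in> \<Lambda>. \<xi> (\<eta> x))"

text \<open>The sum over \<open>G\<close> is restricted to its nonzero summands: \<open>\<eta>\<close> differs from the base state, where
  \<open>\<xi>\<close> vanishes, in only finitely many of the pairwise disjoint translates of \<open>\<Lambda>0\<close>.\<close>

definition frakA ::
    "('x, 'e) pre_digraph \<Rightarrow> 'g monoid \<Rightarrow> ('g \<Rightarrow> 'x \<Rightarrow> 'x) \<Rightarrow> 's \<Rightarrow> (nat \<Rightarrow> 'g \<Rightarrow> int) \<Rightarrow> 'x set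
      \<Rightarrow> nat \<Rightarrow> ('s \<Rightarrow> real) \<Rightarrow> (('x \<Rightarrow> 's) \<Rightarrow> real)"
  where "frakA X G aV b n \<Lambda>0 j \<xi> = (\<lambda>\<eta>.
    if \<eta> \<in> fin_configs X b
    then (\<Sum>\<tau> \<in> {\<tau> \<in> carrier G. of_int (n j \<tau>) * xi_sum \<xi> (aV \<tau> ` \<Lambda>0) \<eta> \<noteq> 0}.
            of_int (n j \<tau>) * xi_sum \<xi> (aV \<tau> ` \<Lambda>0) \<eta>)
    else 0)"

definition dV_space ::
    "('x, 'e) pre_digraph \<Rightarrow> 'g monoid \<Rightarrow> ('g \<Rightarrow> 'x \<Rightarrow> 'x) \<Rightarrow> ('s \<times> 's \<Rightarrow> 's \<times> 's) \<Rightarrow> 's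
      \<Rightarrow> nat \<Rightarrow> (nat \<Rightarrow> 'g \<Rightarrow> int) \<Rightarrow> 'x set \<Rightarrow> ('e \<Rightarrow> ('x \<Rightarrow> 's) \<Rightarrow> real) set"
  where "dV_space X G aV \<phi> b d n \<Lambda>0 =
    span {differential X \<phi> b (frakA X G aV b n \<Lambda>0 j \<xi>) |\<xi> j. \<xi> \<in> Consv \<phi> b \<and> j \<in> {1..d}}"

end

theory Submission
  imports Defs
begin

text \<open>
  A closed form \<open>\<omega>\<close> has a primitive \<open>f\<close>, since configurations are joined by transitions exactly when they
  have the same charge, the family of the values of all conserved quantities. If two configurations are
  far apart, then \<open>f(\<eta> \<union> \<zeta>) - f(\<eta>) - f(\<zeta>)\<close> depends only on their charges, because particles can be
  moved within one of them without affecting the other; this defines a 2-cocycle on the monoid of charges. In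
  dimension at least 2 the cocycle is symmetric, as the coordinate directions \<open>\<plusminus>1\<close> are both compatible
  with the direction 2, and hence a coboundary; in dimension 1 the monoid is that of the naturals or the integers.
  Subtracting a function of the charge makes \<open>f\<close> additive over distant configurations, and then the
  effect of removing a particle at \<open>x\<close> is not felt far from \<open>x\<close>, as particles far away can be moved off to infinity:
  this says that \<open>f\<close> is uniform.

  If \<open>\<omega>\<close> is invariant, then \<open>g f - f\<close> is a function of the charge, additive, hence given by a conserved
  quantity. So \<open>f\<close> determines a homomorphism from \<open>G\<close> to the conserved quantities, that is, a \<open>d\<close>-tuple
  of them, and subtracting the corresponding combination of the \<open>\<AA>\<^sup>j\<^sub>\<xi>\<close> makes \<open>f\<close> invariant. The sum is direct
  because \<open>\<AA>\<^sup>j\<^sub>\<xi>\<close> changes by \<open>\<xi>\<close> when a particle is translated by \<open>\<sigma>\<^sub>j\<close>.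
\<close>

section \<open>Paths of configurations\<close>

text \<open>Particles can be moved only through finite connected sets of vertices, and such a set
  must stay away from the configuration that is to remain unaffected. The complement of a ball does
  not serve: it can be disconnected, as on a line. Half-spaces of a lattice coordinate are connected
  up to a bounded margin, so two configurations count as distant if such a coordinate separates
  them, one lying above the other. The pairing therefore depends on a direction and on an order, and
  pairings in two directions can be compared if one translation moves up in both. A coordinate and
  its negative never satisfy this and have to be compared through a second coordinate; in dimension
  one there is none, and simplicity of the interaction takes its place. Uniformity is handled
  through mixed differences: removing a particle has the same effect whether or not a given distant
  particle is present. By Moebius inversion this is equivalent to an expansion over small finite
  sets, and it can be checked for one pair of vertices at a time, in a coordinate that tells them
  apart.\<close>

locale interacting_system = multigraph X \<iota>
  for X :: "('x, 'e) pre_digraph" and \<iota> :: "'e \<Rightarrow> 'e" +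
  fixes \<phi> :: "'s \<times> 's \<Rightarrow> 's \<times> 's" and b :: 's
  assumes connected_system: "connected_graph X"
    and locally_finite: "locally_finite_graph X"
    and interaction: "is_interaction \<phi>"
    and irreducible: "irreducibly_quantified \<phi> b"
begin

section \<open>Configurations, supports and transitions\<close>

abbreviation "S \<equiv> (fin_configs X b :: ('x \<Rightarrow> 's) set)"

abbreviation step :: "('x \<Rightarrow> 's) \<Rightarrow> 'e \<Rightarrow> 'x \<Rightarrow> 's"
  where "step \<equiv> transition X \<phi>"

abbreviation steps :: "('x \<Rightarrow> 's) \<Rightarrow> 'e list \<Rightarrow> 'x \<Rightarrow> 's"
  where "steps \<equiv> transitions X \<phi>"

definition supp :: "('x \<Rightarrow> 's) \<Rightarrow> 'x set"
  where "supp \<eta> = {x \<in> verts X. \<eta> x \<noteq> b}"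

lemma finite_supp [simp]: "\<eta> \<in> S \<Longrightarrow> finite (supp \<eta>)"
  by (simp add: fin_configs_def supp_def)

lemma supp_verts: "x \<in> supp \<eta> \<Longrightarrow> x \<in> verts X"
  by (simp add: supp_def)

lemma supp_subset_verts: "supp \<eta> \<subseteq> verts X"
  by (auto simp: supp_def)

lemma not_supp: "x \<in> verts X \<Longrightarrow> x \<notin> supp \<eta> \<Longrightarrow> \<eta> x = b"
  by (simp add: supp_def)

lemma config_off: "\<eta> \<in> S \<Longrightarrow> x \<notin> verts X \<Longrightarrow> \<eta> x = undefined"
  by (auto simp: fin_configs_def configs_def)

lemma in_S_iff: "\<eta> \<in> S \<longleftrightarrow> (\<forall>x. x \<notin> verts X \<longrightarrow> \<eta> x = undefined) \<and> finite (supp \<eta>)"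
  by (auto simp: fin_configs_def configs_def supp_def PiE_def extensional_def)

lemma config_eqI:
  "\<eta> \<in> S \<Longrightarrow> \<zeta> \<in> S \<Longrightarrow> (\<And>x. x \<in> verts X \<Longrightarrow> \<eta> x = \<zeta> x) \<Longrightarrow> \<eta> = \<zeta>"
  by (metis config_off ext)

lemma update_in_S: "\<eta> \<in> S \<Longrightarrow> x \<in> verts X \<Longrightarrow> \<eta>(x := s) \<in> S"
proof -
  assume a: "\<eta> \<in> S" "x \<in> verts X"
  have "supp (\<eta>(x := s)) \<subseteq> insert x (supp \<eta>)" by (auto simp: supp_def)
  with a show ?thesis
    by (auto simp: in_S_iff finite_subset)
qed

lemma step_in_S: "\<eta> \<in> S \<Longrightarrow> e \<in> arcs X \<Longrightarrow> step \<eta> e \<in> S"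
  by (simp add: transition_def update_in_S)

lemma steps_Nil [simp]: "steps \<eta> [] = \<eta>"
  and steps_Cons [simp]: "steps \<eta> (e # es) = steps (step \<eta> e) es"
  and steps_append [simp]: "steps \<eta> (es @ es') = steps (steps \<eta> es) es'"
  by (simp_all add: transitions_def)

lemma steps_in_S: "\<eta> \<in> S \<Longrightarrow> set es \<subseteq> arcs X \<Longrightarrow> steps \<eta> es \<in> S"
  by (induction es arbitrary: \<eta>) (auto simp: step_in_S)

lemma step_off: "x \<noteq> tail X e \<Longrightarrow> x \<noteq> head X e \<Longrightarrow> step \<eta> e x = \<eta> x"
  by (simp add: transition_def)

lemma step_agree:
  assumes "x \<noteq> tail X e \<and> x \<noteq> head X e \<Longrightarrow> \<eta> x = \<zeta> x"
    and "\<eta> (tail X e) = \<zeta> (tail X e)" "\<eta> (head X e) = \<zeta> (head X e)"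
  shows "step \<eta> e x = step \<zeta> e x"
  using assms by (auto simp: transition_def)

lemma step_inversion:
  assumes "e \<in> arcs X" "step \<eta> e \<noteq> \<eta>"
  shows "step (step \<eta> e) (\<iota> e) = \<eta>"
proof -
  have ne: "tail X e \<noteq> head X e" using assms by (auto simp: transition_def)
  let ?p = "(\<eta> (tail X e), \<eta> (head X e))"
  have "\<phi> ?p \<noteq> ?p"
  proof
    assume eq: "\<phi> ?p = ?p"
    have "step \<eta> e = \<eta>" unfolding transition_def eq by (auto simp: ne)
    with assms show False by simp
  qed
  then have "prod.swap (\<phi> (prod.swap (\<phi> ?p))) = ?p"
    using interaction unfolding is_interaction_def by (metis comp_apply)
  then have "\<phi> (snd (\<phi> ?p), fst (\<phi> ?p)) = (\<eta> (head X e), \<eta> (tail X e))"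
    by (metis prod.swap_def swap_simp swap_swap)
  then show ?thesis
    using ne assms(1) by (auto simp: transition_def tail_inversion head_inversion fun_eq_iff)
qed

section \<open>Connectivity inside sets of vertices\<close>

definition adj :: "'x set \<Rightarrow> ('x \<times> 'x) set"
  where "adj V = {(tail X e, head X e) |e. e \<in> arcs X \<and> tail X e \<in> V \<and> head X e \<in> V}"

definition conn :: "'x set \<Rightarrow> bool"
  where "conn V \<longleftrightarrow> V \<subseteq> verts X \<and> (\<forall>x \<in> V. \<forall>y \<in> V. (x, y) \<in> (adj V)\<^sup>*)"

lemma adj_mono: "V \<subseteq> W \<Longrightarrow> adj V \<subseteq> adj W"
  by (auto simp: adj_def)

lemma adj_rtrancl_mono: "V \<subseteq> W \<Longrightarrow> (x, y) \<in> (adj V)\<^sup>* \<Longrightarrow> (x, y) \<in> (adj W)\<^sup>*"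
  using rtrancl_mono[OF adj_mono] by blast

lemma adj_sym: "(x, y) \<in> adj V \<Longrightarrow> (y, x) \<in> adj V"
proof -
  assume "(x, y) \<in> adj V"
  then obtain e where e: "e \<in> arcs X" "tail X e \<in> V" "head X e \<in> V" "x = tail X e" "y = head X e"
    by (auto simp: adj_def)
  then show ?thesis
    unfolding adj_def
    by (intro CollectI exI[of _ "\<iota> e"]) (auto simp: tail_inversion head_inversion inversion_closed)
qed

lemma conn_UN:
  assumes "conn W" "\<And>i. i \<in> I \<Longrightarrow> conn (V i)" "\<And>i. i \<in> I \<Longrightarrow> V i \<inter> W \<noteq> {}"
  shows "conn (W \<union> (\<Union>i \<in> I. V i))"
proof -
  let ?U = "W \<union> (\<Union>i \<in> I. V i)"
  have to_W: "\<exists>w \<in> W. (x, w) \<in> (adj ?U)\<^sup>* \<and> (w, x) \<in> (adj ?U)\<^sup>*" if x: "x \<in> ?U" for x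
  proof (cases "x \<in> W")
    case False
    then obtain i where i: "i \<in> I" "x \<in> V i" using x by auto
    then obtain w where w: "w \<in> V i" "w \<in> W" using assms(3) by blast
    have "(x, w) \<in> (adj (V i))\<^sup>*" "(w, x) \<in> (adj (V i))\<^sup>*"
      using assms(2)[OF i(1)] i w by (auto simp: conn_def)
    then show ?thesis using i w(2) by (blast intro: adj_rtrancl_mono[of "V i" ?U])
  qed auto
  have "(x, y) \<in> (adj ?U)\<^sup>*" if xU: "x \<in> ?U" and yU: "y \<in> ?U" for x y
  proof -
    obtain w w' where "w \<in> W" "w' \<in> W" "(x, w) \<in> (adj ?U)\<^sup>*" "(w', y) \<in> (adj ?U)\<^sup>*"
      using to_W[OF xU] to_W[OF yU] by blast
    moreover have "(w, w') \<in> (adj ?U)\<^sup>*"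
      using assms(1) calculation by (auto simp: conn_def intro: adj_rtrancl_mono[of W])
    ultimately show ?thesis by (meson rtrancl_trans)
  qed
  then show ?thesis using assms(1,2) by (auto simp: conn_def)
qed

lemma conn_Un: "conn V \<Longrightarrow> conn W \<Longrightarrow> V \<inter> W \<noteq> {} \<Longrightarrow> conn (V \<union> W)"
  using conn_UN[of V "{()}" "\<lambda>_. W"] by (simp add: inf_commute)

lemma conn_singleton: "x \<in> verts X \<Longrightarrow> conn {x}"
  by (auto simp: conn_def)

lemma conn_edge: "e \<in> arcs X \<Longrightarrow> conn {tail X e, head X e}"
proof -
  assume e: "e \<in> arcs X"
  then have "(tail X e, head X e) \<in> adj {tail X e, head X e}" by (auto simp: adj_def)
  with e show ?thesis using adj_sym by (auto simp: conn_def)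
qed

lemma finite_conn_pair:
  assumes "x \<in> verts X" "y \<in> verts X"
  shows "\<exists>V. finite V \<and> conn V \<and> x \<in> V \<and> y \<in> V"
proof -
  obtain p where p: "pre_digraph.awalk (X \<restriction> verts X) x p y"
    using connected_system assms unfolding connected_graph_def connected_subset_def by blast
  have "pre_digraph.cas (X \<restriction> verts X) x p y" "set p \<subseteq> arcs X"
    using p by (auto simp: pre_digraph.awalk_def)
  then show ?thesis using assms(1)
  proof (induction p arbitrary: x)
    case Nil
    then show ?case by (auto simp: pre_digraph.cas.simps intro: exI[of _ "{x}"] conn_singleton)
  next
    case (Cons e p)
    then have e: "e \<in> arcs X" "tail X e = x" by (auto simp: pre_digraph.cas.simps)
    have "\<exists>V. finite V \<and> conn V \<and> head X e \<in> V \<and> y \<in> V"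
      using Cons by (intro Cons.IH) (auto simp: pre_digraph.cas.simps)
    then obtain V where V: "finite V" "conn V" "head X e \<in> V" "y \<in> V" by blast
    have "conn ({tail X e, head X e} \<union> V)" using V e by (intro conn_Un conn_edge) auto
    with V e show ?case by (intro exI[of _ "{tail X e, head X e} \<union> V"]) auto
  qed
qed

text \<open>Nonemptiness of \<open>V\<close> strengthens the induction: the next point of
  \<open>A\<close> needs a vertex of \<open>V\<close> to be linked to.\<close>

lemma finite_conn_cover:
  assumes "finite A" "A \<subseteq> verts X"
  shows "\<exists>V. finite V \<and> conn V \<and> A \<subseteq> V \<and> V \<noteq> {}"
proof -
  obtain x0 where x0: "x0 \<in> verts X" using connected_system by (auto simp: connected_graph_def)
  show ?thesis using assms
  proof (induction A rule: finite_induct)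
    case empty
    then show ?case using x0 conn_singleton by (intro exI[of _ "{x0}"]) auto
  next
    case (insert x A)
    then obtain V v where V: "finite V" "conn V" "A \<subseteq> V" "v \<in> V" by auto
    then have "v \<in> verts X" by (auto simp: conn_def)
    with insert obtain W where W: "finite W" "conn W" "x \<in> W" "v \<in> W"
      using finite_conn_pair[of x v] by auto
    then have "conn (V \<union> W)" using V by (intro conn_Un) auto
    with V W show ?case by (intro exI[of _ "V \<union> W"]) auto
  qed
qed

section \<open>Charges, and paths between configurations of equal charge\<close>

definition charge :: "('x \<Rightarrow> 's) \<Rightarrow> ('s \<Rightarrow> real) \<Rightarrow> real"
  where "charge \<eta> = (\<lambda>\<xi>. if \<xi> \<in> Consv \<phi> b then \<Sum>x \<in> supp \<eta>. \<xi> (\<eta> x) else 0)"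

lemma Consv_base: "\<xi> \<in> Consv \<phi> b \<Longrightarrow> \<xi> b = 0"
  by (simp add: Consv_def)

lemma charge_superset:
  assumes "\<xi> \<in> Consv \<phi> b" "finite A" "supp \<eta> \<subseteq> A" "A \<subseteq> verts X"
  shows "charge \<eta> \<xi> = (\<Sum>x \<in> A. \<xi> (\<eta> x))"
  unfolding charge_def using assms
  by (auto intro!: sum.mono_neutral_left simp: Consv_base not_supp subset_iff)

text \<open>This is the reason for the value 0 off \<open>Consv \<phi> b\<close>: charges can be
  compared, and later added, as functions.\<close>

lemma charge_eqI:
  "(\<And>\<xi>. \<xi> \<in> Consv \<phi> b \<Longrightarrow> charge \<eta> \<xi> = charge \<zeta> \<xi>) \<Longrightarrow> charge \<eta> = charge \<zeta>"
  unfolding charge_def by (rule ext) auto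

lemma charge_step:
  assumes "\<eta> \<in> S" "e \<in> arcs X"
  shows "charge (step \<eta> e) = charge \<eta>"
proof (rule charge_eqI)
  fix \<xi> assume \<xi>: "\<xi> \<in> Consv \<phi> b"
  let ?t = "tail X e" let ?h = "head X e"
  \<comment> \<open>The support may change under the step, so both charges are expanded over one
    finite set that contains both supports and the ends of \<open>e\<close>.\<close>
  define A where "A = supp \<eta> \<union> supp (step \<eta> e) \<union> {?t, ?h}"
  have A: "finite A" "A \<subseteq> verts X"
    using assms step_in_S[OF assms] by (auto simp: A_def supp_verts)
  have 1: "charge \<eta> \<xi> = (\<Sum>x \<in> A. \<xi> (\<eta> x))"
    using \<xi> A by (intro charge_superset) (auto simp: A_def)
  have 2: "charge (step \<eta> e) \<xi> = (\<Sum>x \<in> A. \<xi> (step \<eta> e x))"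
    using \<xi> A by (intro charge_superset) (auto simp: A_def)
  show "charge (step \<eta> e) \<xi> = charge \<eta> \<xi>"
  proof (cases "?t = ?h")
    case True
    then show ?thesis by (simp add: transition_def)
  next
    case False
    have split: "(\<Sum>x \<in> A. g x) = g ?t + g ?h + (\<Sum>x \<in> A - {?t, ?h}. g x)" for g :: "'x \<Rightarrow> real"
    proof -
      have "(\<Sum>x \<in> A. g x) = (\<Sum>x \<in> A - {?t, ?h}. g x) + (\<Sum>x \<in> {?t, ?h}. g x)"
        using A by (intro sum.subset_diff) (auto simp: A_def)
      then show ?thesis using False by simp
    qed
    have "\<xi> (\<eta> ?t) + \<xi> (\<eta> ?h) = \<xi> (step \<eta> e ?t) + \<xi> (step \<eta> e ?h)"
      using \<xi> False by (auto simp: Consv_def transition_def)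
    moreover have "(\<Sum>x \<in> A - {?t, ?h}. \<xi> (step \<eta> e x)) = (\<Sum>x \<in> A - {?t, ?h}. \<xi> (\<eta> x))"
      by (intro sum.cong) (auto simp: step_off)
    ultimately show ?thesis unfolding 1 2 by (subst (1 2) split) simp
  qed
qed

lemma finite_inner_arcs:
  assumes "finite V" "V \<subseteq> verts X"
  shows "finite {e \<in> arcs X. tail X e \<in> V \<and> head X e \<in> V}"
proof -
  have "finite (\<Union>x \<in> V. {e \<in> arcs X. tail X e = x})"
    using assms locally_finite by (auto simp: locally_finite_graph_def)
  then show ?thesis by (rule rev_finite_subset) auto
qed

text \<open>Irreducible quantification speaks of graphs on natural numbers, so a finite piece of \<open>X\<close>
  has to be copied there.\<close>

lemma path_exists:
  assumes V: "finite V" "conn V"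
    and S: "\<eta> \<in> S" "\<zeta> \<in> S"
    and off: "\<And>x. x \<in> verts X \<Longrightarrow> x \<notin> V \<Longrightarrow> \<eta> x = \<zeta> x"
    and ch: "charge \<eta> = charge \<zeta>"
  shows "\<exists>es. set es \<subseteq> {e \<in> arcs X. tail X e \<in> V \<and> head X e \<in> V} \<and> steps \<eta> es = \<zeta>"
proof (cases "V = {}")
  \<comment> \<open>The graph without vertices is not a locale, so irreducible quantification says
    nothing about it.\<close>
  case True
  then have "\<eta> = \<zeta>" using S off by (auto intro: config_eqI)
  then show ?thesis by (intro exI[of _ "[]"]) auto
next
  case False
  define A where "A = {e \<in> arcs X. tail X e \<in> V \<and> head X e \<in> V}"
  have VX: "V \<subseteq> verts X" using V by (simp add: conn_def)
  have A: "finite A" unfolding A_def using V VX by (intro finite_inner_arcs)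
  obtain h :: "'x \<Rightarrow> nat" where h: "inj_on h V"
    using V by (meson countable_finite countableE)
  obtain k :: "'e \<Rightarrow> nat" where k: "inj_on k A"
    using A by (meson countable_finite countableE)
  define h' where "h' = the_inv_into V h"
  define k' where "k' = the_inv_into A k"
  have h': "h' (h x) = x" if "x \<in> V" for x using h that by (simp add: h'_def the_inv_into_f_f)
  have k': "k' (k e) = e" if "e \<in> A" for e using k that by (simp add: k'_def the_inv_into_f_f)
  have Aarcs: "e \<in> arcs X" "tail X e \<in> V" "head X e \<in> V" if "e \<in> A" for e
    using that by (auto simp: A_def)
  have A\<iota>: "\<iota> e \<in> A" if "e \<in> A" for e
    using Aarcs[OF that] by (auto simp: A_def tail_inversion head_inversion inversion_closed)
  define L :: "(nat, nat) pre_digraph"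
    where "L = \<lparr>verts = h ` V, arcs = k ` A, tail = (\<lambda>m. h (tail X (k' m))), head = (\<lambda>m. h (head X (k' m)))\<rparr>"
  define \<iota>L where "\<iota>L = (\<lambda>m. k (\<iota> (k' m)))"
  have L [simp]: "verts L = h ` V" "arcs L = k ` A" "tail L m = h (tail X (k' m))"
    "head L m = h (head X (k' m))" for m by (auto simp: L_def)
  have mg: "multigraph L \<iota>L"
    by unfold_locales
      (auto simp: k' A\<iota> Aarcs \<iota>L_def inversion_inversion tail_inversion head_inversion)
  have fin: "fin_digraph L"
  proof -
    interpret L: multigraph L \<iota>L by (rule mg)
    show ?thesis by unfold_locales (auto simp: V A)
  qed
  have conL: "connected_graph L"
  proof -
    have "\<exists>p. pre_digraph.awalk (L \<restriction> verts L) (h x) p (h y)" if "x \<in> V" "y \<in> V" for x y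
    proof -
      have "(x, y) \<in> (adj V)\<^sup>*" using V that by (auto simp: conn_def)
      then show ?thesis using that(1)
      proof (induction rule: converse_rtrancl_induct)
        case base
        then show ?case
          by (intro exI[of _ "[]"]) (auto simp: pre_digraph.awalk_def pre_digraph.cas.simps)
      next
        case (step x z)
        then obtain e where e: "e \<in> A" "x = tail X e" "z = head X e" by (auto simp: adj_def A_def)
        then have "z \<in> V" using Aarcs by auto
        then obtain p where "pre_digraph.awalk (L \<restriction> verts L) (h z) p (h y)" using step by auto
        then show ?case using e Aarcs[OF e(1)]
          by (intro exI[of _ "k e # p"]) (auto simp: pre_digraph.awalk_def pre_digraph.cas.simps k')
      qed
    qed
    then show ?thesis using False by (auto simp: connected_graph_def connected_subset_def)
  qed
  have "locally_finite_graph L" using A by (auto simp: locally_finite_graph_def)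
  then have loc: "graph_locale L \<iota>L" using mg conL by (simp add: graph_locale_def)
  define tr :: "('x \<Rightarrow> 's) \<Rightarrow> nat \<Rightarrow> 's" where "tr \<zeta> = (\<lambda>m \<in> h ` V. \<zeta> (h' m))" for \<zeta>
  have tr: "tr \<zeta> (h x) = \<zeta> x" if "x \<in> V" for \<zeta> x using that by (simp add: tr_def h')
  have cfg: "tr \<zeta> \<in> configs L" for \<zeta> by (auto simp: configs_def tr_def)
  \<comment> \<open>Only the total charges are known to agree; the part outside \<open>V\<close> is
    common to both configurations and cancels.\<close>
  have sums: "(\<Sum>x \<in> verts L. \<xi> (tr \<eta> x)) = (\<Sum>x \<in> verts L. \<xi> (tr \<zeta> x))" if \<xi>: "\<xi> \<in> Consv \<phi> b" for \<xi>
  proof -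
    define B where "B = V \<union> supp \<eta> \<union> supp \<zeta>"
    have B: "finite B" "B \<subseteq> verts X" using V VX S by (auto simp: B_def supp_verts)
    have "charge \<eta> \<xi> = (\<Sum>x \<in> B. \<xi> (\<eta> x))" "charge \<zeta> \<xi> = (\<Sum>x \<in> B. \<xi> (\<zeta> x))"
      using \<xi> B by (auto intro!: charge_superset simp: B_def)
    then have "(\<Sum>x \<in> B. \<xi> (\<eta> x)) = (\<Sum>x \<in> B. \<xi> (\<zeta> x))" using ch by simp
    moreover have "(\<Sum>x \<in> B. g x) = (\<Sum>x \<in> B - V. g x) + (\<Sum>x \<in> V. g x)" for g :: "'x \<Rightarrow> real"
      using B by (intro sum.subset_diff) (auto simp: B_def)
    moreover have "(\<Sum>x \<in> B - V. \<xi> (\<eta> x)) = (\<Sum>x \<in> B - V. \<xi> (\<zeta> x))"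
      using off B by (intro sum.cong) auto
    ultimately have "(\<Sum>x \<in> V. \<xi> (\<eta> x)) = (\<Sum>x \<in> V. \<xi> (\<zeta> x))" by simp
    then show ?thesis using h by (simp add: sum.reindex tr)
  qed
  obtain es where es: "set es \<subseteq> k ` A" "transitions L \<phi> (tr \<eta>) es = tr \<zeta>"
    using irreducible loc fin cfg[of \<eta>] cfg[of \<zeta>] sums unfolding irreducibly_quantified_def
    by (metis L(2))
  have tr_step: "tr (step \<theta> e) = transition L \<phi> (tr \<theta>) (k e)" if e: "e \<in> A" for \<theta> e
  proof
    fix m
    have inj: "h x = h y \<longleftrightarrow> x = y" if "x \<in> V" "y \<in> V" for x y
      using h that by (auto simp: inj_on_def)
    show "tr (step \<theta> e) m = transition L \<phi> (tr \<theta>) (k e) m"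
    proof (cases "m \<in> h ` V")
      case True
      then obtain x where "x \<in> V" "m = h x" by auto
      then show ?thesis using Aarcs[OF e] e
        by (auto simp: transition_def tr k' inj)
    next
      case False
      then have "m \<noteq> h (tail X e)" "m \<noteq> h (head X e)" using Aarcs[OF e] by auto
      with False show ?thesis using e by (simp add: transition_def k' tr_def)
    qed
  qed
  have tr_steps: "tr (steps \<theta> (map k' es)) = transitions L \<phi> (tr \<theta>) es" for \<theta>
    using es(1)
  proof (induction es arbitrary: \<theta>)
    case (Cons m es)
    then obtain e where "e \<in> A" "m = k e" by auto
    with Cons show ?case by (simp add: tr_step transitions_def k')
  qed (simp add: transitions_def)
  have sub: "set (map k' es) \<subseteq> A" using es(1) k' by auto
  have off_steps: "steps \<theta> fs x = \<theta> x" if "set fs \<subseteq> A" "x \<notin> V" for fs \<theta> x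
    using that
  proof (induction fs arbitrary: \<theta>)
    case (Cons e fs)
    then have "x \<noteq> tail X e" "x \<noteq> head X e" using Aarcs[of e] by auto
    with Cons show ?case by (simp add: step_off)
  qed simp
  have "steps \<eta> (map k' es) = \<zeta>"
  proof (rule config_eqI)
    show "steps \<eta> (map k' es) \<in> S" using S sub by (intro steps_in_S) (auto simp: A_def)
    show "steps \<eta> (map k' es) x = \<zeta> x" if "x \<in> verts X" for x
    proof (cases "x \<in> V")
      case True
      then show ?thesis by (metis tr tr_steps es(2))
    next
      case False
      then show ?thesis using off_steps[OF sub] off that by simp
    qed
  qed (rule S)
  with sub show ?thesis unfolding A_def by blast
qed

lemma path_exists_global:
  assumes "\<eta> \<in> S" "\<zeta> \<in> S" "charge \<eta> = charge \<zeta>"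
  shows "\<exists>es. set es \<subseteq> arcs X \<and> steps \<eta> es = \<zeta>"
proof -
  obtain V where V: "finite V" "conn V" "supp \<eta> \<union> supp \<zeta> \<subseteq> V"
    using finite_conn_cover[of "supp \<eta> \<union> supp \<zeta>"] assms supp_subset_verts by auto
  have "\<exists>es. set es \<subseteq> {e \<in> arcs X. tail X e \<in> V \<and> head X e \<in> V} \<and> steps \<eta> es = \<zeta>"
  proof (rule path_exists[OF V(1,2) assms(1,2) _ assms(3)])
    fix x assume "x \<in> verts X" "x \<notin> V"
    then have "\<eta> x = b" "\<zeta> x = b" using V(3) by (auto intro: not_supp)
    then show "\<eta> x = \<zeta> x" by simp
  qed
  then show ?thesis by blast
qed

end

section \<open>Uniform functions and local gradients\<close>

definition moebius :: "('a set \<Rightarrow> real) \<Rightarrow> 'a set \<Rightarrow> real"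
  where "moebius g \<Lambda> = (\<Sum>A \<in> Pow \<Lambda>. (-1) ^ card (\<Lambda> - A) * g A)"

lemma sum_Pow_insert:
  fixes g :: "'a set \<Rightarrow> real"
  assumes "finite \<Lambda>" "x \<notin> \<Lambda>"
  shows "(\<Sum>A \<in> Pow (insert x \<Lambda>). g A) = (\<Sum>A \<in> Pow \<Lambda>. g A + g (insert x A))"
proof -
  have "inj_on (insert x) (Pow \<Lambda>)" using assms(2) by (intro inj_onI) (metis PowD insert_ident subsetD)
  moreover have "Pow \<Lambda> \<inter> insert x ` Pow \<Lambda> = {}" using assms(2) by auto
  ultimately show ?thesis
    using assms(1) by (simp add: Pow_insert sum.union_disjoint sum.reindex sum.distrib)
qed

text \<open>Subsets with and without \<open>x\<close> are paired. Applied twice, this shows that the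
  transform over a set containing \<open>x\<close> and \<open>y\<close> is a transform of mixed
  differences in \<open>x\<close> and \<open>y\<close>.\<close>

lemma moebius_insert:
  assumes "finite \<Lambda>" "x \<notin> \<Lambda>"
  shows "moebius g (insert x \<Lambda>) = moebius (\<lambda>A. g (insert x A) - g A) \<Lambda>"
proof -
  have "(-1) ^ card (insert x \<Lambda> - A) * g A + (-1) ^ card (insert x \<Lambda> - insert x A) * g (insert x A)
      = (-1) ^ card (\<Lambda> - A) * (g (insert x A) - g A)" if "A \<in> Pow \<Lambda>" for A
  proof -
    have "insert x \<Lambda> - A = insert x (\<Lambda> - A)" "insert x \<Lambda> - insert x A = \<Lambda> - A"
      using assms that by auto
    then show ?thesis using assms by (simp add: algebra_simps)
  qed
  then show ?thesis
    unfolding moebius_def sum_Pow_insert[OF assms] by (intro sum.cong) auto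
qed

lemma moebius_cong: "(\<And>A. A \<subseteq> \<Lambda> \<Longrightarrow> g A = g' A) \<Longrightarrow> moebius g \<Lambda> = moebius g' \<Lambda>"
  unfolding moebius_def by (intro sum.cong) auto

lemma moebius_eq_0: "(\<And>A. A \<subseteq> \<Lambda> \<Longrightarrow> g A = 0) \<Longrightarrow> moebius g \<Lambda> = 0"
  unfolding moebius_def by (intro sum.neutral) auto

text \<open>In the induction the terms for \<open>\<Lambda>\<close> and
  \<open>insert x \<Lambda>\<close> add up to the transform of
  \<open>\<lambda>A. g (insert x A)\<close>, so the hypothesis is applied to this shifted
  function.\<close>

lemma moebius_inversion:
  assumes "finite U"
  shows "(\<Sum>\<Lambda> \<in> Pow U. moebius g \<Lambda>) = g U"
  using assms
proof (induction U arbitrary: g rule: finite_induct)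
  case empty
  then show ?case by (simp add: moebius_def)
next
  case (insert x U)
  have "(\<Sum>\<Lambda> \<in> Pow (insert x U). moebius g \<Lambda>)
      = (\<Sum>\<Lambda> \<in> Pow U. moebius g \<Lambda> + moebius (\<lambda>A. g (insert x A) - g A) \<Lambda>)"
    unfolding sum_Pow_insert[OF insert.hyps]
    using insert.hyps by (intro sum.cong refl) (subst moebius_insert, auto intro: finite_subset)
  also have "\<dots> = (\<Sum>\<Lambda> \<in> Pow U. moebius (\<lambda>A. g (insert x A)) \<Lambda>)"
    by (intro sum.cong refl) (simp add: moebius_def sum.distrib[symmetric] algebra_simps)
  finally show ?case using insert.IH by simp
qed

section \<open>Graph distance\<close>

lemma gdist_le_iff:
  "gdist X x y \<le> enat n \<longleftrightarrow> (\<exists>p. pre_digraph.awalk X x p y \<and> length p \<le> n)"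
proof
  let ?A = "(\<lambda>p. enat (length p)) ` {p. pre_digraph.awalk X x p y}"
  assume le: "gdist X x y \<le> enat n"
  \<comment> \<open>An infimum of extended naturals that is not infinite belongs to a nonempty set
    and is attained, hence comes from an actual walk.\<close>
  then have "Inf ?A \<noteq> \<infinity>" unfolding gdist_def by (metis enat_ile enat.distinct(2))
  then have "?A \<noteq> {}" by (metis Inf_enat_def)
  then have "Inf ?A \<in> ?A" unfolding Inf_enat_def by (simp only: if_False) (meson LeastI ex_in_conv)
  then show "\<exists>p. pre_digraph.awalk X x p y \<and> length p \<le> n"
    using le unfolding gdist_def by auto
next
  assume "\<exists>p. pre_digraph.awalk X x p y \<and> length p \<le> n"
  then obtain p where "pre_digraph.awalk X x p y" "length p \<le> n" by blast
  then show "gdist X x y \<le> enat n"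
    unfolding gdist_def by (intro INF_lower2[of p]) auto
qed

lemma depends_onD:
  "depends_on X b \<Lambda> f \<Longrightarrow> \<eta> \<in> fin_configs X b \<Longrightarrow> \<zeta> \<in> fin_configs X b
    \<Longrightarrow> (\<And>x. x \<in> \<Lambda> \<Longrightarrow> \<eta> x = \<zeta> x) \<Longrightarrow> f \<eta> = f \<zeta>"
  unfolding depends_on_def by blast

lemma depends_onI:
  "(\<And>\<eta> \<zeta>. \<eta> \<in> fin_configs X b \<Longrightarrow> \<zeta> \<in> fin_configs X b \<Longrightarrow> \<forall>x \<in> \<Lambda>. \<eta> x = \<zeta> x \<Longrightarrow> f \<eta> = f \<zeta>)
    \<Longrightarrow> depends_on X b \<Lambda> f"
  unfolding depends_on_def by blast

lemma depends_on_mono: "depends_on X b \<Lambda> f \<Longrightarrow> \<Lambda> \<subseteq> \<Lambda>' \<Longrightarrow> depends_on X b \<Lambda>' f"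
  unfolding depends_on_def by blast

context interacting_system
begin

lemma gdist_self: "x \<in> verts X \<Longrightarrow> gdist X x x \<le> enat n"
  unfolding gdist_le_iff by (intro exI[of _ "[]"]) (simp add: awalk_Nil_iff)

lemma gdist_Cons:
  "e \<in> arcs X \<Longrightarrow> gdist X (head X e) y \<le> enat n \<Longrightarrow> gdist X (tail X e) y \<le> enat (Suc n)"
  unfolding gdist_le_iff by (metis awalk_Cons_iff length_Cons Suc_le_mono)

lemma gdist_finite:
  assumes "x \<in> verts X" "y \<in> verts X"
  shows "\<exists>n. gdist X x y \<le> enat n"
proof -
  obtain p where "pre_digraph.awalk (X \<restriction> verts X) x p y"
    using connected_system assms unfolding connected_graph_def connected_subset_def by blast
  then have "pre_digraph.cas (X \<restriction> verts X) x p y" "set p \<subseteq> arcs X"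
    by (auto simp: pre_digraph.awalk_def)
  moreover have "pre_digraph.cas (X \<restriction> verts X) x p y = cas x p y"
    by (induction p arbitrary: x) (auto simp: pre_digraph.cas.simps)
  ultimately have "awalk x p y" using assms by (simp add: awalk_def)
  then show ?thesis unfolding gdist_le_iff by blast
qed

lemma gdist_lipschitz:
  fixes q :: "'x \<Rightarrow> int"
  assumes L: "\<And>e. e \<in> arcs X \<Longrightarrow> \<bar>q (head X e) - q (tail X e)\<bar> \<le> L" and "0 \<le> L"
    and "gdist X x y \<le> enat n"
  shows "\<bar>q x - q y\<bar> \<le> L * int n"
proof -
  obtain p where p: "awalk x p y" "length p \<le> n" using assms(3) unfolding gdist_le_iff by blast
  from p(1) have "\<bar>q x - q y\<bar> \<le> L * int (length p)"
  proof (induction p arbitrary: x)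
    case (Cons e p)
    then have "awalk (head X e) p y" "e \<in> arcs X" "x = tail X e" by (auto simp: awalk_Cons_iff)
    with Cons.IH L[of e] show ?case by (fastforce simp: algebra_simps)
  qed (simp add: awalk_Nil_iff)
  also have "\<dots> \<le> L * int n" using p(2) \<open>0 \<le> L\<close> by (intro mult_left_mono) auto
  finally show ?thesis .
qed

section \<open>Uniform functions as functions of short range\<close>

definition cut :: "('x \<Rightarrow> 's) \<Rightarrow> 'x set \<Rightarrow> 'x \<Rightarrow> 's"
  where "cut \<eta> A = (\<lambda>x \<in> verts X. if x \<in> A then \<eta> x else b)"

lemma cut_apply: "x \<in> verts X \<Longrightarrow> cut \<eta> A x = (if x \<in> A then \<eta> x else b)"
  by (simp add: cut_def)

lemma supp_cut [simp]: "supp (cut \<eta> A) = supp \<eta> \<inter> A"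
  by (auto simp: supp_def cut_def)

lemma cut_in_S: "\<eta> \<in> S \<Longrightarrow> cut \<eta> A \<in> S"
  unfolding in_S_iff supp_cut by (auto simp: cut_def)

lemma cut_supp: "\<eta> \<in> S \<Longrightarrow> supp \<eta> \<subseteq> A \<Longrightarrow> cut \<eta> A = \<eta>"
  by (rule config_eqI) (auto simp: cut_in_S cut_apply dest: not_supp)

lemma cut_eqI: "(\<And>x. x \<in> verts X \<Longrightarrow> x \<in> A \<Longrightarrow> \<eta> x = \<zeta> x) \<Longrightarrow> cut \<eta> A = cut \<zeta> A"
  by (auto simp: cut_def fun_eq_iff)

text \<open>The mixed difference of \<open>f\<close> under erasing \<open>x\<close> and
  \<open>y\<close> vanishes: particles further apart than \<open>R\<close> do not interact. By
  \<open>uniform_functions_iff\<close> this characterises uniformity without reference to an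
  expansion.\<close>

definition short_range :: "nat \<Rightarrow> (('x \<Rightarrow> 's) \<Rightarrow> real) \<Rightarrow> bool"
  where "short_range R f \<longleftrightarrow> (\<forall>\<eta> \<in> S. \<forall>x \<in> verts X. \<forall>y \<in> verts X. \<not> gdist X x y \<le> enat R \<longrightarrow>
    f \<eta> + f (\<eta>(x := b, y := b)) = f (\<eta>(x := b)) + f (\<eta>(y := b)))"

lemma short_range_mono: "R \<le> R' \<Longrightarrow> short_range R f \<Longrightarrow> short_range R' f"
  unfolding short_range_def by (meson enat_ord_simps(1) order_trans)

text \<open>A set of diameter at most \<open>R\<close> misses one of two vertices at larger
  distance, so every summand of the expansion has vanishing mixed difference.\<close>

lemma uniform_imp_short_range:
  assumes "f \<in> uniform_functions X b"
  shows "\<exists>R. short_range R f"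
proof -
  obtain R F where F: "\<forall>\<Lambda> \<in> small_subsets X R. F \<Lambda> \<in> local_functions X b \<Lambda>"
    and f: "\<forall>\<eta> \<in> S. f \<eta> = (\<Sum>\<Lambda> \<in> {\<Lambda> \<in> small_subsets X R. F \<Lambda> \<eta> \<noteq> 0}. F \<Lambda> \<eta>)"
    using assms unfolding uniform_functions_def by blast
  \<comment> \<open>A summand vanishes unless all of \<open>\<Lambda>\<close> is occupied. All four
    configurations can thus be expanded over the small subsets of one finite set
    \<open>U\<close>.\<close>
  have expand: "f \<eta> = (\<Sum>\<Lambda> \<in> small_subsets X R \<inter> Pow U. F \<Lambda> \<eta>)"
    if "\<eta> \<in> S" "supp \<eta> \<subseteq> U" "finite U" for \<eta> U
  proof -
    have "\<Lambda> \<subseteq> U" if \<Lambda>: "\<Lambda> \<in> small_subsets X R" "F \<Lambda> \<eta> \<noteq> 0" for \<Lambda>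
    proof
      fix x assume "x \<in> \<Lambda>"
      then have "\<eta> x \<noteq> b" "x \<in> verts X"
        using \<Lambda> F \<open>\<eta> \<in> S\<close> by (auto simp: local_functions_def small_subsets_def)
      then show "x \<in> U" using \<open>supp \<eta> \<subseteq> U\<close> by (auto simp: supp_def)
    qed
    then show ?thesis
      using f that by (auto intro!: sum.mono_neutral_left)
  qed
  have "short_range R f" unfolding short_range_def
  proof (intro ballI impI)
    fix \<eta> x y assume \<eta>: "\<eta> \<in> S" and x: "x \<in> verts X" and y: "y \<in> verts X"
      and far: "\<not> gdist X x y \<le> enat R"
    let ?I = "small_subsets X R \<inter> Pow (supp \<eta>)"
    have sub: "supp (\<eta>(x := b)) \<subseteq> supp \<eta>" "supp (\<eta>(y := b)) \<subseteq> supp \<eta>"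
      "supp (\<eta>(x := b, y := b)) \<subseteq> supp \<eta>" by (auto simp: supp_def)
    have inS: "\<eta>(x := b) \<in> S" "\<eta>(y := b) \<in> S" "\<eta>(x := b, y := b) \<in> S"
      using \<eta> x y by (auto intro!: update_in_S)
    have summand: "F \<Lambda> \<eta> + F \<Lambda> (\<eta>(x := b, y := b)) = F \<Lambda> (\<eta>(x := b)) + F \<Lambda> (\<eta>(y := b))"
      if "\<Lambda> \<in> ?I" for \<Lambda>
    proof -
      have dep: "depends_on X b \<Lambda> (F \<Lambda>)" using that F by (auto simp: local_functions_def)
      have eq: "F \<Lambda> \<zeta> = F \<Lambda> \<zeta>'" if "\<zeta> \<in> S" "\<zeta>' \<in> S" "\<And>z. z \<in> \<Lambda> \<Longrightarrow> \<zeta> z = \<zeta>' z" for \<zeta> \<zeta>'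
        using dep that unfolding depends_on_def by blast
      have "x \<notin> \<Lambda> \<or> y \<notin> \<Lambda>" using that far by (auto simp: small_subsets_def)
      then show ?thesis
      proof
        assume "x \<notin> \<Lambda>"
        then have "F \<Lambda> \<eta> = F \<Lambda> (\<eta>(x := b))" "F \<Lambda> (\<eta>(y := b)) = F \<Lambda> (\<eta>(x := b, y := b))"
          by (auto intro!: eq inS \<eta>)
        then show ?thesis by simp
      next
        assume "y \<notin> \<Lambda>"
        then have "F \<Lambda> \<eta> = F \<Lambda> (\<eta>(y := b))" "F \<Lambda> (\<eta>(x := b)) = F \<Lambda> (\<eta>(x := b, y := b))"
          by (auto intro!: eq inS \<eta>)
        then show ?thesis by simp
      qed
    qed
    show "f \<eta> + f (\<eta>(x := b, y := b)) = f (\<eta>(x := b)) + f (\<eta>(y := b))"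
      unfolding expand[OF \<eta> order_refl finite_supp[OF \<eta>]]
        expand[OF inS(1) sub(1) finite_supp[OF \<eta>]] expand[OF inS(2) sub(2) finite_supp[OF \<eta>]]
        expand[OF inS(3) sub(3) finite_supp[OF \<eta>]]
        sum.distrib[symmetric]
      using summand by (intro sum.cong) auto
  qed
  then show ?thesis ..
qed

text \<open>The expansion is forced: its terms are the Moebius transform of
  \<open>\<lambda>A. f (cut \<eta> A)\<close>. A term over a set with two distant points is built
  from mixed differences and vanishes.\<close>

lemma short_range_imp_uniform:
  assumes f: "f \<in> config_functions X b" and sr: "short_range R f"
  shows "f \<in> uniform_functions X b"
proof -
  define F where "F \<Lambda> \<eta> = (if \<eta> \<in> S then moebius (\<lambda>A. f (cut \<eta> A)) \<Lambda> else 0)" for \<Lambda> \<eta>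
  have local: "F \<Lambda> \<in> local_functions X b \<Lambda>" if "finite \<Lambda>" "\<Lambda> \<subseteq> verts X" for \<Lambda>
    unfolding local_functions_def
  proof (intro CollectI conjI ballI impI)
    show "F \<Lambda> \<in> config_functions X b" by (auto simp: config_functions_def F_def)
    show "depends_on X b \<Lambda> (F \<Lambda>)"
    proof (rule depends_onI)
      fix \<eta> \<zeta> assume a: "\<eta> \<in> S" "\<zeta> \<in> S" "\<forall>x \<in> \<Lambda>. \<eta> x = \<zeta> x"
      have "moebius (\<lambda>A. f (cut \<eta> A)) \<Lambda> = moebius (\<lambda>A. f (cut \<zeta> A)) \<Lambda>"
        using a(3) by (intro moebius_cong arg_cong[of _ _ f] cut_eqI) auto
      then show "F \<Lambda> \<eta> = F \<Lambda> \<zeta>" using a by (simp add: F_def)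
    qed
    fix \<eta> assume \<eta>: "\<eta> \<in> S" and "\<exists>x \<in> \<Lambda>. \<eta> x = b"
    then obtain x where x: "x \<in> \<Lambda>" "\<eta> x = b" by blast
    have "moebius (\<lambda>A. f (cut \<eta> A)) (insert x (\<Lambda> - {x}))
        = moebius (\<lambda>A. f (cut \<eta> (insert x A)) - f (cut \<eta> A)) (\<Lambda> - {x})"
      using that by (intro moebius_insert) auto
    also have "\<dots> = 0"
    proof (rule moebius_eq_0)
      fix A
      have "cut \<eta> (insert x A) = cut \<eta> A" using x by (auto simp: cut_def fun_eq_iff)
      then show "f (cut \<eta> (insert x A)) - f (cut \<eta> A) = 0" by simp
    qed
    finally show "F \<Lambda> \<eta> = 0" using \<eta> x by (simp add: F_def insert_absorb)
  qed
  have far: "F \<Lambda> \<eta> = 0"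
    if "finite \<Lambda>" "\<Lambda> \<subseteq> verts X" "x \<in> \<Lambda>" "y \<in> \<Lambda>" "\<not> gdist X x y \<le> enat R" "\<eta> \<in> S" for \<Lambda> \<eta> x y
  proof -
    have xy: "x \<noteq> y" using that gdist_self by blast
    define \<Lambda>' where "\<Lambda>' = \<Lambda> - {x, y}"
    have \<Lambda>: "\<Lambda> = insert x (insert y \<Lambda>')" using that by (auto simp: \<Lambda>'_def)
    have "finite \<Lambda>'" "x \<notin> insert y \<Lambda>'" "y \<notin> \<Lambda>'" using that xy by (auto simp: \<Lambda>'_def)
    then have "moebius (\<lambda>A. f (cut \<eta> A)) \<Lambda> = moebius (\<lambda>A. (f (cut \<eta> (insert x (insert y A)))
        - f (cut \<eta> (insert y A))) - (f (cut \<eta> (insert x A)) - f (cut \<eta> A))) \<Lambda>'"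
      unfolding \<Lambda> by (simp add: moebius_insert)
    also have "\<dots> = 0"
    proof (rule moebius_eq_0)
      fix A assume A: "A \<subseteq> \<Lambda>'"
      let ?\<zeta> = "cut \<eta> (insert x (insert y A))"
      have "x \<notin> A" "y \<notin> A" using A by (auto simp: \<Lambda>'_def)
      then have "cut \<eta> (insert y A) = ?\<zeta>(x := b)" "cut \<eta> (insert x A) = ?\<zeta>(y := b)"
          "cut \<eta> A = ?\<zeta>(x := b, y := b)"
        using that xy by (auto simp: cut_def fun_eq_iff)
      moreover have "f ?\<zeta> + f (?\<zeta>(x := b, y := b)) = f (?\<zeta>(x := b)) + f (?\<zeta>(y := b))"
        using sr that cut_in_S[OF \<open>\<eta> \<in> S\<close>] unfolding short_range_def by blast
      ultimately show "(f ?\<zeta> - f (cut \<eta> (insert y A))) - (f (cut \<eta> (insert x A)) - f (cut \<eta> A)) = 0"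
        by simp
    qed
    finally show ?thesis using that by (simp add: F_def)
  qed
  have "f \<eta> = (\<Sum>\<Lambda> \<in> {\<Lambda> \<in> small_subsets X R. F \<Lambda> \<eta> \<noteq> 0}. F \<Lambda> \<eta>)" if \<eta>: "\<eta> \<in> S" for \<eta>
  proof -
    \<comment> \<open>If \<open>F \<Lambda> \<eta>\<close> is nonzero, then \<open>local\<close>
      puts a small \<open>\<Lambda>\<close> inside the support, and \<open>far\<close> makes a
      subset of the support small.\<close>
    have "{\<Lambda> \<in> small_subsets X R. F \<Lambda> \<eta> \<noteq> 0} = {\<Lambda> \<in> Pow (supp \<eta>). F \<Lambda> \<eta> \<noteq> 0}"
    proof (intro equalityI subsetI; clarsimp)
      fix \<Lambda> x assume \<Lambda>: "\<Lambda> \<in> small_subsets X R" "F \<Lambda> \<eta> \<noteq> 0" "x \<in> \<Lambda>"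
      then have "F \<Lambda> \<in> local_functions X b \<Lambda>" "x \<in> verts X"
        using local by (auto simp: small_subsets_def)
      with \<Lambda> \<eta> show "x \<in> supp \<eta>" by (auto simp: local_functions_def supp_def)
    next
      fix \<Lambda> assume "\<Lambda> \<subseteq> supp \<eta>" "F \<Lambda> \<eta> \<noteq> 0"
      then show "\<Lambda> \<in> small_subsets X R"
        using far[of \<Lambda> _ _ \<eta>] \<eta> finite_subset[of \<Lambda> "supp \<eta>"] subset_trans[OF _ supp_subset_verts, of \<Lambda> \<eta>]
        unfolding small_subsets_def by auto
    qed
    then have "(\<Sum>\<Lambda> \<in> {\<Lambda> \<in> small_subsets X R. F \<Lambda> \<eta> \<noteq> 0}. F \<Lambda> \<eta>) = (\<Sum>\<Lambda> \<in> Pow (supp \<eta>). F \<Lambda> \<eta>)"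
      using \<eta> by (auto intro!: sum.mono_neutral_left)
    also have "\<dots> = f (cut \<eta> (supp \<eta>))"
      using \<eta> moebius_inversion[of "supp \<eta>" "\<lambda>A. f (cut \<eta> A)"] by (simp add: F_def)
    finally show ?thesis using \<eta> by (simp add: cut_supp)
  qed
  moreover have "\<forall>\<Lambda> \<in> small_subsets X R. F \<Lambda> \<in> local_functions X b \<Lambda>"
    using local by (simp add: small_subsets_def)
  ultimately show ?thesis using f unfolding uniform_functions_def by blast
qed

lemma uniform_functions_iff:
  "f \<in> uniform_functions X b \<longleftrightarrow> f \<in> config_functions X b \<and> (\<exists>R. short_range R f)"
  using uniform_imp_short_range short_range_imp_uniform by (auto simp: uniform_functions_def)

text \<open>Uniformity of a form, expressed through a primitive \<open>f\<close>. A function of the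
  charge satisfies it trivially, its gradient being zero, however far its particles interact;
  removing this ambiguity is the task of the pairings below.\<close>

definition local_gradient :: "nat \<Rightarrow> (('x \<Rightarrow> 's) \<Rightarrow> real) \<Rightarrow> bool"
  where "local_gradient R f \<longleftrightarrow> (\<forall>e \<in> arcs X.
    depends_on X b {x \<in> verts X. gdist X (tail X e) x \<le> enat R} (\<lambda>\<eta>. f (step \<eta> e) - f \<eta>))"

lemma local_gradientD:
  assumes "local_gradient R f" "e \<in> arcs X" "\<eta> \<in> S" "\<zeta> \<in> S"
    "\<And>x. x \<in> verts X \<Longrightarrow> gdist X (tail X e) x \<le> enat R \<Longrightarrow> \<eta> x = \<zeta> x"
  shows "f (step \<eta> e) - f \<eta> = f (step \<zeta> e) - f \<zeta>"
  using assms unfolding local_gradient_def depends_on_def by blast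

text \<open>Only finitely many occupied sites lie outside \<open>B\<close>, and they are erased one
  at a time.\<close>

lemma erase_all:
  fixes D :: "('x \<Rightarrow> 's) \<Rightarrow> real"
  assumes erase: "\<And>\<eta> y. \<eta> \<in> S \<Longrightarrow> y \<in> verts X \<Longrightarrow> y \<notin> B \<Longrightarrow> D (\<eta>(y := b)) = D \<eta>"
    and "\<eta> \<in> S"
  shows "D (cut \<eta> B) = D \<eta>"
proof -
  have "finite (supp \<eta> - B)" using \<open>\<eta> \<in> S\<close> by simp
  then show ?thesis using \<open>\<eta> \<in> S\<close>
  proof (induction "supp \<eta> - B" arbitrary: \<eta> rule: finite_induct)
    case empty
    then show ?case using cut_supp[of \<eta> B] by auto
  next
    case (insert y A)
    then have y: "y \<in> verts X" "y \<notin> B" by (auto simp: supp_def)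
    have "A = supp (\<eta>(y := b)) - B" using insert by (auto simp: supp_def)
    then have "D (cut (\<eta>(y := b)) B) = D (\<eta>(y := b))"
      using insert.hyps(3) insert.prems y by (simp add: update_in_S)
    moreover have "cut (\<eta>(y := b)) B = cut \<eta> B" using y by (intro cut_eqI) auto
    ultimately show ?case using erase[OF insert.prems y] by simp
  qed
qed

text \<open>\<open>short_range\<close> compares with erased sites only; the difference of its
  instances for \<open>\<eta>(x := s)\<close> and for \<open>\<eta>\<close> admits any new value at
  \<open>x\<close>.\<close>

lemma short_range_update:
  assumes "short_range R f" "\<eta> \<in> S" "x \<in> verts X" "y \<in> verts X" "\<not> gdist X x y \<le> enat R"
  shows "f (\<eta>(x := s)) - f \<eta> = f (\<eta>(x := s, y := b)) - f (\<eta>(y := b))"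
proof -
  have "f (\<eta>(x := s)) + f (\<eta>(x := s, x := b, y := b)) = f (\<eta>(x := s, x := b)) + f (\<eta>(x := s, y := b))"
    using assms update_in_S[of \<eta> x s] unfolding short_range_def by blast
  moreover have "f \<eta> + f (\<eta>(x := b, y := b)) = f (\<eta>(x := b)) + f (\<eta>(y := b))"
    using assms unfolding short_range_def by blast
  ultimately show ?thesis by simp
qed

text \<open>A transition is an update at the origin followed by one at the target. The target is one
  edge away from the origin, where the ball is centred; hence \<open>Suc R\<close>.\<close>

lemma short_range_local_gradient:
  assumes sr: "short_range R f"
  shows "local_gradient (Suc R) f"
  unfolding local_gradient_def depends_on_def
proof (intro ballI impI)
  fix e \<eta> \<zeta> assume e: "e \<in> arcs X" and S: "\<eta> \<in> S" "\<zeta> \<in> S"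
    and agree: "\<forall>x \<in> {x \<in> verts X. gdist X (tail X e) x \<le> enat (Suc R)}. \<eta> x = \<zeta> x"
  let ?B = "{x \<in> verts X. gdist X (tail X e) x \<le> enat (Suc R)}"
  let ?D = "\<lambda>\<eta>. f (step \<eta> e) - f \<eta>"
  let ?t = "tail X e" and ?h = "head X e"
  have erase: "?D (\<eta>(y := b)) = ?D \<eta>" if "\<eta> \<in> S" "y \<in> verts X" "y \<notin> ?B" for \<eta> y
  proof (cases "?t = ?h")
    case True
    then show ?thesis by (simp add: transition_def)
  next
    case False
    let ?s = "fst (\<phi> (\<eta> ?t, \<eta> ?h))" and ?s' = "snd (\<phi> (\<eta> ?t, \<eta> ?h))"
    have "\<not> gdist X ?t y \<le> enat (Suc R)" using that by simp
    then have far: "\<not> gdist X ?t y \<le> enat R" "\<not> gdist X ?h y \<le> enat R"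
      using gdist_Cons[OF e, of y R] by (auto intro: order_trans[of _ "enat R"])
    have ne: "y \<noteq> ?t" "y \<noteq> ?h" using far gdist_self that by blast+
    have v: "?t \<in> verts X" "?h \<in> verts X" using e by auto
    have "f (\<eta>(?t := ?s)) - f \<eta> = f (\<eta>(?t := ?s, y := b)) - f (\<eta>(y := b))"
      by (rule short_range_update[OF sr that(1) v(1) that(2) far(1)])
    moreover have "f (\<eta>(?t := ?s, ?h := ?s')) - f (\<eta>(?t := ?s))
        = f (\<eta>(?t := ?s, ?h := ?s', y := b)) - f (\<eta>(?t := ?s, y := b))"
      by (rule short_range_update[OF sr update_in_S[OF that(1) v(1)] v(2) that(2) far(2)])
    moreover have "step \<eta> e = \<eta>(?t := ?s, ?h := ?s')"
      "step (\<eta>(y := b)) e = \<eta>(?t := ?s, ?h := ?s', y := b)"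
      using False ne by (auto simp: transition_def fun_eq_iff)
    ultimately show ?thesis by simp
  qed
  have "?D \<eta> = ?D (cut \<eta> ?B)" by (rule erase_all[OF erase S(1), symmetric])
  also have "cut \<eta> ?B = cut \<zeta> ?B" using agree by (intro cut_eqI) auto
  also have "?D \<dots> = ?D \<zeta>" by (rule erase_all[OF erase S(2)])
  finally show "?D \<eta> = ?D \<zeta>" .
qed

text \<open>An edge inside \<open>V\<close> changes both configurations in the same way, so their
  agreement within distance \<open>R\<close> of \<open>V\<close> persists along the path and every
  step costs the same.\<close>

lemma local_move_steps:
  assumes f: "local_gradient R f" and V: "V \<subseteq> verts X"
    and es: "set es \<subseteq> {e \<in> arcs X. tail X e \<in> V \<and> head X e \<in> V}"
    and S: "\<eta> \<in> S" "\<zeta> \<in> S"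
    and agree: "\<And>x y. x \<in> V \<Longrightarrow> y \<in> verts X \<Longrightarrow> gdist X x y \<le> enat R \<Longrightarrow> \<eta> y = \<zeta> y"
  shows "f (steps \<eta> es) - f \<eta> = f (steps \<zeta> es) - f \<zeta> \<and>
    (\<forall>x \<in> V. steps \<eta> es x = steps \<zeta> es x) \<and> (\<forall>x. x \<notin> V \<longrightarrow> steps \<zeta> es x = \<zeta> x)"
  using es S agree
proof (induction es arbitrary: \<eta> \<zeta>)
  case Nil
  then show ?case using V gdist_self by auto
next
  case (Cons e es)
  then have e: "e \<in> arcs X" "tail X e \<in> V" "head X e \<in> V" by auto
  have th: "\<eta> (tail X e) = \<zeta> (tail X e)" "\<eta> (head X e) = \<zeta> (head X e)"
    using Cons.prems(4) e gdist_self[of "tail X e"] gdist_self[of "head X e"] by auto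
  have "f (step \<eta> e) - f \<eta> = f (step \<zeta> e) - f \<zeta>"
    using Cons.prems e by (intro local_gradientD[OF f]) auto
  moreover have "step \<eta> e y = step \<zeta> e y"
    if "x \<in> V" "y \<in> verts X" "gdist X x y \<le> enat R" for x y
    using Cons.prems(4)[OF that] th by (intro step_agree)
  then have "f (steps (step \<eta> e) es) - f (step \<eta> e) = f (steps (step \<zeta> e) es) - f (step \<zeta> e) \<and>
    (\<forall>x \<in> V. steps (step \<eta> e) es x = steps (step \<zeta> e) es x) \<and>
    (\<forall>x. x \<notin> V \<longrightarrow> steps (step \<zeta> e) es x = step \<zeta> e x)"
    using Cons.prems e by (intro Cons.IH) (auto simp: step_in_S)
  moreover have "step \<zeta> e x = \<zeta> x" if "x \<notin> V" for x
    using that e by (intro step_off) auto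
  ultimately show ?case by auto
qed

text \<open>The basic tool for all comparisons of distant configurations. Irreducible quantification
  provides a path inside \<open>V\<close> for the first configuration; the second one imitates it,
  at equal cost.\<close>

lemma local_move:
  assumes f: "local_gradient R f" and V: "finite V" "conn V"
    and S: "\<eta>1 \<in> S" "\<eta>2 \<in> S" "\<eta>1' \<in> S" "\<eta>2' \<in> S"
    and off: "\<And>x. x \<in> verts X \<Longrightarrow> x \<notin> V \<Longrightarrow> \<eta>1 x = \<eta>1' x"
      "\<And>x. x \<in> verts X \<Longrightarrow> x \<notin> V \<Longrightarrow> \<eta>2 x = \<eta>2' x"
    and agree: "\<And>x y. x \<in> V \<Longrightarrow> y \<in> verts X \<Longrightarrow> gdist X x y \<le> enat R \<Longrightarrow> \<eta>1 y = \<eta>2 y"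
      "\<And>x. x \<in> V \<Longrightarrow> \<eta>1' x = \<eta>2' x"
    and ch: "charge \<eta>1 = charge \<eta>1'"
  shows "f \<eta>1' - f \<eta>1 = f \<eta>2' - f \<eta>2"
proof -
  obtain es where es: "set es \<subseteq> {e \<in> arcs X. tail X e \<in> V \<and> head X e \<in> V}" "steps \<eta>1 es = \<eta>1'"
    using path_exists[OF V S(1,3) off(1) ch] by blast
  have VX: "V \<subseteq> verts X" using V by (simp add: conn_def)
  have m: "f (steps \<eta>1 es) - f \<eta>1 = f (steps \<eta>2 es) - f \<eta>2 \<and>
    (\<forall>x \<in> V. steps \<eta>1 es x = steps \<eta>2 es x) \<and> (\<forall>x. x \<notin> V \<longrightarrow> steps \<eta>2 es x = \<eta>2 x)"
    using agree(1) by (rule local_move_steps[OF f VX es(1) S(1,2)])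
  have "steps \<eta>2 es = \<eta>2'"
  proof (rule config_eqI)
    show "steps \<eta>2 es \<in> S" using es S by (intro steps_in_S) auto
    show "steps \<eta>2 es x = \<eta>2' x" if "x \<in> verts X" for x
      using m off(2)[OF that] agree(2)[of x] es(2) by (cases "x \<in> V") auto
  qed (rule S)
  then show ?thesis using m es(2) by auto
qed

text \<open>Applied to differences of primitives: two primitives of one form differ by a function of
  the charge.\<close>

lemma constant_on_charge:
  assumes "\<And>e \<eta>. e \<in> arcs X \<Longrightarrow> \<eta> \<in> S \<Longrightarrow> f (step \<eta> e) = f \<eta>"
    and "\<eta> \<in> S" "\<zeta> \<in> S" "charge \<eta> = charge \<zeta>"
  shows "f \<eta> = f \<zeta>"
proof -
  obtain es where es: "set es \<subseteq> arcs X" "steps \<eta> es = \<zeta>"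
    using path_exists_global assms by blast
  have "f (steps \<eta> es) = f \<eta>" using es(1) assms(2)
    by (induction es arbitrary: \<eta>) (auto simp: assms(1) step_in_S)
  with es show ?thesis by simp
qed

section \<open>Path sums and primitives of closed forms\<close>

definition path_sum :: "('e \<Rightarrow> ('x \<Rightarrow> 's) \<Rightarrow> real) \<Rightarrow> ('x \<Rightarrow> 's) \<Rightarrow> 'e list \<Rightarrow> real"
  where "path_sum \<omega> \<eta> es = (\<Sum>i < length es. \<omega> (es ! i) (steps \<eta> (take i es)))"

lemma path_sum_Nil [simp]: "path_sum \<omega> \<eta> [] = 0"
  by (simp add: path_sum_def)

lemma path_sum_Cons [simp]: "path_sum \<omega> \<eta> (e # es) = \<omega> e \<eta> + path_sum \<omega> (step \<eta> e) es"
  unfolding path_sum_def length_Cons lessThan_Suc_eq_insert_0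
  by (subst sum.insert) (auto simp: sum.reindex)

lemma path_sum_append [simp]:
  "path_sum \<omega> \<eta> (es @ es') = path_sum \<omega> \<eta> es + path_sum \<omega> (steps \<eta> es) es'"
  by (induction es arbitrary: \<eta>) auto

lemma path_sum_add: "path_sum (\<omega> + \<omega>') \<eta> es = path_sum \<omega> \<eta> es + path_sum \<omega>' \<eta> es"
  by (simp add: path_sum_def sum.distrib)

lemma path_sum_scale: "path_sum (c *\<^sub>R \<omega>) \<eta> es = c * path_sum \<omega> \<eta> es"
  by (simp add: path_sum_def sum_distrib_left)

lemma closed_form_iff:
  "closed_form X \<phi> b \<omega> \<longleftrightarrow> (\<forall>\<eta> \<in> S. \<forall>es. set es \<subseteq> arcs X \<and> steps \<eta> es = \<eta> \<longrightarrow> path_sum \<omega> \<eta> es = 0)"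
  by (simp add: closed_form_def path_sum_def)

lemma closed_formD:
  "closed_form X \<phi> b \<omega> \<Longrightarrow> \<eta> \<in> S \<Longrightarrow> set es \<subseteq> arcs X \<Longrightarrow> steps \<eta> es = \<eta> \<Longrightarrow> path_sum \<omega> \<eta> es = 0"
  by (simp add: closed_form_iff)

text \<open>The configurations of a given charge form one class under paths, so one base point for
  each charge suffices, and the primitive is the path sum from it.\<close>

lemma closed_form_primitive:
  assumes cl: "closed_form X \<phi> b \<omega>"
  shows "\<exists>f \<in> config_functions X b. \<forall>e \<in> arcs X. \<forall>\<eta> \<in> S. f (step \<eta> e) - f \<eta> = \<omega> e \<eta>"
proof -
  define root where "root c = (SOME \<eta>. \<eta> \<in> S \<and> charge \<eta> = c)" for c
  have root: "root (charge \<eta>) \<in> S" "charge (root (charge \<eta>)) = charge \<eta>" if "\<eta> \<in> S" for \<eta>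
    using someI[of "\<lambda>\<zeta>. \<zeta> \<in> S \<and> charge \<zeta> = charge \<eta>"] that unfolding root_def by auto
  define from_root where "from_root \<eta> = (SOME es. set es \<subseteq> arcs X \<and> steps (root (charge \<eta>)) es = \<eta>)" for \<eta>
  have from_root: "set (from_root \<eta>) \<subseteq> arcs X" "steps (root (charge \<eta>)) (from_root \<eta>) = \<eta>"
    if "\<eta> \<in> S" for \<eta>
    using someI_ex[OF path_exists_global[of "root (charge \<eta>)" \<eta>]] that root[OF that]
    unfolding from_root_def by auto
  define f where "f \<eta> = (if \<eta> \<in> S then path_sum \<omega> (root (charge \<eta>)) (from_root \<eta>) else 0)" for \<eta>
  have "f (step \<eta> e) - f \<eta> = \<omega> e \<eta>" if e: "e \<in> arcs X" and \<eta>: "\<eta> \<in> S" for e \<eta>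
  proof -
    let ?r = "root (charge \<eta>)" and ?\<zeta> = "step \<eta> e"
    have \<zeta>: "?\<zeta> \<in> S" "charge ?\<zeta> = charge \<eta>" using step_in_S charge_step e \<eta> by auto
    \<comment> \<open>A common return path closes both the path through \<open>\<eta>\<close> and
      \<open>e\<close> and the chosen path to \<open>?\<zeta>\<close> into loops; subtracting the
      two vanishing sums gives the claim.\<close>
    obtain ret where ret: "set ret \<subseteq> arcs X" "steps ?\<zeta> ret = ?r"
      using path_exists_global[of ?\<zeta> ?r] \<zeta> root[OF \<eta>] by auto
    have 1: "path_sum \<omega> ?r (from_root \<eta> @ [e] @ ret) = 0"
      using e ret from_root[OF \<eta>] root[OF \<eta>] by (intro closed_formD[OF cl]) auto
    have 2: "path_sum \<omega> ?r (from_root ?\<zeta> @ ret) = 0"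
      using ret from_root[OF \<zeta>(1)] root[OF \<eta>] \<zeta>(2) by (intro closed_formD[OF cl]) auto
    show ?thesis
      using 1 2 from_root[OF \<eta>] from_root[OF \<zeta>(1)] \<zeta> \<eta> by (simp add: f_def)
  qed
  moreover have "f \<in> config_functions X b" by (simp add: config_functions_def f_def)
  ultimately show ?thesis by blast
qed

lemma path_sum_differential:
  "\<eta> \<in> S \<Longrightarrow> set es \<subseteq> arcs X \<Longrightarrow> path_sum (differential X \<phi> b f) \<eta> es = f (steps \<eta> es) - f \<eta>"
  by (induction es arbitrary: \<eta>) (auto simp: differential_def step_in_S)

lemma differential_closed_uniform:
  assumes "local_gradient R f"
  shows "differential X \<phi> b f \<in> closed_uniform_forms X \<iota> \<phi> b"
proof -
  have "differential X \<phi> b f \<in> forms X \<iota> \<phi> b"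
    unfolding forms_def
  proof (intro CollectI conjI ballI impI allI)
    fix e \<eta> assume e: "e \<in> arcs X" and \<eta>: "\<eta> \<in> S"
    show "step \<eta> e \<noteq> \<eta> \<Longrightarrow>
        differential X \<phi> b f e \<eta> = - differential X \<phi> b f (\<iota> e) (step \<eta> e)"
      using e \<eta> by (simp add: differential_def step_in_S inversion_closed step_inversion)
    show "step \<eta> e = \<eta> \<Longrightarrow> differential X \<phi> b f e \<eta> = 0"
      by (simp add: differential_def)
  qed (auto simp: differential_def config_functions_def)
  moreover have "closed_form X \<phi> b (differential X \<phi> b f)"
    unfolding closed_form_iff by (auto simp: path_sum_differential)
  moreover have "uniform_form X b (differential X \<phi> b f)"
    unfolding uniform_form_def
  proof (intro exI[of _ R] ballI)
    fix e assume e: "e \<in> arcs X"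
    show "depends_on X b {x \<in> verts X. gdist X (tail X e) x \<le> enat R} (differential X \<phi> b f e)"
    proof (rule depends_onI)
      fix \<eta> \<zeta> assume a: "\<eta> \<in> S" "\<zeta> \<in> S"
        "\<forall>x \<in> {x \<in> verts X. gdist X (tail X e) x \<le> enat R}. \<eta> x = \<zeta> x"
      then have "f (step \<eta> e) - f \<eta> = f (step \<zeta> e) - f \<zeta>" by (intro local_gradientD[OF assms e]) auto
      then show "differential X \<phi> b f e \<eta> = differential X \<phi> b f e \<zeta>"
        using a(1,2) e by (simp add: differential_def)
    qed
  qed
  ultimately show ?thesis by (simp add: closed_uniform_forms_def)
qed

lemma differential_eqI:
  assumes "\<omega> \<in> forms X \<iota> \<phi> b" "\<And>e \<eta>. e \<in> arcs X \<Longrightarrow> \<eta> \<in> S \<Longrightarrow> f (step \<eta> e) - f \<eta> = \<omega> e \<eta>"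
  shows "differential X \<phi> b f = \<omega>"
proof (intro ext)
  fix e \<eta>
  show "differential X \<phi> b f e \<eta> = \<omega> e \<eta>"
    using assms unfolding forms_def differential_def config_functions_def
    by (cases "e \<in> arcs X"; cases "\<eta> \<in> S") auto
qed

section \<open>Linear structure on forms\<close>

lemma subspace_config_functions: "subspace (config_functions X b)"
  by (auto simp: subspace_def config_functions_def)

lemma formsD:
  assumes "\<omega> \<in> forms X \<iota> \<phi> b"
  shows "e \<notin> arcs X \<Longrightarrow> \<omega> e = 0"
    and "e \<in> arcs X \<Longrightarrow> \<omega> e \<in> config_functions X b"
    and "e \<in> arcs X \<Longrightarrow> \<eta> \<in> S \<Longrightarrow> step \<eta> e \<noteq> \<eta> \<Longrightarrow> \<omega> e \<eta> = - \<omega> (\<iota> e) (step \<eta> e)"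
    and "e \<in> arcs X \<Longrightarrow> \<eta> \<in> S \<Longrightarrow> step \<eta> e = \<eta> \<Longrightarrow> \<omega> e \<eta> = 0"
  using assms unfolding forms_def by blast+

lemma formsI:
  assumes "\<And>e. e \<notin> arcs X \<Longrightarrow> \<omega> e = 0"
    and "\<And>e. e \<in> arcs X \<Longrightarrow> \<omega> e \<in> config_functions X b"
    and "\<And>e \<eta>. e \<in> arcs X \<Longrightarrow> \<eta> \<in> S \<Longrightarrow> step \<eta> e \<noteq> \<eta> \<Longrightarrow> \<omega> e \<eta> = - \<omega> (\<iota> e) (step \<eta> e)"
    and "\<And>e \<eta>. e \<in> arcs X \<Longrightarrow> \<eta> \<in> S \<Longrightarrow> step \<eta> e = \<eta> \<Longrightarrow> \<omega> e \<eta> = 0"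
  shows "\<omega> \<in> forms X \<iota> \<phi> b"
  using assms unfolding forms_def by blast

lemma subspace_forms: "subspace (forms X \<iota> \<phi> b)"
proof (rule subspaceI)
  show "0 \<in> forms X \<iota> \<phi> b" by (auto simp: forms_def config_functions_def)
next
  fix \<omega> \<omega>' assume w: "\<omega> \<in> forms X \<iota> \<phi> b" and w': "\<omega>' \<in> forms X \<iota> \<phi> b"
  show "\<omega> + \<omega>' \<in> forms X \<iota> \<phi> b"
  proof (rule formsI)
    fix e \<eta> assume e: "e \<in> arcs X" "\<eta> \<in> S"
    show "(\<omega> + \<omega>') e \<eta> = - (\<omega> + \<omega>') (\<iota> e) (step \<eta> e)" if "step \<eta> e \<noteq> \<eta>"
      using formsD(3)[OF w e that] formsD(3)[OF w' e that] unfolding plus_fun_apply by simp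
    show "(\<omega> + \<omega>') e \<eta> = 0" if "step \<eta> e = \<eta>"
      using formsD(4)[OF w e that] formsD(4)[OF w' e that] by simp
  next
    show "(\<omega> + \<omega>') e \<in> config_functions X b" if "e \<in> arcs X" for e
      using formsD(2)[OF w that] formsD(2)[OF w' that] by (simp add: config_functions_def)
  qed (simp add: formsD(1)[OF w] formsD(1)[OF w'])
next
  fix c :: real and \<omega> assume w: "\<omega> \<in> forms X \<iota> \<phi> b"
  show "c *\<^sub>R \<omega> \<in> forms X \<iota> \<phi> b"
  proof (rule formsI)
    fix e \<eta> assume e: "e \<in> arcs X" "\<eta> \<in> S"
    show "(c *\<^sub>R \<omega>) e \<eta> = - (c *\<^sub>R \<omega>) (\<iota> e) (step \<eta> e)" if "step \<eta> e \<noteq> \<eta>"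
      using formsD(3)[OF w e that] by simp
    show "(c *\<^sub>R \<omega>) e \<eta> = 0" if "step \<eta> e = \<eta>"
      using formsD(4)[OF w e that] by simp
  next
    show "(c *\<^sub>R \<omega>) e \<in> config_functions X b" if "e \<in> arcs X" for e
      using formsD(2)[OF w that] by (simp add: config_functions_def)
  qed (simp add: formsD(1)[OF w])
qed

lemma subspace_closed_uniform_forms: "subspace (closed_uniform_forms X \<iota> \<phi> b)"
proof (rule subspaceI)
  show "0 \<in> closed_uniform_forms X \<iota> \<phi> b"
    by (auto simp: closed_uniform_forms_def forms_def config_functions_def closed_form_def
        uniform_form_def depends_on_def)
next
  fix \<omega> \<omega>' assume w: "\<omega> \<in> closed_uniform_forms X \<iota> \<phi> b" and w': "\<omega>' \<in> closed_uniform_forms X \<iota> \<phi> b"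
  obtain R R' where R: "\<forall>e \<in> arcs X. depends_on X b {x \<in> verts X. gdist X (tail X e) x \<le> enat R} (\<omega> e)"
    and R': "\<forall>e \<in> arcs X. depends_on X b {x \<in> verts X. gdist X (tail X e) x \<le> enat R'} (\<omega>' e)"
    using w w' unfolding closed_uniform_forms_def uniform_form_def by blast
  let ?B = "\<lambda>R e. {x \<in> verts X. gdist X (tail X e) x \<le> enat R}"
  have "depends_on X b (?B (max R R') e) ((\<omega> + \<omega>') e)" if e: "e \<in> arcs X" for e
  proof -
    have "?B R e \<subseteq> ?B (max R R') e" "?B R' e \<subseteq> ?B (max R R') e"
      using order_trans[of _ "enat R" "enat (max R R')"] order_trans[of _ "enat R'" "enat (max R R')"]
      by auto
    note * = depends_on_mono[OF bspec[OF R e] this(1)] depends_on_mono[OF bspec[OF R' e] this(2)]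
    show ?thesis
    proof (rule depends_onI)
      fix \<eta> \<zeta> :: "'x \<Rightarrow> 's" assume a: "\<eta> \<in> S" "\<zeta> \<in> S" "\<forall>x \<in> ?B (max R R') e. \<eta> x = \<zeta> x"
      have "\<omega> e \<eta> = \<omega> e \<zeta>" by (rule depends_onD[OF *(1) a(1,2) bspec[OF a(3)]])
      moreover have "\<omega>' e \<eta> = \<omega>' e \<zeta>" by (rule depends_onD[OF *(2) a(1,2) bspec[OF a(3)]])
      ultimately show "(\<omega> + \<omega>') e \<eta> = (\<omega> + \<omega>') e \<zeta>" by simp
    qed
  qed
  then have "uniform_form X b (\<omega> + \<omega>')" unfolding uniform_form_def by blast
  moreover have "\<omega> + \<omega>' \<in> forms X \<iota> \<phi> b"
    using w w' subspace_forms unfolding closed_uniform_forms_def by (auto intro: subspace_add)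
  moreover have "closed_form X \<phi> b (\<omega> + \<omega>')"
    unfolding closed_form_iff path_sum_add
  proof (intro ballI allI impI; elim conjE)
    fix \<eta> es assume "\<eta> \<in> S" "set es \<subseteq> arcs X" "steps \<eta> es = \<eta>"
    then show "path_sum \<omega> \<eta> es + path_sum \<omega>' \<eta> es = 0"
      using w w' closed_formD[of \<omega> \<eta> es] closed_formD[of \<omega>' \<eta> es]
      by (simp add: closed_uniform_forms_def)
  qed
  ultimately show "\<omega> + \<omega>' \<in> closed_uniform_forms X \<iota> \<phi> b" by (simp add: closed_uniform_forms_def)
next
  fix c :: real and \<omega> assume w: "\<omega> \<in> closed_uniform_forms X \<iota> \<phi> b"
  have "c *\<^sub>R \<omega> \<in> forms X \<iota> \<phi> b"
    using w subspace_forms unfolding closed_uniform_forms_def by (auto intro: subspace_scale)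
  moreover have "closed_form X \<phi> b (c *\<^sub>R \<omega>)"
    unfolding closed_form_iff path_sum_scale
  proof (intro ballI allI impI; elim conjE)
    fix \<eta> es assume "\<eta> \<in> S" "set es \<subseteq> arcs X" "steps \<eta> es = \<eta>"
    then show "c * path_sum \<omega> \<eta> es = 0"
      using w closed_formD[of \<omega> \<eta> es] by (simp add: closed_uniform_forms_def)
  qed
  moreover have "uniform_form X b (c *\<^sub>R \<omega>)"
  proof -
    obtain R where "\<forall>e \<in> arcs X. depends_on X b {x \<in> verts X. gdist X (tail X e) x \<le> enat R} (\<omega> e)"
      using w unfolding closed_uniform_forms_def uniform_form_def by blast
    moreover have "depends_on X b \<Lambda> ((c *\<^sub>R \<omega>) e)" if "depends_on X b \<Lambda> (\<omega> e)" for \<Lambda> e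
    proof (rule depends_onI)
      fix \<eta> \<zeta> :: "'x \<Rightarrow> 's" assume "\<eta> \<in> S" "\<zeta> \<in> S" "\<forall>x \<in> \<Lambda>. \<eta> x = \<zeta> x"
      then have "\<omega> e \<eta> = \<omega> e \<zeta>" by (intro depends_onD[OF that]) auto
      then show "(c *\<^sub>R \<omega>) e \<eta> = (c *\<^sub>R \<omega>) e \<zeta>" by simp
    qed
    ultimately show ?thesis unfolding uniform_form_def by blast
  qed
  ultimately show "c *\<^sub>R \<omega> \<in> closed_uniform_forms X \<iota> \<phi> b" by (simp add: closed_uniform_forms_def)
qed

end

section \<open>Geometry of the crystal lattice\<close>

lemma finite_cyclic_torsion:
  fixes G :: "'g monoid" (structure)
  assumes "group G" "t \<in> torsion_subgroup G"
  shows "finite (generate G {t})"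
proof -
  interpret group G by fact
  obtain N :: nat where t: "t \<in> carrier G" and N: "N > 0" "t [^] N = \<one>"
    using assms by (auto simp: torsion_subgroup_def)
  have "t [^] k \<in> (\<lambda>i. t [^] i) ` {..<N}" for k :: int
  proof -
    have "t [^] k = t [^] (int N * (k div int N) + k mod int N)" by simp
    also have "\<dots> = t [^] (int N * (k div int N)) \<otimes> t [^] (k mod int N)"
      using t by (simp only: int_pow_mult)
    also have "t [^] (int N * (k div int N)) = (t [^] int N) [^] (k div int N)"
      using t by (simp only: int_pow_pow)
    also have "\<dots> = \<one>" using N by (simp add: int_pow_int)
    also have "t [^] (k mod int N) = t [^] nat (k mod int N)"
      using N by (simp add: int_pow_int[symmetric])
    finally have "t [^] k = t [^] nat (k mod int N)" using t by simp
    moreover have "nat (k mod int N) < N" using N by (simp add: nat_less_iff)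
    ultimately show ?thesis by blast
  qed
  then have "generate G {t} \<subseteq> (\<lambda>i. t [^] i) ` {..<N}" unfolding generate_pow[OF t] by auto
  then show ?thesis by (rule finite_subset) simp
qed

text \<open>In an abelian group the product of a finite subgroup and a finite cyclic one is again a
  finite subgroup, so the generators can be added one by one.\<close>

lemma finite_torsion_generated:
  fixes G :: "'g monoid" (structure)
  assumes "comm_group G" "finite B" "B \<subseteq> torsion_subgroup G"
  shows "\<exists>H. subgroup H G \<and> finite H \<and> B \<subseteq> H"
  using assms(2,3)
proof (induction B rule: finite_induct)
  case empty
  interpret comm_group G by fact
  show ?case using triv_subgroup by blast
next
  case (insert t B)
  interpret comm_group G by fact
  obtain H where H: "subgroup H G" "finite H" "B \<subseteq> H" using insert by auto
  have t: "t \<in> carrier G" using insert.prems by (auto simp: torsion_subgroup_def)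
  let ?K = "generate G {t}"
  have K: "subgroup ?K G" using t by (intro generate_is_subgroup) auto
  have "t \<in> ?K" by (rule generate.incl) simp
  have "H \<subseteq> H <#> ?K"
  proof
    fix h assume h: "h \<in> H"
    then have "h = h \<otimes> \<one>" using subgroup.mem_carrier[OF H(1)] by simp
    then show "h \<in> H <#> ?K" using h subgroup.one_closed[OF K] by (auto simp: set_mult_def)
  qed
  moreover have "t \<in> H <#> ?K"
  proof -
    have "t = \<one> \<otimes> t" using t by simp
    then show ?thesis using \<open>t \<in> ?K\<close> subgroup.one_closed[OF H(1)] unfolding set_mult_def by blast
  qed
  moreover have "finite (H <#> ?K)"
    using H finite_cyclic_torsion[OF is_group, of t] insert.prems by (auto simp: set_mult_def)
  ultimately show ?case using H mult_subgroups[OF H(1) K] by blast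
qed

locale framed_system = crystal_lattice X \<iota> G aV aE
  for X :: "('x, 'e) pre_digraph" and \<iota> :: "'e \<Rightarrow> 'e" and G :: "'g monoid" (structure)
    and aV :: "'g \<Rightarrow> 'x \<Rightarrow> 'x" and aE :: "'g \<Rightarrow> 'e \<Rightarrow> 'e" +
  fixes \<phi> :: "'s \<times> 's \<Rightarrow> 's \<times> 's" and b :: 's
    and d :: nat and F :: "'g set" and \<sigma> :: "nat \<Rightarrow> 'g" and n :: "nat \<Rightarrow> 'g \<Rightarrow> int"
    and \<Lambda>0 :: "'x set"
  assumes is_interaction: "is_interaction \<phi>"
    and is_irreducible: "irreducibly_quantified \<phi> b"
    and rank: "d = abelian_rank G"
    and frame: "free_part G F d \<sigma>"
    and coordinates: "free_coordinates G d \<sigma> n"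
    and domain: "fundamental_domain X G aV \<Lambda>0"
begin

section \<open>The group action on the graph\<close>

lemma act_verts [simp]: "g \<in> carrier G \<Longrightarrow> x \<in> verts X \<Longrightarrow> aV g x \<in> verts X"
  using vertex_action.element_image by blast

lemma act_arcs [simp]: "g \<in> carrier G \<Longrightarrow> e \<in> arcs X \<Longrightarrow> aE g e \<in> arcs X"
  using edge_action.element_image by blast

lemma act_mult: "x \<in> verts X \<Longrightarrow> g \<in> carrier G \<Longrightarrow> h \<in> carrier G \<Longrightarrow> aV (g \<otimes> h) x = aV g (aV h x)"
  by (rule vertex_action.composition_rule)

lemma act_inv [simp]: "g \<in> carrier G \<Longrightarrow> x \<in> verts X \<Longrightarrow> aV (inv g) (aV g x) = x"
  using vertex_action.orbit_sym_aux by blast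

lemma act_inv' [simp]: "g \<in> carrier G \<Longrightarrow> x \<in> verts X \<Longrightarrow> aV g (aV (inv g) x) = x"
  using act_inv[of "inv g" x] by simp

lemma actE_inv [simp]: "g \<in> carrier G \<Longrightarrow> e \<in> arcs X \<Longrightarrow> aE (inv g) (aE g e) = e"
  using edge_action.orbit_sym_aux by blast

lemma actE_inv' [simp]: "g \<in> carrier G \<Longrightarrow> e \<in> arcs X \<Longrightarrow> aE g (aE (inv g) e) = e"
  using actE_inv[of "inv g" e] by simp

lemma act_one [simp]: "x \<in> verts X \<Longrightarrow> aV \<one> x = x"
  by (metis vertex_action.id_eq_one restrict_apply')

lemma act_eq_iff: "g \<in> carrier G \<Longrightarrow> x \<in> verts X \<Longrightarrow> y \<in> verts X \<Longrightarrow> aV g x = aV g y \<longleftrightarrow> x = y"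
  by (metis act_inv)

lemma act_commute:
  "x \<in> verts X \<Longrightarrow> g \<in> carrier G \<Longrightarrow> h \<in> carrier G \<Longrightarrow> aV g (aV h x) = aV h (aV g x)"
  by (metis act_mult m_comm)

lemma finite_arc_orbits: "finite (orbits G (arcs X) aE)"
  and finite_vert_orbits: "finite (orbits G (verts X) aV)"
proof -
  interpret Q: fin_digraph "quotient_graph X G aV aE" by (rule quotient_finite)
  show "finite (orbits G (arcs X) aE)" using Q.finite_arcs by (simp add: quotient_graph_def)
  show "finite (orbits G (verts X) aV)" using Q.finite_verts by (simp add: quotient_graph_def)
qed

text \<open>By freeness, distinct edges with a common origin lie in distinct orbits, and there are
  finitely many orbits of edges.\<close>

lemma is_locally_finite: "locally_finite_graph X"
  unfolding locally_finite_graph_def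
proof
  fix x assume x: "x \<in> verts X"
  let ?A = "{e \<in> arcs X. tail X e = x}"
  have "inj_on (Group_Action.orbit G aE) ?A"
  proof (rule inj_onI)
    fix e e' assume e: "e \<in> ?A" "e' \<in> ?A" "Group_Action.orbit G aE e = Group_Action.orbit G aE e'"
    then have "e' \<in> Group_Action.orbit G aE e" using edge_action.orbit_refl by auto
    then obtain g where g: "g \<in> carrier G" "e' = aE g e" by (auto simp: Group_Action.orbit_def)
    then have "aV g x = x" using e tail_act by force
    then have "g = \<one>" using free g x by blast
    then show "e = e'" using g e edge_action.id_eq_one by (metis (no_types, lifting) mem_Collect_eq restrict_apply')
  qed
  moreover have "Group_Action.orbit G aE ` ?A \<subseteq> orbits G (arcs X) aE" by (auto simp: orbits_def)
  ultimately show "finite ?A" using finite_arc_orbits by (meson finite_imageD finite_subset)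
qed

sublocale interacting_system X \<iota> \<phi> b
  by unfold_locales (rule connected is_locally_finite is_interaction is_irreducible)+

section \<open>Coordinates and torsion of the group\<close>

lemma n_mult: "j \<in> {1..d} \<Longrightarrow> g \<in> carrier G \<Longrightarrow> h \<in> carrier G \<Longrightarrow> n j (g \<otimes> h) = n j g + n j h"
  using coordinates by (force simp: free_coordinates_def dest: hom_mult)

lemma n_sigma: "j \<in> {1..d} \<Longrightarrow> i \<in> {1..d} \<Longrightarrow> n j (\<sigma> i) = (if i = j then 1 else 0)"
  using coordinates by (auto simp: free_coordinates_def)

lemma n_torsion: "j \<in> {1..d} \<Longrightarrow> g \<in> torsion_subgroup G \<Longrightarrow> n j g = 0"
  using coordinates by (auto simp: free_coordinates_def)

lemma n_one: "j \<in> {1..d} \<Longrightarrow> n j \<one> = 0"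
  using n_mult[of j \<one> \<one>] by simp

lemma n_inv: "j \<in> {1..d} \<Longrightarrow> g \<in> carrier G \<Longrightarrow> n j (inv g) = - n j g"
  using n_mult[of j g "inv g"] n_one by simp

lemma sigma_closed [simp]: "j \<in> {1..d} \<Longrightarrow> \<sigma> j \<in> carrier G"
  using frame by (auto simp: free_part_def Z_independent_def)

lemma d_pos: "d > 0"
  using rank rank_pos by simp

lemma torsion_carrier: "t \<in> torsion_subgroup G \<Longrightarrow> t \<in> carrier G"
  by (simp add: torsion_subgroup_def)

lemma decompose: "g \<in> carrier G \<Longrightarrow> \<exists>f \<in> F. \<exists>t \<in> torsion_subgroup G. g = f \<otimes> t"
proof -
  assume "g \<in> carrier G"
  then have "g \<in> F <#> torsion_subgroup G" using frame by (simp add: free_part_def)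
  then show ?thesis by (auto simp: set_mult_def)
qed

lemma F_carrier: "f \<in> F \<Longrightarrow> f \<in> carrier G"
  using frame subgroup.mem_carrier by (auto simp: free_part_def)

lemma subgroup_sigma_F: "subgroup H G \<Longrightarrow> \<sigma> ` {1..d} \<subseteq> H \<Longrightarrow> F \<subseteq> H"
  using frame generate_subgroup_incl[of "\<sigma> ` {1..d}" H] by (simp add: free_part_def)

text \<open>The projection of \<open>G\<close> onto the free part \<open>F\<close> along the torsion
  subgroup, written in the basis \<open>\<sigma>\<close>; \<open>torsion_part\<close> below is the
  complementary projection.\<close>

definition lattice_part :: "'g \<Rightarrow> 'g"
  where "lattice_part g = finprod G (\<lambda>j. \<sigma> j [^] n j g) {1..d}"

lemma lattice_part_closed [simp]: "lattice_part g \<in> carrier G"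
  unfolding lattice_part_def by (intro finprod_closed) auto

lemma lattice_part_mult:
  assumes "g \<in> carrier G" "h \<in> carrier G"
  shows "lattice_part (g \<otimes> h) = lattice_part g \<otimes> lattice_part h"
proof -
  have "lattice_part (g \<otimes> h) = finprod G (\<lambda>j. \<sigma> j [^] n j g \<otimes> \<sigma> j [^] n j h) {1..d}"
    unfolding lattice_part_def using assms
    by (intro finprod_cong') (auto simp: n_mult int_pow_mult)
  also have "\<dots> = lattice_part g \<otimes> lattice_part h"
    unfolding lattice_part_def by (intro finprod_multf) auto
  finally show ?thesis .
qed

lemma lattice_part_trivial:
  assumes "\<And>j. j \<in> {1..d} \<Longrightarrow> n j g = 0"
  shows "lattice_part g = \<one>"
  unfolding lattice_part_def using assms by (intro finprod_one_eqI) auto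

lemma lattice_part_sigma: "i \<in> {1..d} \<Longrightarrow> lattice_part (\<sigma> i) = \<sigma> i"
proof -
  assume i: "i \<in> {1..d}"
  have "lattice_part (\<sigma> i) = finprod G (\<lambda>j. if i = j then \<sigma> j else \<one>) {1..d}"
    unfolding lattice_part_def using i by (intro finprod_cong') (auto simp: n_sigma)
  also have "\<dots> = \<sigma> i" using i by (intro finprod_singleton) auto
  finally show ?thesis .
qed

lemma lattice_part_inv: "g \<in> carrier G \<Longrightarrow> lattice_part (inv g) = inv (lattice_part g)"
  using lattice_part_mult[of "inv g" g] lattice_part_trivial[of \<one>] n_one
  by (intro inv_equality[symmetric]) auto

lemma lattice_part_F: "f \<in> F \<Longrightarrow> lattice_part f = f"
proof -
  have "subgroup {g \<in> carrier G. lattice_part g = g} G"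
    using lattice_part_trivial[of \<one>] n_one
    by (intro subgroupI) (auto simp: lattice_part_mult lattice_part_inv)
  then have "F \<subseteq> {g \<in> carrier G. lattice_part g = g}"
    by (rule subgroup_sigma_F) (auto simp: lattice_part_sigma)
  then show "f \<in> F \<Longrightarrow> ?thesis" by auto
qed

definition torsion_part :: "'g \<Rightarrow> 'g"
  where "torsion_part g = g \<otimes> inv (lattice_part g)"

lemma torsion_part_decompose:
  assumes "f \<in> F" "t \<in> torsion_subgroup G"
  shows "torsion_part (f \<otimes> t) = t"
proof -
  have c: "f \<in> carrier G" "t \<in> carrier G" using assms F_carrier torsion_carrier by auto
  have "lattice_part (f \<otimes> t) = f"
    using c assms n_torsion lattice_part_trivial[of t] by (simp add: lattice_part_mult lattice_part_F)
  then show ?thesis using c by (simp add: torsion_part_def m_comm[of f t] m_assoc)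
qed

lemma torsion_part_torsion: "g \<in> carrier G \<Longrightarrow> torsion_part g \<in> torsion_subgroup G"
  using decompose[of g] torsion_part_decompose by auto

lemma lattice_torsion_part: "g \<in> carrier G \<Longrightarrow> g = lattice_part g \<otimes> torsion_part g"
  unfolding torsion_part_def by (simp add: m_comm[of "lattice_part g"] m_assoc)

text \<open>The projection \<open>torsion_part\<close> is a homomorphism. It maps the finitely many
  generators of \<open>G\<close> into a finite subgroup, hence all of \<open>G\<close>, and it fixes
  the torsion elements.\<close>

lemma finite_torsion: "finite (torsion_subgroup G)"
proof -
  obtain A where A: "finite A" "A \<subseteq> carrier G" "generate G A = carrier G"
    using finitely_generated by (auto simp: finitely_generated_group_def)
  obtain H where H: "subgroup H G" "finite H" "torsion_part ` A \<subseteq> H"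
    using finite_torsion_generated[OF comm_group_axioms, of "torsion_part ` A"] A torsion_part_torsion by auto
  have mult: "torsion_part (g \<otimes> h) = torsion_part g \<otimes> torsion_part h"
    if "g \<in> carrier G" "h \<in> carrier G" for g h
    unfolding torsion_part_def using that
    by (simp add: lattice_part_mult inv_mult m_ac)
  have one: "torsion_part \<one> = \<one>"
    using lattice_part_trivial[of \<one>] n_one by (simp add: torsion_part_def)
  have invs: "torsion_part (inv g) = inv (torsion_part g)" if "g \<in> carrier G" for g
    unfolding torsion_part_def using that by (simp add: lattice_part_inv inv_mult)
  have "subgroup {g \<in> carrier G. torsion_part g \<in> H} G"
    using H(1) one
    by (intro subgroupI) (auto simp: mult invs subgroup.m_closed subgroup.m_inv_closed subgroup.one_closed)
  then have "generate G A \<subseteq> {g \<in> carrier G. torsion_part g \<in> H}"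
    using A H(3) by (intro generate_subgroup_incl) auto
  then have "torsion_part ` carrier G \<subseteq> H" using A(3) by auto
  moreover have "t = torsion_part t" if "t \<in> torsion_subgroup G" for t
  proof -
    have "\<one> \<in> F" using frame subgroup.one_closed by (auto simp: free_part_def)
    then show ?thesis using torsion_part_decompose[of \<one> t] that torsion_carrier by simp
  qed
  ultimately have "torsion_subgroup G \<subseteq> H" using torsion_carrier by blast
  then show ?thesis using H(2) finite_subset by blast
qed

text \<open>An element of \<open>G\<close> is determined by its coordinates and its torsion part,
  and both range over finite sets.\<close>

lemma finite_box: "finite {g \<in> carrier G. \<forall>j \<in> {1..d}. \<bar>n j g\<bar> \<le> K}"
proof -
  let ?N = "{g \<in> carrier G. \<forall>j \<in> {1..d}. \<bar>n j g\<bar> \<le> K}"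
  let ?P = "PiE {1..d} (\<lambda>_. {-K..K})"
  let ?f = "\<lambda>(k, t). finprod G (\<lambda>j. \<sigma> j [^] (k j :: int)) {1..d} \<otimes> t"
  have "?N \<subseteq> ?f ` (?P \<times> torsion_subgroup G)"
  proof
    fix g assume g: "g \<in> ?N"
    define k where "k = (\<lambda>j \<in> {1..d}. n j g)"
    have k: "k \<in> ?P" using g by (auto simp: k_def abs_le_iff minus_le_iff)
    have "lattice_part g = finprod G (\<lambda>j. \<sigma> j [^] k j) {1..d}"
      unfolding lattice_part_def by (intro finprod_cong') (auto simp: k_def)
    then have "g = ?f (k, torsion_part g)" using lattice_torsion_part[of g] g by simp
    then show "g \<in> ?f ` (?P \<times> torsion_subgroup G)" using k torsion_part_torsion[of g] g by blast
  qed
  moreover have "finite (?P \<times> torsion_subgroup G)"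
    by (intro finite_cartesian_product finite_PiE finite_torsion) auto
  ultimately show ?thesis by (meson finite_surj)
qed

section \<open>Tiling by translates of the fundamental domain\<close>

lemma domain_verts: "x \<in> \<Lambda>0 \<Longrightarrow> x \<in> verts X"
  using domain by (auto simp: fundamental_domain_def connected_subset_def)

lemma domain_unique:
  assumes "x \<in> \<Lambda>0" "y \<in> \<Lambda>0" "g \<in> carrier G" "y = aV g x"
  shows "x = y"
proof -
  have x: "x \<in> verts X" using assms domain_verts by simp
  have "Group_Action.orbit G aV x \<in> orbits G (verts X) aV" using x by (auto simp: orbits_def)
  moreover have "x \<in> Group_Action.orbit G aV x" using vertex_action.orbit_refl x by simp
  moreover have "y \<in> Group_Action.orbit G aV x" using assms by (auto simp: Group_Action.orbit_def)
  ultimately show ?thesis using domain assms unfolding fundamental_domain_def by blast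
qed

lemma domain_exists: "x \<in> verts X \<Longrightarrow> \<exists>g \<in> carrier G. \<exists>y \<in> \<Lambda>0. x = aV g y"
proof -
  assume x: "x \<in> verts X"
  have "Group_Action.orbit G aV x \<in> orbits G (verts X) aV" using x by (auto simp: orbits_def)
  then obtain y where y: "y \<in> \<Lambda>0" "y \<in> Group_Action.orbit G aV x"
    using domain unfolding fundamental_domain_def by blast
  then obtain g where g: "g \<in> carrier G" "y = aV g x" by (auto simp: Group_Action.orbit_def)
  then have "x = aV (inv g) y" using x by simp
  with y g show ?thesis by blast
qed

lemma finite_domain: "finite \<Lambda>0"
proof -
  have "inj_on (Group_Action.orbit G aV) \<Lambda>0"
  proof (rule inj_onI)
    fix x y assume xy: "x \<in> \<Lambda>0" "y \<in> \<Lambda>0"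
      and eq: "Group_Action.orbit G aV x = Group_Action.orbit G aV y"
    have "y \<in> Group_Action.orbit G aV x"
      unfolding eq by (rule vertex_action.orbit_refl[OF domain_verts[OF xy(2)]])
    then obtain g where "g \<in> carrier G" "y = aV g x" by (auto simp: Group_Action.orbit_def)
    then show "x = y" by (rule domain_unique[OF xy])
  qed
  moreover have "Group_Action.orbit G aV ` \<Lambda>0 \<subseteq> orbits G (verts X) aV" using domain_verts by (auto simp: orbits_def)
  ultimately show ?thesis using finite_vert_orbits by (meson finite_imageD finite_subset)
qed

text \<open>The label of the tile containing \<open>x\<close>. The choice is unique, because the
  action is free and \<open>\<Lambda>0\<close> meets every orbit once.\<close>

definition cell :: "'x \<Rightarrow> 'g"
  where "cell x = (SOME g. g \<in> carrier G \<and> x \<in> aV g ` \<Lambda>0)"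

lemma cell: "x \<in> verts X \<Longrightarrow> cell x \<in> carrier G \<and> x \<in> aV (cell x) ` \<Lambda>0"
  unfolding cell_def using domain_exists[of x] by (intro someI_ex[of "\<lambda>g. g \<in> carrier G \<and> x \<in> aV g ` \<Lambda>0"]) blast

lemma cell_unique:
  assumes "g \<in> carrier G" "h \<in> carrier G" "x \<in> \<Lambda>0" "y \<in> \<Lambda>0" "aV g x = aV h y"
  shows "g = h"
proof -
  have v: "x \<in> verts X" "y \<in> verts X" using assms domain_verts by auto
  have gh: "inv h \<otimes> g \<in> carrier G" using assms(1,2) by simp
  have y: "y = aV (inv h \<otimes> g) x"
    using act_mult[OF v(1) inv_closed[OF assms(2)] assms(1)] act_inv[OF assms(2) v(2)] assms(5) by simp
  have "x = y" by (rule domain_unique[OF assms(3,4) gh y])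
  then have "inv h \<otimes> g = \<one>" using free[OF gh v(1)] y by simp
  then show ?thesis using assms by (metis inv_closed inv_equality inv_inv)
qed

lemma cell_eqI: "g \<in> carrier G \<Longrightarrow> x \<in> aV g ` \<Lambda>0 \<Longrightarrow> cell x = g"
proof -
  assume g: "g \<in> carrier G" "x \<in> aV g ` \<Lambda>0"
  then obtain y where y: "y \<in> \<Lambda>0" "x = aV g y" by auto
  then have "x \<in> verts X" using g domain_verts by simp
  then obtain z where z: "z \<in> \<Lambda>0" "x = aV (cell x) z" "cell x \<in> carrier G" using cell by blast
  show ?thesis using cell_unique[OF z(3) g(1) z(1) y(1)] z(2) y(2) by simp
qed

lemma cell_act:
  assumes "g \<in> carrier G" "x \<in> verts X"
  shows "cell (aV g x) = g \<otimes> cell x"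
proof -
  obtain y where y: "y \<in> \<Lambda>0" "x = aV (cell x) y" "cell x \<in> carrier G" using cell[OF assms(2)] by auto
  have "aV g x = aV (g \<otimes> cell x) y"
    using act_mult[OF domain_verts[OF y(1)] assms(1) y(3)] y(2) by simp
  then show ?thesis using assms y(1,3) by (intro cell_eqI) auto
qed

text \<open>These are coordinates of the cell, the same for all points of a translate of
  \<open>\<Lambda>0\<close>. They are therefore exactly equivariant, and they are the coefficients
  that occur in \<open>frakA\<close>.\<close>

definition pos :: "nat \<Rightarrow> 'x \<Rightarrow> int"
  where "pos j x = n j (cell x)"

lemma pos_act: "j \<in> {1..d} \<Longrightarrow> g \<in> carrier G \<Longrightarrow> x \<in> verts X \<Longrightarrow> pos j (aV g x) = pos j x + n j g"
  unfolding pos_def using cell[of x] by (simp add: cell_act n_mult)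

section \<open>Distances and coordinates\<close>

lemma awalk_act:
  assumes g: "g \<in> carrier G"
  shows "awalk x p y \<Longrightarrow> awalk (aV g x) (map (aE g) p) (aV g y)"
proof (induction p arbitrary: x)
  case Nil
  then show ?case using g by (auto simp: awalk_Nil_iff)
next
  case (Cons e p)
  then show ?case using g by (auto simp: awalk_Cons_iff tail_act head_act)
qed

lemma gdist_act: "g \<in> carrier G \<Longrightarrow> gdist X x y \<le> enat k \<Longrightarrow> gdist X (aV g x) (aV g y) \<le> enat k"
  unfolding gdist_le_iff by (elim exE conjE) (rule exI, rule conjI, erule awalk_act, simp_all)

text \<open>Up to translation, which does not increase distances, there are only finitely many pairs
  of vertices with coordinates differing by at most \<open>K\<close>. Conversely, distant vertices
  differ much in some coordinate.\<close>

lemma box_gdist: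
  "\<exists>R. \<forall>x \<in> verts X. \<forall>y \<in> verts X. (\<forall>j \<in> {1..d}. \<bar>pos j y - pos j x\<bar> \<le> K) \<longrightarrow> gdist X x y \<le> enat R"
proof -
  let ?N = "{g \<in> carrier G. \<forall>j \<in> {1..d}. \<bar>n j g\<bar> \<le> K}"
  let ?I = "\<Lambda>0 \<times> ?N \<times> \<Lambda>0"
  have "\<forall>i \<in> ?I. \<exists>r. gdist X (fst i) (aV (fst (snd i)) (snd (snd i))) \<le> enat r"
    using gdist_finite domain_verts by fastforce
  then obtain r where r: "\<And>i. i \<in> ?I \<Longrightarrow> gdist X (fst i) (aV (fst (snd i)) (snd (snd i))) \<le> enat (r i)"
    using bchoice[of ?I "\<lambda>i r. gdist X (fst i) (aV (fst (snd i)) (snd (snd i))) \<le> enat r"] by blast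
  have fin: "finite ?I" using finite_box finite_domain by (intro finite_cartesian_product)
  have "gdist X x y \<le> enat (Max (r ` ?I))"
    if xy: "x \<in> verts X" "y \<in> verts X" and K: "\<forall>j \<in> {1..d}. \<bar>pos j y - pos j x\<bar> \<le> K" for x y
  proof -
    obtain x0 where x0: "x0 \<in> \<Lambda>0" "x = aV (cell x) x0" "cell x \<in> carrier G" using cell[OF xy(1)] by auto
    obtain y0 where y0: "y0 \<in> \<Lambda>0" "y = aV (cell y) y0" "cell y \<in> carrier G" using cell[OF xy(2)] by auto
    \<comment> \<open>Translating by the inverse of \<open>cell x\<close> brings \<open>x\<close>
      into \<open>\<Lambda>0\<close> and \<open>y\<close> into the cell with label \<open>g\<close>,
      which lies in the finite box.\<close>
    define g where "g = inv (cell x) \<otimes> cell y"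
    have g: "g \<in> ?N" using K x0(3) y0(3) by (auto simp: g_def pos_def n_mult n_inv)
    then have i: "(x0, g, y0) \<in> ?I" using x0(1) y0(1) by simp
    have "cell x \<otimes> g = cell y" using x0(3) y0(3) by (simp add: g_def m_assoc[symmetric])
    then have "aV (cell x) (aV g y0) = y" 
      using act_mult[OF domain_verts[OF y0(1)] x0(3), of g] g y0(2) by simp
    moreover have "gdist X x0 (aV g y0) \<le> enat (Max (r ` ?I))"
      using r[OF i] Max_ge[of "r ` ?I" "r (x0, g, y0)"] fin i by (auto intro: order_trans)
    ultimately show ?thesis using gdist_act[OF x0(3), of x0 "aV g y0"] x0(2)[symmetric] by simp
  qed
  then show ?thesis by blast
qed

section \<open>Height functions and their half-spaces\<close>

definition equivariant :: "('x \<Rightarrow> int) \<Rightarrow> ('g \<Rightarrow> int) \<Rightarrow> bool"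
  where "equivariant q \<nu> \<longleftrightarrow> (\<forall>g \<in> carrier G. \<forall>x \<in> verts X. q (aV g x) = q x + \<nu> g)"

lemma equivariantD: "equivariant q \<nu> \<Longrightarrow> g \<in> carrier G \<Longrightarrow> x \<in> verts X \<Longrightarrow> q (aV g x) = q x + \<nu> g"
  by (simp add: equivariant_def)

text \<open>The increment of \<open>q\<close> along an edge is constant on orbits of edges, of which
  there are finitely many.\<close>

lemma equivariant_lipschitz:
  assumes q: "equivariant q \<nu>"
  shows "\<exists>L \<ge> 0. \<forall>e \<in> arcs X. \<bar>q (head X e) - q (tail X e)\<bar> \<le> L"
proof -
  let ?v = "\<lambda>e. \<bar>q (head X e) - q (tail X e)\<bar>"
  have "?v ` arcs X \<subseteq> (\<lambda>Q. ?v (SOME e. e \<in> Q)) ` orbits G (arcs X) aE"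
  proof
    fix k assume "k \<in> ?v ` arcs X"
    then obtain e where e: "e \<in> arcs X" "k = ?v e" by auto
    let ?Q = "Group_Action.orbit G aE e"
    have "e \<in> ?Q" using e edge_action.orbit_refl by simp
    then have "(SOME e. e \<in> ?Q) \<in> ?Q" by (rule someI)
    then obtain g where g: "g \<in> carrier G" "(SOME e. e \<in> ?Q) = aE g e" by (auto simp: Group_Action.orbit_def)
    then have "?v (SOME e. e \<in> ?Q) = k" using e q by (simp add: tail_act head_act equivariantD)
    then show "k \<in> (\<lambda>Q. ?v (SOME e. e \<in> Q)) ` orbits G (arcs X) aE" 
      using e by (intro image_eqI[of _ _ ?Q]) (auto simp: orbits_def)
  qed
  then have fin: "finite (insert 0 (?v ` arcs X))" using finite_arc_orbits by (meson finite_surj finite_insert)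
  show ?thesis
    using fin by (intro exI[of _ "Max (insert 0 (?v ` arcs X))"]) (auto intro: Max_ge)
qed

lemma conn_act:
  assumes g: "g \<in> carrier G" and V: "conn V"
  shows "conn (aV g ` V)"
  unfolding conn_def
proof (intro conjI ballI)
  show "aV g ` V \<subseteq> verts X" using V g by (auto simp: conn_def)
  fix x y assume "x \<in> aV g ` V" "y \<in> aV g ` V"
  then obtain x' y' where xy: "x = aV g x'" "y = aV g y'" "x' \<in> V" "y' \<in> V" by auto
  then have "(x', y') \<in> (adj V)\<^sup>*" using V by (auto simp: conn_def)
  then have "(aV g x', aV g y') \<in> (adj (aV g ` V))\<^sup>*"
  proof (induction rule: rtrancl_induct)
    case (step y z)
    then obtain e where e: "e \<in> arcs X" "tail X e \<in> V" "head X e \<in> V" "y = tail X e" "z = head X e"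
      by (auto simp: adj_def)
    then have "(aV g y, aV g z) \<in> adj (aV g ` V)"
      unfolding adj_def using g
      by (intro CollectI exI[of _ "aE g e"]) (auto simp: tail_act head_act)
    then show ?case using step.IH by (rule rtrancl_into_rtrancl[rotated])
  qed simp
  then show "(x, y) \<in> (adj (aV g ` V))\<^sup>*" by (simp add: xy)
qed

lemma finite_int_bound: "finite A \<Longrightarrow> \<exists>K :: int. K \<ge> 0 \<and> (\<forall>x \<in> A. \<bar>q x\<bar> \<le> K)"
  by (intro exI[of _ "Max (insert 0 ((\<lambda>x. \<bar>q x\<bar>) ` A))"]) (auto intro: Max_ge)

text \<open>Covers the coordinates \<open>pos j\<close> and their negatives at once: some
  translation raises all heights by exactly one.\<close>

definition direction :: "('x \<Rightarrow> int) \<Rightarrow> bool"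
  where "direction q \<longleftrightarrow> (\<exists>\<nu>. equivariant q \<nu> \<and> (\<exists>g \<in> carrier G. \<nu> g = 1))"

lemma equivariant_pow:
  fixes k :: nat
  assumes q: "equivariant q \<nu>" and g: "g \<in> carrier G" and x: "x \<in> verts X"
  shows "q (aV (g [^] k) x) = q x + int k * \<nu> g"
proof (induction k)
  case (Suc k)
  have "aV (g [^] Suc k) x = aV g (aV (g [^] k) x)"
    using g x by (simp add: act_mult act_commute)
  then show ?case using Suc g x equivariantD[OF q] by (simp add: algebra_simps)
qed (use x in simp)

text \<open>A finite set can be joined within a half-space of \<open>q\<close>, up to a margin that does not depend on
  the set: shift a connected set containing it far up, and join each point to its shifted copy by
  translates of finitely many bounded paths.\<close>

lemma half_space_connected:
  assumes q: "direction q"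
  obtains c where "c \<ge> 0" and "\<And>m A. finite A \<Longrightarrow> A \<subseteq> verts X \<Longrightarrow> \<forall>x \<in> A. m \<le> q x \<Longrightarrow>
    \<exists>V. finite V \<and> conn V \<and> A \<subseteq> V \<and> (\<forall>x \<in> V. m - c \<le> q x)"
proof -
  obtain \<nu> s where \<nu>: "equivariant q \<nu>" and s: "s \<in> carrier G" "\<nu> s = 1"
    using q by (auto simp: direction_def)
  have "\<forall>x \<in> \<Lambda>0. \<exists>P. finite P \<and> conn P \<and> x \<in> P \<and> aV s x \<in> P"
    using finite_conn_pair s domain_verts by auto
  then obtain P where P: "\<And>x. x \<in> \<Lambda>0 \<Longrightarrow> finite (P x) \<and> conn (P x) \<and> x \<in> P x \<and> aV s x \<in> P x"
    by metis
  have "finite (SIGMA x:\<Lambda>0. P x)" using P finite_domain by auto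
  \<comment> \<open>The constant depends only on the sets chosen at the points of
    \<open>\<Lambda>0\<close>; equivariance of \<open>q\<close> carries the bound to all
    vertices.\<close>
  then obtain c where c: "c \<ge> 0" "\<forall>i \<in> (SIGMA x:\<Lambda>0. P x). \<bar>q (fst i) - q (snd i)\<bar> \<le> c"
    using finite_int_bound[of _ "\<lambda>i. q (fst i) - q (snd i)"] by blast
  have one: "\<exists>V. finite V \<and> conn V \<and> x \<in> V \<and> aV s x \<in> V \<and> (\<forall>y \<in> V. q x - c \<le> q y)"
    if x: "x \<in> verts X" for x
  proof -
    obtain x0 g where x0: "x0 \<in> \<Lambda>0" "x = aV g x0" and g: "g \<in> carrier G"
      using domain_exists[OF x] by auto
    have PX: "P x0 \<subseteq> verts X" using P[OF x0(1)] by (simp add: conn_def)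
    have "aV s x = aV g (aV s x0)" using x0 g s domain_verts act_commute by metis
    moreover have "q x - c \<le> q (aV g y)" if "y \<in> P x0" for y
    proof -
      have "\<bar>q x0 - q y\<bar> \<le> c" using c x0 that by force
      moreover have "q (aV g y) = q y + \<nu> g" "q x = q x0 + \<nu> g"
        using equivariantD[OF \<nu> g] PX that x0 domain_verts by auto
      ultimately show ?thesis by linarith
    qed
    ultimately show ?thesis using P[OF x0(1)] x0(2) conn_act[OF g]
      by (intro exI[of _ "aV g ` P x0"]) auto
  qed
  have ray: "\<exists>V. finite V \<and> conn V \<and> x \<in> V \<and> aV (s [^] k) x \<in> V \<and> (\<forall>y \<in> V. q x - c \<le> q y)"
    if x: "x \<in> verts X" for x and k :: nat
  proof (induction k)
    case 0
    show ?case using x c conn_singleton by (intro exI[of _ "{x}"]) auto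
  next
    case (Suc k)
    then obtain V where V: "finite V" "conn V" "x \<in> V" "aV (s [^] k) x \<in> V" "\<forall>y \<in> V. q x - c \<le> q y"
      by blast
    let ?y = "aV (s [^] k) x"
    have y: "?y \<in> verts X" "q x \<le> q ?y" using x s equivariant_pow[OF \<nu> s(1) x, of k] by auto
    obtain W where W: "finite W" "conn W" "?y \<in> W" "aV s ?y \<in> W" "\<forall>z \<in> W. q ?y - c \<le> q z"
      using one[OF y(1)] by blast
    have "aV (s [^] Suc k) x = aV s ?y" using s x by (simp add: act_mult act_commute)
    moreover have "conn (V \<union> W)" using V W by (intro conn_Un) auto
    ultimately show ?case using V W y(2) by (intro exI[of _ "V \<union> W"]) force
  qed
  have *: "\<exists>V. finite V \<and> conn V \<and> A \<subseteq> V \<and> (\<forall>x \<in> V. m - c \<le> q x)"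
    if A: "finite A" "A \<subseteq> verts X" "\<forall>x \<in> A. m \<le> q x" for m A
  proof -
    obtain W where W: "finite W" "conn W" "A \<subseteq> W" using finite_conn_cover[OF A(1,2)] by blast
    then have WX: "W \<subseteq> verts X" by (simp add: conn_def)
    obtain K where K: "K \<ge> 0" "\<forall>x \<in> W. \<bar>q x\<bar> \<le> K" using finite_int_bound[OF W(1), of q] by blast
    \<comment> \<open>Heights in \<open>W\<close> are at least \<open>- K\<close>, so this many
      upward translations lift all of \<open>W\<close> to level \<open>m\<close> or higher.\<close>
    define k where "k = nat (m + K)"
    let ?W = "aV (s [^] k) ` W"
    have "\<forall>x \<in> A. \<exists>V. finite V \<and> conn V \<and> x \<in> V \<and> aV (s [^] k) x \<in> V \<and> (\<forall>y \<in> V. q x - c \<le> q y)"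
      using ray A(2) by blast
    then obtain V where V: "\<And>x. x \<in> A \<Longrightarrow> finite (V x) \<and> conn (V x) \<and> x \<in> V x \<and> aV (s [^] k) x \<in> V x \<and>
        (\<forall>y \<in> V x. q x - c \<le> q y)" by metis
    have "conn (?W \<union> (\<Union>x \<in> A. V x))"
    proof (rule conn_UN)
      show "conn ?W" using s W by (intro conn_act) auto
      show "conn (V x)" if "x \<in> A" for x using V[OF that] by simp
      show "V x \<inter> ?W \<noteq> {}" if "x \<in> A" for x using V[OF that] W(3) that by blast
    qed
    moreover have "m - c \<le> q y" if "y \<in> ?W" for y
    proof -
      obtain w where w: "w \<in> W" "y = aV (s [^] k) w" using \<open>y \<in> ?W\<close> by auto
      then have "q y = q w + int k" using equivariant_pow[OF \<nu> s(1), of w k] WX s by auto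
      moreover have "\<bar>q w\<bar> \<le> K" using K w by simp
      moreover have "m + K \<le> int k" by (simp add: k_def)
      ultimately show ?thesis using c(1) by linarith
    qed
    moreover have "m - c \<le> q y" if "x \<in> A" "y \<in> V x" for x y
      using V[OF that(1)] that A(3) by force
    ultimately show ?thesis using V A W(1)
      by (intro exI[of _ "?W \<union> (\<Union>x \<in> A. V x)"]) auto
  qed
  show ?thesis by (rule that[OF c(1) *])
qed

end

section \<open>The pairing of distant configurations\<close>

context framed_system
begin

section \<open>Translation of configurations\<close>

abbreviation act :: "'g \<Rightarrow> ('x \<Rightarrow> 's) \<Rightarrow> 'x \<Rightarrow> 's"
  where "act \<equiv> act_config X G aV"

lemma act_apply: "x \<in> verts X \<Longrightarrow> act g \<eta> x = \<eta> (aV (inv g) x)"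
  by (simp add: act_config_def)

lemma supp_act: "g \<in> carrier G \<Longrightarrow> supp (act g \<eta>) = aV g ` supp \<eta>"
proof (intro equalityI subsetI)
  fix x assume g: "g \<in> carrier G" and "x \<in> supp (act g \<eta>)"
  then have "x \<in> verts X" "aV (inv g) x \<in> supp \<eta>" by (auto simp: supp_def act_apply)
  then show "x \<in> aV g ` supp \<eta>" using g by (intro image_eqI[of _ _ "aV (inv g) x"]) auto
qed (auto simp: supp_def act_apply)

lemma act_in_S: "g \<in> carrier G \<Longrightarrow> \<eta> \<in> S \<Longrightarrow> act g \<eta> \<in> S"
  unfolding in_S_iff supp_act by (simp add: act_config_def)

lemma act_act:
  "g \<in> carrier G \<Longrightarrow> h \<in> carrier G \<Longrightarrow> act g (act h \<eta>) = act (g \<otimes> h) \<eta>"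
  by (auto simp: act_config_def fun_eq_iff inv_mult_group act_mult)

lemma charge_act:
  assumes g: "g \<in> carrier G" and \<eta>: "\<eta> \<in> S"
  shows "charge (act g \<eta>) = charge \<eta>"
proof (rule charge_eqI)
  fix \<xi> assume \<xi>: "\<xi> \<in> Consv \<phi> b"
  have "inj_on (aV g) (supp \<eta>)"
    using g by (auto simp: inj_on_def act_eq_iff supp_verts)
  then have "(\<Sum>x \<in> aV g ` supp \<eta>. \<xi> (act g \<eta> x)) = (\<Sum>x \<in> supp \<eta>. \<xi> (act g \<eta> (aV g x)))"
    by (simp add: sum.reindex)
  also have "\<dots> = (\<Sum>x \<in> supp \<eta>. \<xi> (\<eta> x))"
    using g by (intro sum.cong) (auto simp: act_apply supp_verts)
  finally show "charge (act g \<eta>) \<xi> = charge \<eta> \<xi>" using g \<xi> by (simp add: charge_def supp_act)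
qed

lemma step_act:
  assumes g: "g \<in> carrier G" and e: "e \<in> arcs X" and \<eta>: "\<eta> \<in> S"
  shows "step (act g \<eta>) (aE g e) = act g (step \<eta> e)"
proof (rule config_eqI)
  show "step (act g \<eta>) (aE g e) \<in> S" "act g (step \<eta> e) \<in> S"
    using assms by (auto intro!: step_in_S act_in_S)
  fix x assume x: "x \<in> verts X"
  define y where "y = aV (inv g) x"
  have y: "y \<in> verts X" "x = aV g y" using x g by (auto simp: y_def)
  have v: "tail X e \<in> verts X" "head X e \<in> verts X" using e by auto
  show "step (act g \<eta>) (aE g e) x = act g (step \<eta> e) x"
    unfolding y(2) using g e y(1) v
    by (simp add: transition_def act_apply tail_act head_act act_eq_iff)
qed

section \<open>Superposition and separation of configurations\<close>

definition merge :: "('x \<Rightarrow> 's) \<Rightarrow> ('x \<Rightarrow> 's) \<Rightarrow> 'x \<Rightarrow> 's"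
  where "merge \<eta> \<zeta> = (\<lambda>x \<in> verts X. if \<eta> x = b then \<zeta> x else \<eta> x)"

lemma merge_apply: "x \<in> verts X \<Longrightarrow> merge \<eta> \<zeta> x = (if \<eta> x = b then \<zeta> x else \<eta> x)"
  by (simp add: merge_def)

lemma supp_merge [simp]: "supp (merge \<eta> \<zeta>) = supp \<eta> \<union> supp \<zeta>"
  by (auto simp: supp_def merge_def)

lemma merge_in_S: "\<eta> \<in> S \<Longrightarrow> \<zeta> \<in> S \<Longrightarrow> merge \<eta> \<zeta> \<in> S"
  unfolding in_S_iff supp_merge by (simp add: merge_def)

text \<open>Overlapping supports do no harm here: on both sides the first occupied entry wins. This
  associativity is the source of the cocycle identity.\<close>

lemma merge_assoc: "merge (merge \<eta> \<zeta>) \<theta> = merge \<eta> (merge \<zeta> \<theta>)"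
  by (auto simp: merge_def fun_eq_iff)

lemma merge_commute: "supp \<eta> \<inter> supp \<zeta> = {} \<Longrightarrow> merge \<eta> \<zeta> = merge \<zeta> \<eta>"
  by (auto simp: merge_def fun_eq_iff supp_def)

lemma merge_left: "x \<in> verts X \<Longrightarrow> x \<notin> supp \<zeta> \<Longrightarrow> merge \<eta> \<zeta> x = \<eta> x"
  by (auto simp: merge_apply supp_def)

lemma merge_right: "x \<in> verts X \<Longrightarrow> x \<notin> supp \<eta> \<Longrightarrow> merge \<eta> \<zeta> x = \<zeta> x"
  by (auto simp: merge_apply supp_def)

lemma merge_cut: "\<eta> \<in> S \<Longrightarrow> merge (cut \<eta> A) (cut \<eta> (- A)) = \<eta>"
  by (rule config_eqI) (auto simp: merge_in_S cut_in_S merge_apply cut_apply)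

lemma off_supp:
  assumes "supp \<eta> \<union> supp \<zeta> \<subseteq> V" "x \<in> verts X" "x \<notin> V"
  shows "\<eta> x = \<zeta> x"
proof -
  have "x \<notin> supp \<eta>" "x \<notin> supp \<zeta>" using assms by blast+
  then show ?thesis using not_supp[OF assms(2)] by metis
qed

lemma charge_merge:
  assumes S: "\<eta> \<in> S" "\<zeta> \<in> S" and disj: "supp \<eta> \<inter> supp \<zeta> = {}"
  shows "charge (merge \<eta> \<zeta>) = charge \<eta> + charge \<zeta>"
proof
  fix \<xi> :: "'s \<Rightarrow> real"
  have "(\<Sum>x \<in> supp \<eta> \<union> supp \<zeta>. \<xi> (merge \<eta> \<zeta> x))
      = (\<Sum>x \<in> supp \<eta>. \<xi> (merge \<eta> \<zeta> x)) + (\<Sum>x \<in> supp \<zeta>. \<xi> (merge \<eta> \<zeta> x))"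
    using S disj by (intro sum.union_disjoint) auto
  also have "(\<Sum>x \<in> supp \<eta>. \<xi> (merge \<eta> \<zeta> x)) = (\<Sum>x \<in> supp \<eta>. \<xi> (\<eta> x))"
    using disj by (intro sum.cong refl arg_cong[of _ _ \<xi>] merge_left) (auto simp: supp_verts)
  also have "(\<Sum>x \<in> supp \<zeta>. \<xi> (merge \<eta> \<zeta> x)) = (\<Sum>x \<in> supp \<zeta>. \<xi> (\<zeta> x))"
    using disj by (intro sum.cong refl arg_cong[of _ _ \<xi>] merge_right) (auto simp: supp_verts)
  finally show "charge (merge \<eta> \<zeta>) \<xi> = (charge \<eta> + charge \<zeta>) \<xi>" by (simp add: charge_def)
qed

definition pair :: "(('x \<Rightarrow> 's) \<Rightarrow> real) \<Rightarrow> ('x \<Rightarrow> 's) \<Rightarrow> ('x \<Rightarrow> 's) \<Rightarrow> real"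
  where "pair f \<eta> \<zeta> = f (merge \<eta> \<zeta>) - f \<eta> - f \<zeta>"

text \<open>Separation is one-sided: \<open>\<zeta>\<close> lies above \<open>\<eta>\<close> with
  respect to the height \<open>q\<close>. The empty configuration is separated from every other in
  both orders.\<close>

definition sep :: "('x \<Rightarrow> int) \<Rightarrow> int \<Rightarrow> ('x \<Rightarrow> 's) \<Rightarrow> ('x \<Rightarrow> 's) \<Rightarrow> bool"
  where "sep q C \<eta> \<zeta> \<longleftrightarrow> (\<forall>x \<in> supp \<eta>. \<forall>y \<in> supp \<zeta>. q x + C < q y)"

lemma sep_disjoint: "sep q C \<eta> \<zeta> \<Longrightarrow> 0 \<le> C \<Longrightarrow> supp \<eta> \<inter> supp \<zeta> = {}"
  unfolding sep_def by force

lemma sep_mono: "sep q C \<eta> \<zeta> \<Longrightarrow> C' \<le> C \<Longrightarrow> sep q C' \<eta> \<zeta>"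
  unfolding sep_def by force

lemma sep_uminus: "sep (\<lambda>x. - q x) C \<eta> \<zeta> \<longleftrightarrow> sep q C \<zeta> \<eta>"
  unfolding sep_def by (auto simp: algebra_simps)

lemma sep_merge_left: "sep q C (merge \<eta> \<zeta>) \<theta> \<longleftrightarrow> sep q C \<eta> \<theta> \<and> sep q C \<zeta> \<theta>"
  unfolding sep_def by auto

lemma sep_merge_right: "sep q C \<eta> (merge \<zeta> \<theta>) \<longleftrightarrow> sep q C \<eta> \<zeta> \<and> sep q C \<eta> \<theta>"
  unfolding sep_def by auto

text \<open>A single translation ascends in both heights. A configuration can then be lifted above
  another one for \<open>q\<close> and \<open>q'\<close> simultaneously, so that the two pairings
  can be compared.\<close>

definition codirected :: "('x \<Rightarrow> int) \<Rightarrow> ('x \<Rightarrow> int) \<Rightarrow> bool"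
  where "codirected q q' \<longleftrightarrow> (\<exists>\<nu> \<nu>' g. equivariant q \<nu> \<and> equivariant q' \<nu>' \<and> g \<in> carrier G \<and> \<nu> g = 1 \<and> \<nu>' g = 1)"

lemma codirected_self: "direction q \<Longrightarrow> codirected q q"
  unfolding direction_def codirected_def by blast

lemma codirected_shift:
  assumes "codirected q q'"
  shows "\<exists>g \<in> carrier G. \<exists>k \<ge> K. \<forall>x \<in> verts X. q (aV g x) = q x + k \<and> q' (aV g x) = q' x + k"
proof -
  obtain \<nu> \<nu>' g where *: "equivariant q \<nu>" "equivariant q' \<nu>'" "g \<in> carrier G" "\<nu> g = 1" "\<nu>' g = 1"
    using assms unfolding codirected_def by blast
  have "g [^] nat K \<in> carrier G" using * by simp
  moreover have "int (nat K) \<ge> K" by simp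
  moreover have "\<forall>x \<in> verts X. q (aV (g [^] nat K) x) = q x + int (nat K) \<and>
      q' (aV (g [^] nat K) x) = q' x + int (nat K)"
    using equivariant_pow[OF *(1,3)] equivariant_pow[OF *(2,3)] *(4,5) by simp
  ultimately show ?thesis by blast
qed

lemma sep_shift:
  assumes "\<eta> \<in> S" "\<zeta> \<in> S"
  shows "\<exists>K. \<forall>g \<in> carrier G. \<forall>k \<ge> K. (\<forall>x \<in> verts X. q (aV g x) = q x + k) \<longrightarrow> sep q C \<eta> (act g \<zeta>)"
proof -
  obtain K where K: "\<forall>x \<in> supp \<eta> \<union> supp \<zeta>. \<bar>q x\<bar> \<le> K"
    using finite_int_bound[of "supp \<eta> \<union> supp \<zeta>" q] assms by auto
  have "sep q C \<eta> (act g \<zeta>)"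
    if g: "g \<in> carrier G" and k: "k \<ge> 2 * K + C + 1" and q: "\<forall>x \<in> verts X. q (aV g x) = q x + k" for g k
    unfolding sep_def supp_act[OF g]
  proof (intro ballI)
    fix x y assume "x \<in> supp \<eta>" "y \<in> aV g ` supp \<zeta>"
    then obtain z where z: "z \<in> supp \<zeta>" "y = aV g z" by auto
    have "\<bar>q x\<bar> \<le> K" "\<bar>q z\<bar> \<le> K" using K \<open>x \<in> supp \<eta>\<close> z by auto
    moreover have "q y = q z + k" using q z supp_verts by simp
    ultimately show "q x + C < q y" using k by linarith
  qed
  then show ?thesis by blast
qed

lemma codirected_sep:
  assumes "codirected q q'" "\<eta> \<in> S" "\<zeta> \<in> S"
  shows "\<exists>g \<in> carrier G. sep q C \<eta> (act g \<zeta>) \<and> sep q' C \<eta> (act g \<zeta>)"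
proof -
  obtain K where K: "\<forall>g \<in> carrier G. \<forall>k \<ge> K. (\<forall>x \<in> verts X. q (aV g x) = q x + k) \<longrightarrow> sep q C \<eta> (act g \<zeta>)"
    using sep_shift[OF assms(2,3)] by blast
  obtain K' where K': "\<forall>g \<in> carrier G. \<forall>k \<ge> K'. (\<forall>x \<in> verts X. q' (aV g x) = q' x + k) \<longrightarrow> sep q' C \<eta> (act g \<zeta>)"
    using sep_shift[OF assms(2,3)] by blast
  obtain g k where g: "g \<in> carrier G" "k \<ge> max K K'"
      "\<forall>x \<in> verts X. q (aV g x) = q x + k \<and> q' (aV g x) = q' x + k"
    using codirected_shift[OF assms(1)] by blast
  then have "sep q C \<eta> (act g \<zeta>)" "sep q' C \<eta> (act g \<zeta>)" using K K' by auto
  then show ?thesis using g(1) by blast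
qed

lemma direction_sep:
  "direction q \<Longrightarrow> \<eta> \<in> S \<Longrightarrow> \<zeta> \<in> S \<Longrightarrow> \<exists>g \<in> carrier G. sep q C \<eta> (act g \<zeta>)"
  using codirected_sep[OF codirected_self] by blast

section \<open>Moving one of two distant configurations\<close>

lemma direction_lipschitz:
  assumes "direction q"
  obtains D where "D \<ge> 0" and "\<And>x y. gdist X x y \<le> enat R \<Longrightarrow> \<bar>q x - q y\<bar> \<le> D"
proof -
  obtain \<nu> where "equivariant q \<nu>" using assms by (auto simp: direction_def)
  then obtain L where L: "L \<ge> 0" "\<forall>e \<in> arcs X. \<bar>q (head X e) - q (tail X e)\<bar> \<le> L"
    using equivariant_lipschitz by blast
  have *: "\<bar>q x - q y\<bar> \<le> L * int R" if "gdist X x y \<le> enat R" for x y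
    using L that by (intro gdist_lipschitz) auto
  have "0 \<le> L * int R" using L(1) by simp
  then show ?thesis using * by (rule that)
qed

text \<open>The rearrangement from \<open>\<zeta>\<close> to \<open>\<zeta>'\<close> takes place in
  a connected set that may hang down by the margin \<open>c\<close> of
  \<open>half_space_connected\<close>, and heights vary by at most \<open>D\<close> within distance
  \<open>R\<close>; hence the separation \<open>c + D\<close>.\<close>

lemma pair_move_upper:
  assumes q: "direction q" and f: "local_gradient R f"
  obtains C where "C \<ge> 0" and "\<And>\<eta> \<zeta> \<zeta>'. \<eta> \<in> S \<Longrightarrow> \<zeta> \<in> S \<Longrightarrow> \<zeta>' \<in> S \<Longrightarrow> sep q C \<eta> \<zeta> \<Longrightarrow>
    sep q C \<eta> \<zeta>' \<Longrightarrow> charge \<zeta> = charge \<zeta>' \<Longrightarrow> pair f \<eta> \<zeta> = pair f \<eta> \<zeta>'"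
proof -
  obtain c where c: "c \<ge> 0" "\<And>m A. finite A \<Longrightarrow> A \<subseteq> verts X \<Longrightarrow> \<forall>x \<in> A. m \<le> q x \<Longrightarrow>
      \<exists>V. finite V \<and> conn V \<and> A \<subseteq> V \<and> (\<forall>x \<in> V. m - c \<le> q x)"
    by (fact half_space_connected[OF q])
  obtain D where D: "D \<ge> 0" "\<And>x y. gdist X x y \<le> enat R \<Longrightarrow> \<bar>q x - q y\<bar> \<le> D"
    by (fact direction_lipschitz[OF q])
  have *: "pair f \<eta> \<zeta> = pair f \<eta> \<zeta>'"
    if S: "\<eta> \<in> S" "\<zeta> \<in> S" "\<zeta>' \<in> S" and sep: "sep q (c + D) \<eta> \<zeta>" "sep q (c + D) \<eta> \<zeta>'"
      and ch: "charge \<zeta> = charge \<zeta>'" for \<eta> \<zeta> \<zeta>'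
  proof (cases "supp \<eta> = {}")
    \<comment> \<open>Treated apart because the level \<open>m\<close> below is obtained from a
      maximum over the support of \<open>\<eta>\<close>.\<close>
    case True
    have "merge \<eta> \<theta> = \<theta>" if "\<theta> \<in> S" for \<theta>
      using that S True by (intro config_eqI) (auto simp: merge_in_S merge_right)
    then show ?thesis using S by (simp add: pair_def)
  next
    case False
    \<comment> \<open>The lowest height that separation allows for \<open>\<zeta>\<close> and
      \<open>\<zeta>'\<close>; the summand 1 expresses the strict inequality of integers in
      \<open>sep\<close>. The connected set below then stays more than \<open>D\<close> above
      \<open>\<eta>\<close>.\<close>
    define m where "m = Max (q ` supp \<eta>) + c + D + 1"
    have le: "q x \<le> m - c - D - 1" if "x \<in> supp \<eta>" for x
      using that S by (simp add: m_def)
    have "m \<le> q y" if "y \<in> supp \<zeta> \<union> supp \<zeta>'" for y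
    proof -
      have "Max (q ` supp \<eta>) \<in> q ` supp \<eta>" using False S by (intro Max_in) auto
      then obtain x where "x \<in> supp \<eta>" "q x = Max (q ` supp \<eta>)" by auto
      moreover have "q x + (c + D) < q y"
        using that sep \<open>x \<in> supp \<eta>\<close> unfolding sep_def by blast
      ultimately show ?thesis by (simp add: m_def)
    qed
    then have up: "\<forall>y \<in> supp \<zeta> \<union> supp \<zeta>'. m \<le> q y" by blast
    have fin: "finite (supp \<zeta> \<union> supp \<zeta>')" "supp \<zeta> \<union> supp \<zeta>' \<subseteq> verts X"
      using S supp_verts by auto
    obtain V where V: "finite V" "conn V" "supp \<zeta> \<union> supp \<zeta>' \<subseteq> V" "\<forall>x \<in> V. m - c \<le> q x"
      using c(2)[OF fin up] by (elim exE conjE)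
    have VX: "V \<subseteq> verts X" using V by (simp add: conn_def)
    have near: "y \<notin> supp \<eta>" if "x \<in> V" "gdist X x y \<le> enat R" for x y
    proof
      assume "y \<in> supp \<eta>"
      then have "q y \<le> m - c - D - 1" by (rule le)
      moreover have "m - c \<le> q x" using V that by simp
      moreover have "\<bar>q x - q y\<bar> \<le> D" using D that by simp
      ultimately show False by linarith
    qed
    have disj: "supp \<eta> \<inter> supp \<zeta> = {}" "supp \<eta> \<inter> supp \<zeta>' = {}"
      using sep c(1) D(1) by (auto intro!: sep_disjoint[of q "c + D"])
    have "f (merge \<eta> \<zeta>') - f (merge \<eta> \<zeta>) = f \<zeta>' - f \<zeta>"
    proof (rule local_move[OF f V(1,2)])
      show "merge \<eta> \<zeta> \<in> S" "\<zeta> \<in> S" "merge \<eta> \<zeta>' \<in> S" "\<zeta>' \<in> S" using S by (auto intro: merge_in_S)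
      show "merge \<eta> \<zeta> x = merge \<eta> \<zeta>' x" if "x \<in> verts X" "x \<notin> V" for x
        using that V(3) by (subst (1 2) merge_left) auto
      show "\<zeta> x = \<zeta>' x" if "x \<in> verts X" "x \<notin> V" for x
        by (rule off_supp[OF V(3) that])
      show "merge \<eta> \<zeta> y = \<zeta> y" if "x \<in> V" "y \<in> verts X" "gdist X x y \<le> enat R" for x y
        using near that by (intro merge_right) auto
      show "merge \<eta> \<zeta>' x = \<zeta>' x" if "x \<in> V" for x
        using near[OF that gdist_self] VX that by (intro merge_right) auto
      show "charge (merge \<eta> \<zeta>) = charge (merge \<eta> \<zeta>')"
        using S disj ch by (simp add: charge_merge)
    qed
    then show ?thesis by (simp add: pair_def)
  qed
  have "0 \<le> c + D" using c(1) D(1) by simp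
  then show ?thesis using * by (rule that)
qed

text \<open>The connected set \<open>W\<close> is prescribed here, and \<open>\<zeta>\<close> has to
  be above all of it, not only above the supports. Such a position can be reached by first moving
  \<open>\<zeta>\<close> up.\<close>

lemma pair_move_lower:
  assumes q: "direction q" and f: "local_gradient R f"
  obtains D where "D \<ge> 0" and "\<And>W \<eta> \<eta>' \<zeta>. \<eta> \<in> S \<Longrightarrow> \<eta>' \<in> S \<Longrightarrow> \<zeta> \<in> S \<Longrightarrow> finite W \<Longrightarrow> conn W \<Longrightarrow>
    supp \<eta> \<union> supp \<eta>' \<subseteq> W \<Longrightarrow> \<forall>w \<in> W. \<forall>y \<in> supp \<zeta>. q w + D < q y \<Longrightarrow> charge \<eta> = charge \<eta>' \<Longrightarrow>
    pair f \<eta> \<zeta> = pair f \<eta>' \<zeta>"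
proof -
  obtain D where D: "D \<ge> 0" "\<And>x y. gdist X x y \<le> enat R \<Longrightarrow> \<bar>q x - q y\<bar> \<le> D"
    by (fact direction_lipschitz[OF q])
  have *: "pair f \<eta> \<zeta> = pair f \<eta>' \<zeta>"
    if S: "\<eta> \<in> S" "\<eta>' \<in> S" "\<zeta> \<in> S" and W: "finite W" "conn W" "supp \<eta> \<union> supp \<eta>' \<subseteq> W"
      and far: "\<forall>w \<in> W. \<forall>y \<in> supp \<zeta>. q w + D < q y" and ch: "charge \<eta> = charge \<eta>'" for W \<eta> \<eta>' \<zeta>
  proof -
    have WX: "W \<subseteq> verts X" using W by (simp add: conn_def)
    have near: "y \<notin> supp \<zeta>" if "x \<in> W" "gdist X x y \<le> enat R" for x y
      using far that D(2)[OF that(2)] by force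
    have disj: "supp \<eta> \<inter> supp \<zeta> = {}" "supp \<eta>' \<inter> supp \<zeta> = {}"
      using near gdist_self W(3) WX by blast+
    have "f (merge \<eta>' \<zeta>) - f (merge \<eta> \<zeta>) = f \<eta>' - f \<eta>"
    proof (rule local_move[OF f W(1,2)])
      show "merge \<eta> \<zeta> \<in> S" "\<eta> \<in> S" "merge \<eta>' \<zeta> \<in> S" "\<eta>' \<in> S" using S by (auto intro: merge_in_S)
      show "merge \<eta> \<zeta> x = merge \<eta>' \<zeta> x" if "x \<in> verts X" "x \<notin> W" for x
        using that W(3) by (subst (1 2) merge_right) auto
      show "\<eta> x = \<eta>' x" if "x \<in> verts X" "x \<notin> W" for x
        by (rule off_supp[OF W(3) that])
      show "merge \<eta> \<zeta> y = \<eta> y" if "x \<in> W" "y \<in> verts X" "gdist X x y \<le> enat R" for x y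
        using near that by (intro merge_left) auto
      show "merge \<eta>' \<zeta> x = \<eta>' x" if "x \<in> W" for x
        using near[OF that gdist_self] WX that by (intro merge_left) auto
      show "charge (merge \<eta> \<zeta>) = charge (merge \<eta>' \<zeta>)"
        using S disj ch by (simp add: charge_merge)
    qed
    then show ?thesis by (simp add: pair_def)
  qed
  show ?thesis by (rule that[OF D(1) *])
qed

text \<open>First \<open>\<zeta>\<close> is translated above a connected set containing both lower
  configurations, then these are exchanged, and finally the upper configuration comes down as
  \<open>\<zeta>'\<close>. The constant is that of \<open>pair_move_upper\<close>, as the
  intermediate height may depend on the configurations.\<close>

lemma pair_charge:
  assumes q: "direction q" and f: "local_gradient R f"
  obtains C where "C \<ge> 0" and "\<And>\<eta> \<eta>' \<zeta> \<zeta>'. \<eta> \<in> S \<Longrightarrow> \<eta>' \<in> S \<Longrightarrow> \<zeta> \<in> S \<Longrightarrow> \<zeta>' \<in> S \<Longrightarrow> sep q C \<eta> \<zeta> \<Longrightarrow>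
      sep q C \<eta>' \<zeta>' \<Longrightarrow> charge \<eta> = charge \<eta>' \<Longrightarrow> charge \<zeta> = charge \<zeta>' \<Longrightarrow> pair f \<eta> \<zeta> = pair f \<eta>' \<zeta>'"
proof -
  obtain C where C: "C \<ge> 0" "\<And>\<eta> \<zeta> \<zeta>'. \<eta> \<in> S \<Longrightarrow> \<zeta> \<in> S \<Longrightarrow> \<zeta>' \<in> S \<Longrightarrow> sep q C \<eta> \<zeta> \<Longrightarrow> sep q C \<eta> \<zeta>' \<Longrightarrow>
      charge \<zeta> = charge \<zeta>' \<Longrightarrow> pair f \<eta> \<zeta> = pair f \<eta> \<zeta>'"
    by (fact pair_move_upper[OF q f])
  obtain D where D: "D \<ge> 0" "\<And>W \<eta> \<eta>' \<zeta>. \<eta> \<in> S \<Longrightarrow> \<eta>' \<in> S \<Longrightarrow> \<zeta> \<in> S \<Longrightarrow> finite W \<Longrightarrow> conn W \<Longrightarrow>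
      supp \<eta> \<union> supp \<eta>' \<subseteq> W \<Longrightarrow> \<forall>w \<in> W. \<forall>y \<in> supp \<zeta>. q w + D < q y \<Longrightarrow> charge \<eta> = charge \<eta>' \<Longrightarrow>
      pair f \<eta> \<zeta> = pair f \<eta>' \<zeta>"
    by (fact pair_move_lower[OF q f])
  have *: "pair f \<eta> \<zeta> = pair f \<eta>' \<zeta>'"
    if S: "\<eta> \<in> S" "\<eta>' \<in> S" "\<zeta> \<in> S" "\<zeta>' \<in> S" and sep: "sep q C \<eta> \<zeta>" "sep q C \<eta>' \<zeta>'"
      and ch: "charge \<eta> = charge \<eta>'" "charge \<zeta> = charge \<zeta>'" for \<eta> \<eta>' \<zeta> \<zeta>'
  proof -
    obtain W where W: "finite W" "conn W" "supp \<eta> \<union> supp \<eta>' \<subseteq> W"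
      using finite_conn_cover[of "supp \<eta> \<union> supp \<eta>'"] S supp_subset_verts by auto
    obtain K where K: "\<forall>x \<in> W \<union> supp \<zeta>. \<bar>q x\<bar> \<le> K"
      using finite_int_bound[of "W \<union> supp \<zeta>" q] W S by auto
    obtain g k where g: "g \<in> carrier G" "k \<ge> 2 * K + C + D + 1" "\<forall>x \<in> verts X. q (aV g x) = q x + k"
      using codirected_shift[OF codirected_self[OF q]] by blast
    let ?\<zeta> = "act g \<zeta>"
    have "q w + C + D < q y" if w: "w \<in> W" and y: "y \<in> supp ?\<zeta>" for w y
    proof -
      obtain z where z: "z \<in> supp \<zeta>" "y = aV g z" using y g(1) by (auto simp: supp_act)
      then have "q y = q z + k" using g supp_verts by simp
      moreover have "\<bar>q z\<bar> \<le> K" "\<bar>q w\<bar> \<le> K" using K z w by auto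
      ultimately show ?thesis using g(2) by linarith
    qed
    then have far: "\<forall>w \<in> W. \<forall>y \<in> supp ?\<zeta>. q w + D < q y" "\<forall>w \<in> W. \<forall>y \<in> supp ?\<zeta>. q w + C < q y"
      using C(1) D(1) by force+
    have sep': "sep q C \<eta> ?\<zeta>" "sep q C \<eta>' ?\<zeta>" using far(2) W(3) unfolding sep_def by auto
    have \<zeta>: "?\<zeta> \<in> S" "charge ?\<zeta> = charge \<zeta>" using g(1) S by (auto simp: act_in_S charge_act)
    have "pair f \<eta> \<zeta> = pair f \<eta> ?\<zeta>" using C(2)[OF S(1,3) \<zeta>(1) sep(1) sep'(1)] \<zeta> by simp
    also have "\<dots> = pair f \<eta>' ?\<zeta>" by (rule D(2)[OF S(1,2) \<zeta>(1) W far(1) ch(1)])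
    also have "\<dots> = pair f \<eta>' \<zeta>'" using C(2)[OF S(2) \<zeta>(1) S(4) sep'(2) sep(2)] \<zeta> ch by simp
    finally show ?thesis .
  qed
  show ?thesis by (rule that[OF C(1) *])
qed

section \<open>The cocycle of a direction\<close>

definition has_pairing ::
    "(('x \<Rightarrow> 's) \<Rightarrow> real) \<Rightarrow> ('x \<Rightarrow> int) \<Rightarrow> ((('s \<Rightarrow> real) \<Rightarrow> real) \<Rightarrow> (('s \<Rightarrow> real) \<Rightarrow> real) \<Rightarrow> real) \<Rightarrow> bool"
  where "has_pairing f q H \<longleftrightarrow> (\<exists>C \<ge> 0. \<forall>\<eta> \<in> S. \<forall>\<zeta> \<in> S. sep q C \<eta> \<zeta> \<longrightarrow> pair f \<eta> \<zeta> = H (charge \<eta>) (charge \<zeta>))"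

lemma has_pairingE:
  assumes "has_pairing f q H"
  obtains C where "C \<ge> 0" and "\<And>\<eta> \<zeta>. \<eta> \<in> S \<Longrightarrow> \<zeta> \<in> S \<Longrightarrow> sep q C \<eta> \<zeta> \<Longrightarrow> pair f \<eta> \<zeta> = H (charge \<eta>) (charge \<zeta>)"
  using assms unfolding has_pairing_def by blast

lemma pairing_exists:
  assumes "direction q" "local_gradient R f"
  shows "\<exists>H. has_pairing f q H"
proof -
  obtain C where C: "C \<ge> 0" "\<And>\<eta> \<eta>' \<zeta> \<zeta>'. \<eta> \<in> S \<Longrightarrow> \<eta>' \<in> S \<Longrightarrow> \<zeta> \<in> S \<Longrightarrow> \<zeta>' \<in> S \<Longrightarrow> sep q C \<eta> \<zeta> \<Longrightarrow>
      sep q C \<eta>' \<zeta>' \<Longrightarrow> charge \<eta> = charge \<eta>' \<Longrightarrow> charge \<zeta> = charge \<zeta>' \<Longrightarrow> pair f \<eta> \<zeta> = pair f \<eta>' \<zeta>'"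
    by (fact pair_charge[OF assms])
  let ?P = "\<lambda>\<alpha> \<beta> p. fst p \<in> S \<and> snd p \<in> S \<and> sep q C (fst p) (snd p) \<and> charge (fst p) = \<alpha> \<and> charge (snd p) = \<beta>"
  define pr where "pr \<alpha> \<beta> = (SOME p. ?P \<alpha> \<beta> p)" for \<alpha> \<beta>
  define H where "H \<alpha> \<beta> = pair f (fst (pr \<alpha> \<beta>)) (snd (pr \<alpha> \<beta>))" for \<alpha> \<beta>
  have "pair f \<eta> \<zeta> = H (charge \<eta>) (charge \<zeta>)" if "\<eta> \<in> S" "\<zeta> \<in> S" "sep q C \<eta> \<zeta>" for \<eta> \<zeta>
  proof -
    have "?P (charge \<eta>) (charge \<zeta>) (\<eta>, \<zeta>)" using that by simp
    then have "?P (charge \<eta>) (charge \<zeta>) (pr (charge \<eta>) (charge \<zeta>))" unfolding pr_def by (rule someI)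
    then show ?thesis unfolding H_def using that by (intro C(2)) auto
  qed
  then show ?thesis using C(1) unfolding has_pairing_def by blast
qed

text \<open>Reversing the height exchanges the roles of upper and lower configuration, while
  \<open>pair\<close> is symmetric for disjoint supports; so \<open>H\<close> is transposed.\<close>

lemma pairing_uminus:
  assumes "has_pairing f q H"
  shows "has_pairing f (\<lambda>x. - q x) (\<lambda>\<alpha> \<beta>. H \<beta> \<alpha>)"
proof -
  obtain C where C: "C \<ge> 0" "\<And>\<eta> \<zeta>. \<eta> \<in> S \<Longrightarrow> \<zeta> \<in> S \<Longrightarrow> sep q C \<eta> \<zeta> \<Longrightarrow> pair f \<eta> \<zeta> = H (charge \<eta>) (charge \<zeta>)"
    by (fact has_pairingE[OF assms])
  have "pair f \<eta> \<zeta> = H (charge \<zeta>) (charge \<eta>)" if "\<eta> \<in> S" "\<zeta> \<in> S" "sep q C \<zeta> \<eta>" for \<eta> \<zeta>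
  proof -
    have "merge \<eta> \<zeta> = merge \<zeta> \<eta>" using sep_disjoint[OF that(3) C(1)] by (intro merge_commute) auto
    then have "pair f \<eta> \<zeta> = pair f \<zeta> \<eta>" by (simp add: pair_def)
    then show ?thesis using C(2)[OF that(2,1,3)] by simp
  qed
  then show ?thesis unfolding has_pairing_def sep_uminus using C(1) by blast
qed

text \<open>Some translate of \<open>\<zeta>\<close> is above \<open>\<eta>\<close> for both heights
  at once, and it has the charge of \<open>\<zeta>\<close>. Off the charges of configurations,
  \<open>H\<close> and \<open>H'\<close> are arbitrary.\<close>

lemma pairing_unique:
  assumes "has_pairing f q H" "has_pairing f q' H'" "codirected q q'" "\<eta> \<in> S" "\<zeta> \<in> S"
  shows "H (charge \<eta>) (charge \<zeta>) = H' (charge \<eta>) (charge \<zeta>)"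
proof -
  obtain C where C: "C \<ge> 0" "\<And>\<eta> \<zeta>. \<eta> \<in> S \<Longrightarrow> \<zeta> \<in> S \<Longrightarrow> sep q C \<eta> \<zeta> \<Longrightarrow> pair f \<eta> \<zeta> = H (charge \<eta>) (charge \<zeta>)"
    by (fact has_pairingE[OF assms(1)])
  obtain C' where C': "C' \<ge> 0" "\<And>\<eta> \<zeta>. \<eta> \<in> S \<Longrightarrow> \<zeta> \<in> S \<Longrightarrow> sep q' C' \<eta> \<zeta> \<Longrightarrow> pair f \<eta> \<zeta> = H' (charge \<eta>) (charge \<zeta>)"
    by (fact has_pairingE[OF assms(2)])
  obtain g where g: "g \<in> carrier G" "sep q (max C C') \<eta> (act g \<zeta>)" "sep q' (max C C') \<eta> (act g \<zeta>)"
    using codirected_sep[OF assms(3,4,5)] by blast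
  have "pair f \<eta> (act g \<zeta>) = H (charge \<eta>) (charge \<zeta>)"
    using C(2)[OF assms(4) act_in_S[OF g(1) assms(5)] sep_mono[OF g(2)]] charge_act[OF g(1) assms(5)] by simp
  moreover have "pair f \<eta> (act g \<zeta>) = H' (charge \<eta>) (charge \<zeta>)"
    using C'(2)[OF assms(4) act_in_S[OF g(1) assms(5)] sep_mono[OF g(3)]] charge_act[OF g(1) assms(5)] by simp
  ultimately show ?thesis by simp
qed

text \<open>Translates of the three configurations are stacked along \<open>q\<close>; the two sides
  expand \<open>f\<close> of their superposition in the two possible ways.\<close>

lemma pairing_cocycle:
  assumes H: "has_pairing f q H" and q: "direction q" and S: "\<eta> \<in> S" "\<zeta> \<in> S" "\<theta> \<in> S"
  shows "H (charge \<eta>) (charge \<zeta>) + H (charge \<eta> + charge \<zeta>) (charge \<theta>)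
    = H (charge \<zeta>) (charge \<theta>) + H (charge \<eta>) (charge \<zeta> + charge \<theta>)"
proof -
  obtain C where C: "C \<ge> 0" "\<And>\<eta> \<zeta>. \<eta> \<in> S \<Longrightarrow> \<zeta> \<in> S \<Longrightarrow> sep q C \<eta> \<zeta> \<Longrightarrow> pair f \<eta> \<zeta> = H (charge \<eta>) (charge \<zeta>)"
    by (fact has_pairingE[OF H])
  obtain g where g: "g \<in> carrier G" "sep q C \<eta> (act g \<zeta>)" using direction_sep[OF q S(1,2)] by blast
  define \<zeta>' where "\<zeta>' = act g \<zeta>"
  have \<zeta>': "\<zeta>' \<in> S" "charge \<zeta>' = charge \<zeta>" "sep q C \<eta> \<zeta>'"
    using g S by (auto simp: \<zeta>'_def act_in_S charge_act)
  have m: "merge \<eta> \<zeta>' \<in> S" using S \<zeta>' by (simp add: merge_in_S)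
  obtain h where h: "h \<in> carrier G" "sep q C (merge \<eta> \<zeta>') (act h \<theta>)" using direction_sep[OF q m S(3)] by blast
  define \<theta>' where "\<theta>' = act h \<theta>"
  have \<theta>': "\<theta>' \<in> S" "charge \<theta>' = charge \<theta>" "sep q C (merge \<eta> \<zeta>') \<theta>'" "sep q C \<eta> \<theta>'" "sep q C \<zeta>' \<theta>'"
    using h S by (auto simp: \<theta>'_def act_in_S charge_act sep_merge_left)
  have m': "merge \<zeta>' \<theta>' \<in> S" "sep q C \<eta> (merge \<zeta>' \<theta>')"
    using \<zeta>' \<theta>' by (auto simp: merge_in_S sep_merge_right)
  have ch: "charge (merge \<eta> \<zeta>') = charge \<eta> + charge \<zeta>" "charge (merge \<zeta>' \<theta>') = charge \<zeta> + charge \<theta>"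
    using charge_merge[OF S(1) \<zeta>'(1) sep_disjoint[OF \<zeta>'(3) C(1)]]
      charge_merge[OF \<zeta>'(1) \<theta>'(1) sep_disjoint[OF \<theta>'(5) C(1)]] \<zeta>' \<theta>' by auto
  have "pair f \<eta> \<zeta>' + pair f (merge \<eta> \<zeta>') \<theta>' = pair f \<zeta>' \<theta>' + pair f \<eta> (merge \<zeta>' \<theta>')"
    by (simp add: pair_def merge_assoc)
  then show ?thesis
    using C(2)[OF S(1) \<zeta>'(1,3)] C(2)[OF m \<theta>'(1,3)] C(2)[OF \<zeta>'(1) \<theta>'(1,5)] C(2)[OF S(1) m']
    by (simp add: ch \<zeta>'(2) \<theta>'(2))
qed

section \<open>Additivity over distant configurations\<close>

definition additive_far :: "('x \<Rightarrow> int) \<Rightarrow> (('x \<Rightarrow> 's) \<Rightarrow> real) \<Rightarrow> bool"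
  where "additive_far q f \<longleftrightarrow> (\<exists>C \<ge> 0. \<forall>\<eta> \<in> S. \<forall>\<zeta> \<in> S. sep q C \<eta> \<zeta> \<longrightarrow> f (merge \<eta> \<zeta>) = f \<eta> + f \<zeta>)"

lemma additive_far_iff: "additive_far q f \<longleftrightarrow> has_pairing f q (\<lambda>_ _. 0)"
proof -
  have "pair f \<eta> \<zeta> = 0 \<longleftrightarrow> f (merge \<eta> \<zeta>) = f \<eta> + f \<zeta>" for \<eta> \<zeta> by (auto simp: pair_def)
  then show ?thesis unfolding additive_far_def has_pairing_def by simp
qed

lemma has_pairing_0I:
  "has_pairing f q H \<Longrightarrow> (\<And>\<eta> \<zeta>. \<eta> \<in> S \<Longrightarrow> \<zeta> \<in> S \<Longrightarrow> H (charge \<eta>) (charge \<zeta>) = 0) \<Longrightarrow> additive_far q f"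
  unfolding additive_far_iff by (elim has_pairingE) (force simp: has_pairing_def)

text \<open>The effect of removing the particle at \<open>x\<close> is unchanged if the particles far above \<open>x\<close> are first
  moved still further up, where they decouple.\<close>

lemma remove_local:
  assumes q: "direction q" and f: "local_gradient R f" and af: "additive_far q f"
  obtains C where "\<And>\<eta> x. \<eta> \<in> S \<Longrightarrow> x \<in> verts X \<Longrightarrow>
    f \<eta> - f (\<eta>(x := b)) = f (cut \<eta> {y. q y \<le> q x + C}) - f ((cut \<eta> {y. q y \<le> q x + C})(x := b))"
proof -
  obtain c where c: "c \<ge> 0" "\<And>m A. finite A \<Longrightarrow> A \<subseteq> verts X \<Longrightarrow> \<forall>x \<in> A. m \<le> q x \<Longrightarrow>
      \<exists>V. finite V \<and> conn V \<and> A \<subseteq> V \<and> (\<forall>x \<in> V. m - c \<le> q x)"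
    by (fact half_space_connected[OF q])
  obtain D where D: "D \<ge> 0" "\<And>x y. gdist X x y \<le> enat R \<Longrightarrow> \<bar>q x - q y\<bar> \<le> D"
    by (fact direction_lipschitz[OF q])
  obtain C where C: "C \<ge> 0" "\<And>\<eta> \<zeta>. \<eta> \<in> S \<Longrightarrow> \<zeta> \<in> S \<Longrightarrow> sep q C \<eta> \<zeta> \<Longrightarrow> f (merge \<eta> \<zeta>) = f \<eta> + f \<zeta>"
    using af unfolding additive_far_def by blast
  have *: "f \<eta> - f (\<eta>(x := b)) = f (cut \<eta> {y. q y \<le> q x + (c + D)}) - f ((cut \<eta> {y. q y \<le> q x + (c + D)})(x := b))"
    if \<eta>: "\<eta> \<in> S" and x: "x \<in> verts X" for \<eta> x
  proof -
    let ?B = "{y. q y \<le> q x + (c + D)}"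
    \<comment> \<open>Particles at height \<open>m\<close> or above can be moved in a set that
      reaches down to \<open>m - c\<close>, which is still more than \<open>D\<close> above
      \<open>x\<close>.\<close>
    define m where "m = q x + c + D + 1"
    define \<rho> where "\<rho> = cut \<eta> ?B"
    define \<zeta> where "\<zeta> = cut \<eta> (- ?B)"
    have S: "\<rho> \<in> S" "\<zeta> \<in> S" using \<eta> by (auto simp: \<rho>_def \<zeta>_def cut_in_S)
    have \<rho>x: "\<rho>(x := b) \<in> S" "\<eta>(x := b) \<in> S" using S \<eta> x by (auto intro: update_in_S)
    obtain K where K: "\<forall>g \<in> carrier G. \<forall>k \<ge> K. (\<forall>x \<in> verts X. q (aV g x) = q x + k) \<longrightarrow> sep q C \<rho> (act g \<zeta>)"
      using sep_shift[OF S] by blast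
    \<comment> \<open>The bound \<open>K\<close> provides separation from \<open>\<rho>\<close>; the
      bound 0 keeps the translated particles at height \<open>m\<close> or above.\<close>
    obtain g k where g: "g \<in> carrier G" "k \<ge> max K 0" "\<forall>x \<in> verts X. q (aV g x) = q x + k"
      using codirected_shift[OF codirected_self[OF q]] by blast
    define \<zeta>' where "\<zeta>' = act g \<zeta>"
    have \<zeta>': "\<zeta>' \<in> S" "charge \<zeta>' = charge \<zeta>" using g S by (auto simp: \<zeta>'_def act_in_S charge_act)
    have sep: "sep q C \<rho> \<zeta>'" unfolding \<zeta>'_def using K g by auto
    have sep_x: "sep q C (\<rho>(x := b)) \<zeta>'" using sep by (auto simp: sep_def supp_def)
    have up: "m \<le> q y" if "y \<in> supp \<zeta>" for y using that by (auto simp: \<zeta>_def m_def)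
    have up': "m \<le> q y" if y: "y \<in> supp \<zeta>'" for y
    proof -
      obtain z where z: "z \<in> supp \<zeta>" "y = aV g z" using y g(1) by (auto simp: \<zeta>'_def supp_act)
      then have "q y = q z + k" using g(3) supp_verts by simp
      then show ?thesis using up[OF z(1)] g(2) by simp
    qed
    have up_all: "\<forall>y \<in> supp \<zeta> \<union> supp \<zeta>'. m \<le> q y" using up up' by blast
    have fin: "finite (supp \<zeta> \<union> supp \<zeta>')" "supp \<zeta> \<union> supp \<zeta>' \<subseteq> verts X"
      using S \<zeta>'(1) supp_verts by auto
    obtain V where V: "finite V" "conn V" "supp \<zeta> \<union> supp \<zeta>' \<subseteq> V" "\<forall>y \<in> V. m - c \<le> q y"
      using c(2)[OF fin up_all] by (elim exE conjE)
    have VX: "V \<subseteq> verts X" using V by (simp add: conn_def)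
    have near: "y \<noteq> x" if "v \<in> V" "gdist X v y \<le> enat R" for v y
    proof
      assume "y = x"
      then have "\<bar>q v - q x\<bar> \<le> D" using D(2) that by simp
      moreover have "m - c \<le> q v" using V that by simp
      ultimately show False by (simp add: m_def)
    qed
    have x_out: "x \<notin> supp \<zeta>" "x \<notin> supp \<zeta>'" "x \<notin> V"
      using V(3) near[of x x] gdist_self[OF x, of R] by auto
    have \<eta>_eq: "\<eta> = merge \<rho> \<zeta>" unfolding \<rho>_def \<zeta>_def using \<eta> by (simp add: merge_cut)
    have disj: "supp \<rho> \<inter> supp \<zeta> = {}" "supp \<rho> \<inter> supp \<zeta>' = {}"
      using sep_disjoint[OF sep C(1)] by (auto simp: \<rho>_def \<zeta>_def)
    have upd: "merge (\<rho>(x := b)) \<zeta>' y = (if y = x then b else merge \<rho> \<zeta>' y)" if "y \<in> verts X" for y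
      using that x_out by (auto simp: merge_apply supp_def)
    \<comment> \<open>The same move from \<open>\<zeta>\<close> to \<open>\<zeta>'\<close> is run
      with and without the particle at \<open>x\<close>, which is invisible from \<open>V\<close>.
      Afterwards additivity splits off \<open>f \<zeta>'\<close> on both sides, and it
      cancels.\<close>
    have "f (merge \<rho> \<zeta>') - f \<eta> = f (merge (\<rho>(x := b)) \<zeta>') - f (\<eta>(x := b))"
    proof (rule local_move[OF f V(1,2)])
      show "\<eta> \<in> S" "\<eta>(x := b) \<in> S" "merge \<rho> \<zeta>' \<in> S" "merge (\<rho>(x := b)) \<zeta>' \<in> S"
        using S \<zeta>' \<rho>x \<eta> by (auto intro: merge_in_S)
      show off: "\<eta> y = merge \<rho> \<zeta>' y" if "y \<in> verts X" "y \<notin> V" for y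
        unfolding \<eta>_eq using that V(3) by (subst (1 2) merge_left) auto
      show "(\<eta>(x := b)) y = merge (\<rho>(x := b)) \<zeta>' y" if "y \<in> verts X" "y \<notin> V" for y
        using off[OF that] upd[OF that(1)] by simp
      show "\<eta> y = (\<eta>(x := b)) y" if "v \<in> V" "y \<in> verts X" "gdist X v y \<le> enat R" for v y
        using near that by simp
      show "merge \<rho> \<zeta>' y = merge (\<rho>(x := b)) \<zeta>' y" if "y \<in> V" for y
        using upd[of y] that x_out VX by auto
      show "charge \<eta> = charge (merge \<rho> \<zeta>')"
        unfolding \<eta>_eq using S \<zeta>' disj by (simp add: charge_merge)
    qed
    then show ?thesis
      using C(2)[OF S(1) \<zeta>'(1) sep] C(2)[OF \<rho>x(1) \<zeta>'(1) sep_x] by (simp add: \<rho>_def)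
  qed
  show ?thesis by (rule that[OF *])
qed

section \<open>Comparing the coordinate directions\<close>

lemma pos_equivariant: "j \<in> {1..d} \<Longrightarrow> equivariant (pos j) (n j)"
  by (simp add: equivariant_def pos_act)

lemma neg_pos_equivariant: "j \<in> {1..d} \<Longrightarrow> equivariant (\<lambda>x. - pos j x) (\<lambda>g. - n j g)"
  by (simp add: equivariant_def pos_act)

lemma direction_pos: "j \<in> {1..d} \<Longrightarrow> direction (pos j)"
  unfolding direction_def
  using pos_equivariant sigma_closed[of j] n_sigma[of j j]
  by (intro exI[of _ "n j"] conjI bexI[of _ "\<sigma> j"]) auto

lemma direction_neg_pos: "j \<in> {1..d} \<Longrightarrow> direction (\<lambda>x. - pos j x)"
  unfolding direction_def
  using neg_pos_equivariant sigma_closed[of j] n_sigma[of j j] n_inv[of j "\<sigma> j"]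
  by (intro exI[of _ "\<lambda>g. - n j g"] conjI bexI[of _ "inv (\<sigma> j)"]) auto

text \<open>Products of \<open>\<sigma> i\<close> and \<open>\<sigma> j\<close>, with inverses for
  negated heights, ascend in both. For a coordinate and its own negative no such element exists,
  which is the obstruction in dimension one.\<close>

lemma codirected_pos:
  assumes "i \<in> {1..d}" "j \<in> {1..d}" "i \<noteq> j"
  shows "codirected (pos i) (pos j)" "codirected (pos i) (\<lambda>x. - pos j x)"
    "codirected (\<lambda>x. - pos i x) (pos j)"
proof -
  note e = pos_equivariant[OF assms(1)] pos_equivariant[OF assms(2)]
    neg_pos_equivariant[OF assms(1)] neg_pos_equivariant[OF assms(2)]
  note s = sigma_closed[OF assms(1)] sigma_closed[OF assms(2)]
  note v = n_sigma[OF assms(1,1)] n_sigma[OF assms(2,2)] n_sigma[OF assms(1,2)] n_sigma[OF assms(2,1)]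
    n_mult[OF assms(1)] n_mult[OF assms(2)] n_inv[OF assms(1)] n_inv[OF assms(2)]
  show "codirected (pos i) (pos j)" unfolding codirected_def
    using e s v assms(3) by (intro exI[of _ "n i"] exI[of _ "n j"] exI[of _ "\<sigma> i \<otimes> \<sigma> j"]) auto
  show "codirected (pos i) (\<lambda>x. - pos j x)" unfolding codirected_def
    using e s v assms(3)
    by (intro exI[of _ "n i"] exI[of _ "\<lambda>g. - n j g"] exI[of _ "\<sigma> i \<otimes> inv (\<sigma> j)"]) auto
  show "codirected (\<lambda>x. - pos i x) (pos j)" unfolding codirected_def
    using e s v assms(3)
    by (intro exI[of _ "\<lambda>g. - n i g"] exI[of _ "n j"] exI[of _ "inv (\<sigma> i) \<otimes> \<sigma> j"]) auto
qed

text \<open>The first coordinate is codirected with every other coordinate and its negative, so the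
  vanishing of its pairing spreads to them; its own negative has the transposed pairing.\<close>

lemma additive_far_all_directions:
  assumes f: "local_gradient R f" and af: "additive_far (pos 1) f" and j: "j \<in> {1..d}"
  shows "additive_far (pos j) f \<and> additive_far (\<lambda>x. - pos j x) f"
proof (cases "j = 1")
  case True
  then show ?thesis using af pairing_uminus[of f "pos 1"] by (auto simp: additive_far_iff)
next
  case False
  have 1: "1 \<in> {1..d}" using d_pos by simp
  note cd = codirected_pos[OF 1 j False[symmetric]]
  have 0: "has_pairing f (pos 1) (\<lambda>_ _. 0)" using af by (simp add: additive_far_iff)
  obtain H where H: "has_pairing f (pos j) H" using pairing_exists[OF direction_pos[OF j] f] by blast
  obtain H' where H': "has_pairing f (\<lambda>x. - pos j x) H'" using pairing_exists[OF direction_neg_pos[OF j] f] by blast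
  have "additive_far (pos j) f"
    using pairing_unique[OF 0 H cd(1)] by (intro has_pairing_0I[OF H]) simp
  moreover have "additive_far (\<lambda>x. - pos j x) f"
    using pairing_unique[OF 0 H' cd(2)] by (intro has_pairing_0I[OF H']) simp
  ultimately show ?thesis by blast
qed

lemma pairing_symmetric:
  assumes f: "local_gradient R f" and H: "has_pairing f (pos 1) H" and d: "d \<ge> 2"
    and S: "\<eta> \<in> S" "\<zeta> \<in> S"
  shows "H (charge \<eta>) (charge \<zeta>) = H (charge \<zeta>) (charge \<eta>)"
proof -
  have j: "1 \<in> {1..d}" "2 \<in> {1..d}" using d by auto
  note cd = codirected_pos[OF j]
  obtain H2 where H2: "has_pairing f (pos 2) H2" using pairing_exists[OF direction_pos[OF j(2)] f] by blast
  have "H (charge \<eta>) (charge \<zeta>) = H2 (charge \<eta>) (charge \<zeta>)"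
    by (rule pairing_unique[OF H H2 cd(1) S]) simp
  also have "\<dots> = H (charge \<zeta>) (charge \<eta>)"
    using pairing_unique[OF pairing_uminus[OF H] H2 cd(3) S] by simp
  finally show ?thesis .
qed

text \<open>If \<open>y\<close> is far from \<open>x\<close>, then some coordinate or its negative
  places \<open>y\<close> high above \<open>x\<close>, and by \<open>remove_local\<close> for that
  height the effect of erasing \<open>x\<close> does not see \<open>y\<close>.\<close>

lemma additive_far_short_range:
  assumes f: "local_gradient R f" and af: "additive_far (pos 1) f"
  shows "\<exists>R. short_range R f"
proof -
  define Q where "Q = pos ` {1..d} \<union> (\<lambda>j x. - pos j x) ` {1..d}"
  define good where "good q C \<longleftrightarrow> (\<forall>\<eta> \<in> S. \<forall>x \<in> verts X. f \<eta> - f (\<eta>(x := b))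
      = f (cut \<eta> {y. q y \<le> q x + C}) - f ((cut \<eta> {y. q y \<le> q x + C})(x := b)))" for q :: "'x \<Rightarrow> int" and C
  have "\<exists>C. good q C" if "q \<in> Q" for q
  proof -
    have q: "direction q" "additive_far q f"
      using that additive_far_all_directions[OF f af] direction_pos direction_neg_pos
      unfolding Q_def by blast+
    show ?thesis
      by (rule remove_local[OF q(1) f q(2)]) (unfold good_def, blast)
  qed
  then have "\<exists>C. \<forall>q \<in> Q. good q (C q)" by (intro bchoice) blast
  then obtain C where "\<forall>q \<in> Q. good q (C q)" ..
  then have C: "f \<eta> - f (\<eta>(x := b)) = f (cut \<eta> {y. q y \<le> q x + C q}) - f ((cut \<eta> {y. q y \<le> q x + C q})(x := b))"
    if "q \<in> Q" "\<eta> \<in> S" "x \<in> verts X" for q \<eta> x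
    using that unfolding good_def by blast
  have "finite Q" by (simp add: Q_def)
  then obtain K where K: "\<forall>q \<in> Q. \<bar>C q\<bar> \<le> K" using finite_int_bound[of Q C] by blast
  obtain R' where R': "\<And>x y. x \<in> verts X \<Longrightarrow> y \<in> verts X \<Longrightarrow> \<forall>j \<in> {1..d}. \<bar>pos j y - pos j x\<bar> \<le> K \<Longrightarrow>
      gdist X x y \<le> enat R'"
    using box_gdist[of K] by blast
  have "short_range R' f" unfolding short_range_def
  proof (intro ballI impI)
    fix \<eta> x y assume \<eta>: "\<eta> \<in> S" and x: "x \<in> verts X" and y: "y \<in> verts X"
      and far: "\<not> gdist X x y \<le> enat R'"
    then obtain j where j: "j \<in> {1..d}" "\<not> \<bar>pos j y - pos j x\<bar> \<le> K" using R' by blast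
    have "\<exists>q \<in> Q. q x + K < q y"
    proof (cases "pos j x \<le> pos j y")
      case True
      then show ?thesis using j by (intro bexI[of _ "pos j"]) (auto simp: Q_def)
    next
      case False
      then show ?thesis using j by (intro bexI[of _ "\<lambda>x. - pos j x"]) (auto simp: Q_def)
    qed
    then obtain q where q: "q \<in> Q" "q x + K < q y" by blast
    have "\<bar>C q\<bar> \<le> K" using K q by simp
    then have "y \<notin> {z. q z \<le> q x + C q}" using q(2) by auto
    then have "cut (\<eta>(y := b)) {z. q z \<le> q x + C q} = cut \<eta> {z. q z \<le> q x + C q}"
      by (intro cut_eqI) auto
    then have "f \<eta> - f (\<eta>(x := b)) = f (\<eta>(y := b)) - f (\<eta>(y := b, x := b))"
      using C[OF q(1) \<eta> x] C[OF q(1) update_in_S[OF \<eta> y] x] by simp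
    moreover have "\<eta>(y := b, x := b) = \<eta>(x := b, y := b)" by (auto simp: fun_eq_iff)
    ultimately show "f \<eta> + f (\<eta>(x := b, y := b)) = f (\<eta>(x := b)) + f (\<eta>(y := b))" by simp
  qed
  then show ?thesis ..
qed

end

section \<open>Splitting of cocycles\<close>

text \<open>The additive group of the reals is divisible, hence injective.\<close>

lemma extend_additive_to_real:
  fixes E :: "'a monoid" (structure) and u :: "'a \<Rightarrow> real"
  assumes "comm_monoid E"
    and cancel: "\<And>a a' c. a \<in> carrier E \<Longrightarrow> a' \<in> carrier E \<Longrightarrow> c \<in> carrier E \<Longrightarrow> a \<otimes> c = a' \<otimes> c \<Longrightarrow> a = a'"
    and U: "U \<subseteq> carrier E" "\<one> \<in> U" "\<And>a a'. a \<in> U \<Longrightarrow> a' \<in> U \<Longrightarrow> a \<otimes> a' \<in> U"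
    and u: "\<And>a a'. a \<in> U \<Longrightarrow> a' \<in> U \<Longrightarrow> u (a \<otimes> a') = u a + u a'"
  shows "\<exists>s. (\<forall>a \<in> carrier E. \<forall>a' \<in> carrier E. s (a \<otimes> a') = s a + s a') \<and> (\<forall>a \<in> U. s a = u a)"
proof -
  interpret comm_monoid E by fact
  \<comment> \<open>Partial additive maps extending \<open>u\<close>, represented by their graphs so
    that extension is inclusion and Zorn's lemma applies.\<close>
  define \<G> where "\<G> = {\<Gamma>. \<Gamma> \<subseteq> carrier E \<times> (UNIV :: real set) \<and> (\<lambda>a. (a, u a)) ` U \<subseteq> \<Gamma> \<and>
    (\<forall>a r a' r'. (a, r) \<in> \<Gamma> \<longrightarrow> (a', r') \<in> \<Gamma> \<longrightarrow> (a \<otimes> a', r + r') \<in> \<Gamma>) \<and>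
    (\<forall>a r r'. (a, r) \<in> \<Gamma> \<longrightarrow> (a, r') \<in> \<Gamma> \<longrightarrow> r = r')}"
  have \<G>_carr: "\<Gamma> \<subseteq> carrier E \<times> UNIV" and \<G>_graph: "(\<lambda>a. (a, u a)) ` U \<subseteq> \<Gamma>"
    and \<G>_mult: "(a, r) \<in> \<Gamma> \<Longrightarrow> (a', r') \<in> \<Gamma> \<Longrightarrow> (a \<otimes> a', r + r') \<in> \<Gamma>"
    and \<G>_func: "(a, r) \<in> \<Gamma> \<Longrightarrow> (a, r') \<in> \<Gamma> \<Longrightarrow> r = r'"
    if "\<Gamma> \<in> \<G>" for \<Gamma> a r a' r'
    using that unfolding \<G>_def mem_Collect_eq by (elim conjE; simp only: simp_thms; metis)+
  have "(\<lambda>a. (a, u a)) ` U \<in> \<G>" using U u by (auto simp: \<G>_def)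
  then have "\<G> \<noteq> {}" by blast
  moreover have "\<Union>\<C> \<in> \<G>" if "\<C> \<noteq> {}" "subset.chain \<G> \<C>" for \<C>
  proof -
    have sub: "\<C> \<subseteq> \<G>" and lin: "\<And>A B. A \<in> \<C> \<Longrightarrow> B \<in> \<C> \<Longrightarrow> A \<subseteq> B \<or> B \<subseteq> A"
      using that(2) by (auto simp: subset_chain_def)
    have both: "\<exists>A \<in> \<C>. p \<in> A \<and> p' \<in> A" if pp: "p \<in> \<Union>\<C>" "p' \<in> \<Union>\<C>" for p p'
    proof -
      obtain A B where AB: "A \<in> \<C>" "p \<in> A" "B \<in> \<C>" "p' \<in> B" using pp by auto
      show ?thesis using lin[OF AB(1,3)]
      proof
        assume "A \<subseteq> B"
        with AB show ?thesis by (intro bexI[of _ B]) auto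
      next
        assume "B \<subseteq> A"
        with AB show ?thesis by (intro bexI[of _ A]) auto
      qed
    qed
    have "(a \<otimes> a', r + r') \<in> \<Union>\<C>" if "(a, r) \<in> \<Union>\<C>" "(a', r') \<in> \<Union>\<C>" for a r a' r'
    proof -
      obtain A where "A \<in> \<C>" "(a, r) \<in> A" "(a', r') \<in> A"
        using both[OF \<open>(a, r) \<in> _\<close> \<open>(a', r') \<in> _\<close>] by (elim bexE conjE)
      moreover from this have "(a \<otimes> a', r + r') \<in> A" using sub by (intro \<G>_mult) auto
      ultimately show ?thesis by blast
    qed
    moreover have "r = r'" if "(a, r) \<in> \<Union>\<C>" "(a, r') \<in> \<Union>\<C>" for a r r'
    proof -
      obtain A where "A \<in> \<C>" "(a, r) \<in> A" "(a, r') \<in> A"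
        using both[OF \<open>(a, r) \<in> _\<close> \<open>(a, r') \<in> _\<close>] by (elim bexE conjE)
      then show ?thesis using sub \<G>_func[of A a r r'] by auto
    qed
    moreover have "\<Union>\<C> \<subseteq> carrier E \<times> UNIV" by (rule Union_least, rule \<G>_carr, rule subsetD[OF sub])
    moreover have "(\<lambda>a. (a, u a)) ` U \<subseteq> \<Union>\<C>"
    proof -
      obtain A where "A \<in> \<C>" using \<open>\<C> \<noteq> {}\<close> by auto
      then show ?thesis using \<G>_graph[of A] sub by auto
    qed
    ultimately show ?thesis unfolding \<G>_def mem_Collect_eq by (intro conjI allI impI)
  qed
  ultimately have "\<exists>\<Gamma> \<in> \<G>. \<forall>\<Delta> \<in> \<G>. \<Gamma> \<subseteq> \<Delta> \<longrightarrow> \<Delta> = \<Gamma>" by (rule subset_Zorn_nonempty)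
  then obtain \<Gamma> where \<Gamma>: "\<Gamma> \<in> \<G>" and max_all: "\<forall>\<Delta> \<in> \<G>. \<Gamma> \<subseteq> \<Delta> \<longrightarrow> \<Delta> = \<Gamma>" ..
  have max: "\<Delta> = \<Gamma>" if "\<Delta> \<in> \<G>" "\<Gamma> \<subseteq> \<Delta>" for \<Delta> using max_all that by blast
  have carr: "a \<in> carrier E" if "(a, r) \<in> \<Gamma>" for a r using that \<G>_carr[OF \<Gamma>] by auto
  have graph: "(a, u a) \<in> \<Gamma>" if "a \<in> U" for a using that \<G>_graph[OF \<Gamma>] by auto
  note mult = \<G>_mult[OF \<Gamma>] and func = \<G>_func[OF \<Gamma>]
  have "u \<one> = 0" using u[of \<one> \<one>] U by simp
  then have one: "(\<one>, 0) \<in> \<Gamma>" using graph[OF U(2)] by simp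
  have pow: "(a [^] k, real k * r) \<in> \<Gamma>" if "(a, r) \<in> \<Gamma>" for a r and k :: nat
  proof (induction k)
    case (Suc k)
    then show ?case using mult[OF Suc that] by (simp add: algebra_simps)
  qed (simp add: one)
  have dom: "\<exists>r. (x, r) \<in> \<Gamma>" if x: "x \<in> carrier E" for x
  proof -
    have pow_rel: "p [^] m' \<otimes> x [^] (m * m') = q [^] m'"
      if "p \<in> carrier E" "p \<otimes> x [^] m = q" for p q and m m' :: nat
    proof -
      have "q [^] m' = p [^] m' \<otimes> (x [^] m) [^] m'" using that x by (auto simp: nat_pow_distrib)
      then show ?thesis using x by (simp add: nat_pow_pow)
    qed
    \<comment> \<open>In a monoid without inverses, a relation between \<open>x\<close> and the
      domain has the form \<open>p \<otimes> x [^] m = q\<close>. It forces \<open>m\<close> times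
      the value at \<open>x\<close>, and any two relations force compatible values.\<close>
    have slope: "(t - r) * real m' = (t' - r') * real m"
      if pq: "(p, r) \<in> \<Gamma>" "(q, t) \<in> \<Gamma>" "p \<otimes> x [^] m = q"
        and pq': "(p', r') \<in> \<Gamma>" "(q', t') \<in> \<Gamma>" "p' \<otimes> x [^] m' = q'" for p r q t m p' r' q' t' m'
    proof -
      note c = carr[OF pq(1)] carr[OF pq(2)] carr[OF pq'(1)] carr[OF pq'(2)]
      have 1: "p [^] m' \<otimes> x [^] (m * m') = q [^] m'" by (rule pow_rel[OF c(1) pq(3)])
      have 2: "p' [^] m \<otimes> x [^] (m * m') = q' [^] m"
        using pow_rel[OF c(3) pq'(3), of m] by (simp add: mult.commute)
      have "q [^] m' \<otimes> p' [^] m = p [^] m' \<otimes> q' [^] m"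
        unfolding 1[symmetric] 2[symmetric] using c x by (simp add: m_ac)
      moreover have "(q [^] m' \<otimes> p' [^] m, real m' * t + real m * r') \<in> \<Gamma>"
        by (intro mult pow pq pq')
      moreover have "(p [^] m' \<otimes> q' [^] m, real m' * r + real m * t') \<in> \<Gamma>"
        by (intro mult pow pq pq')
      ultimately have "real m' * t + real m * r' = real m' * r + real m * t'" by (simp only:) (rule func)
      then show ?thesis by (simp add: algebra_simps)
    qed
    \<comment> \<open>The value to be assigned to \<open>x\<close>. A relation with
      \<open>m > 0\<close> determines it by division in the reals; if there is none, the value is
      free and 0 is taken.\<close>
    have "\<exists>\<tau>. \<forall>p r q t m. (p, r) \<in> \<Gamma> \<longrightarrow> (q, t) \<in> \<Gamma> \<longrightarrow> p \<otimes> x [^] (m :: nat) = q \<longrightarrow> t - r = real m * \<tau>"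
    proof (cases "\<exists>p r q t m. (p, r) \<in> \<Gamma> \<and> (q, t) \<in> \<Gamma> \<and> p \<otimes> x [^] (m :: nat) = q \<and> m > 0")
      case True
      then obtain p0 r0 q0 t0 and m0 :: nat
        where 0: "(p0, r0) \<in> \<Gamma>" "(q0, t0) \<in> \<Gamma>" "p0 \<otimes> x [^] m0 = q0" "m0 > 0" by blast
      have "t - r = real m * ((t0 - r0) / real m0)"
        if "(p, r) \<in> \<Gamma>" "(q, t) \<in> \<Gamma>" "p \<otimes> x [^] m = q" for p r q t and m :: nat
        using slope[OF that 0(1-3)] 0(4) by (simp add: field_simps)
      then show ?thesis by blast
    next
      case False
      have "t - r = real m * 0"
        if a: "(p, r) \<in> \<Gamma>" "(q, t) \<in> \<Gamma>" "p \<otimes> x [^] m = q" for p r q t and m :: nat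
      proof -
        have "\<not> m > 0"
        proof
          assume "m > 0"
          then have "(p, r) \<in> \<Gamma> \<and> (q, t) \<in> \<Gamma> \<and> p \<otimes> x [^] m = q \<and> m > 0" by (intro conjI a)
          then have "\<exists>p r q t m. (p, r) \<in> \<Gamma> \<and> (q, t) \<in> \<Gamma> \<and> p \<otimes> x [^] (m :: nat) = q \<and> m > 0"
            by (intro exI)
          with False show False by contradiction
        qed
        then have "m = 0" by simp
        then have "p = q" using a(3) carr[OF a(1)] by simp
        then show ?thesis using func a(1,2) by simp
      qed
      then show ?thesis by blast
    qed
    then obtain \<tau> where slope_\<tau>: "\<forall>p r q t m. (p, r) \<in> \<Gamma> \<longrightarrow> (q, t) \<in> \<Gamma> \<longrightarrow>
        p \<otimes> x [^] (m :: nat) = q \<longrightarrow> t - r = real m * \<tau>" ..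
    note \<tau> = slope_\<tau>[rule_format]
    define \<Delta> where "\<Delta> = {(p \<otimes> x [^] k, r + real k * \<tau>) |p r (k :: nat). (p, r) \<in> \<Gamma>}"
    have \<Delta>I: "(p \<otimes> x [^] k, r + real k * \<tau>) \<in> \<Delta>" if "(p, r) \<in> \<Gamma>" for p r and k :: nat
      using that unfolding \<Delta>_def by blast
    have \<Delta>E: "\<exists>p r' k. a = p \<otimes> x [^] (k :: nat) \<and> r = r' + real k * \<tau> \<and> (p, r') \<in> \<Gamma>" if "(a, r) \<in> \<Delta>" for a r
      using that unfolding \<Delta>_def by blast
    \<comment> \<open>Well-definedness of the extension: cancelling the smaller power of
      \<open>x\<close> leaves a relation with exponent \<open>k - k'\<close>, to which the choice of
      \<open>\<tau>\<close> applies.\<close>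
    have le: "r + real k * \<tau> = r' + real k' * \<tau>"
      if pr: "(p, r) \<in> \<Gamma>" "(p', r') \<in> \<Gamma>" and eq: "p \<otimes> x [^] k = p' \<otimes> x [^] k'" and "k' \<le> k"
      for p r p' r' and k k' :: nat
    proof -
      note c = carr[OF pr(1)] carr[OF pr(2)]
      have "p \<otimes> x [^] k = (p \<otimes> x [^] (k - k')) \<otimes> x [^] k'"
        using c x \<open>k' \<le> k\<close> by (simp add: m_assoc nat_pow_mult)
      then have eq': "(p \<otimes> x [^] (k - k')) \<otimes> x [^] k' = p' \<otimes> x [^] k'" using eq by simp
      have "p \<otimes> x [^] (k - k') = p'" by (rule cancel[OF _ _ _ eq']) (use c x in auto)
      from \<tau>[OF pr this] show ?thesis using \<open>k' \<le> k\<close> by (simp add: of_nat_diff algebra_simps)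
    qed
    have sub: "\<Gamma> \<subseteq> \<Delta>"
    proof
      fix z assume z: "z \<in> \<Gamma>"
      obtain a r where ar: "z = (a, r)" by (cases z)
      show "z \<in> \<Delta>" using \<Delta>I[of a r 0] z carr[of a r] unfolding ar by simp
    qed
    have "\<Delta> \<in> \<G>" unfolding \<G>_def
    proof (intro CollectI conjI allI impI)
      show "\<Delta> \<subseteq> carrier E \<times> UNIV" using carr x by (auto simp: \<Delta>_def)
      show "(\<lambda>a. (a, u a)) ` U \<subseteq> \<Delta>" using graph sub by blast
    next
      fix a r a' r' assume ar: "(a, r) \<in> \<Delta>" "(a', r') \<in> \<Delta>"
      obtain p s and k :: nat where a: "a = p \<otimes> x [^] k" "r = s + real k * \<tau>" "(p, s) \<in> \<Gamma>"
        using \<Delta>E[OF ar(1)] by (elim exE conjE)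
      obtain p' s' and k' :: nat where b: "a' = p' \<otimes> x [^] k'" "r' = s' + real k' * \<tau>" "(p', s') \<in> \<Gamma>"
        using \<Delta>E[OF ar(2)] by (elim exE conjE)
      note * = a b
      have "a \<otimes> a' = (p \<otimes> p') \<otimes> x [^] (k + k')"
        using carr[OF *(3)] carr[OF *(6)] x by (simp add: *(1,4) nat_pow_mult[symmetric] m_ac)
      moreover have "r + r' = (s + s') + real (k + k') * \<tau>" by (simp add: *(2,5) algebra_simps)
      ultimately show "(a \<otimes> a', r + r') \<in> \<Delta>" using \<Delta>I[OF mult[OF *(3,6)], of "k + k'"] by simp
    next
      fix a r r' assume ar: "(a, r) \<in> \<Delta>" "(a, r') \<in> \<Delta>"
      obtain p s and k :: nat where a: "a = p \<otimes> x [^] k" "r = s + real k * \<tau>" "(p, s) \<in> \<Gamma>"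
        using \<Delta>E[OF ar(1)] by (elim exE conjE)
      obtain p' s' and k' :: nat where b: "a = p' \<otimes> x [^] k'" "r' = s' + real k' * \<tau>" "(p', s') \<in> \<Gamma>"
        using \<Delta>E[OF ar(2)] by (elim exE conjE)
      note * = a b
      show "r = r'"
      proof (cases "k' \<le> k")
        case True
        then show ?thesis using le[OF *(3,6) _ True] *(1,2,4,5) by simp
      next
        case False
        then show ?thesis using le[OF *(6,3), of k' k] *(1,2,4,5) by simp
      qed
    qed
    then have "\<Delta> = \<Gamma>" using sub by (rule max)
    moreover have "(x, \<tau>) \<in> \<Delta>" using \<Delta>I[OF one, of 1] x by simp
    ultimately show ?thesis by blast
  qed
  define s where "s a = (THE r. (a, r) \<in> \<Gamma>)" for a
  have s: "s a = r" if "(a, r) \<in> \<Gamma>" for a r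
    unfolding s_def using that by (rule the_equality) (rule func[OF _ that])
  have "s (a \<otimes> a') = s a + s a'" if a: "a \<in> carrier E" and a': "a' \<in> carrier E" for a a'
  proof -
    obtain r where r: "(a, r) \<in> \<Gamma>" using dom[OF a] ..
    obtain r' where r': "(a', r') \<in> \<Gamma>" using dom[OF a'] ..
    show ?thesis using s[OF r] s[OF r'] s[OF mult[OF r r']] by simp
  qed
  moreover have "s a = u a" if "a \<in> U" for a by (rule s[OF graph[OF that]])
  ultimately show ?thesis by blast
qed

section \<open>Cocycles and coboundaries on monoids\<close>

definition cocycle_on :: "'a::ab_group_add set \<Rightarrow> ('a \<Rightarrow> 'a \<Rightarrow> real) \<Rightarrow> bool"
  where "cocycle_on M c \<longleftrightarrow> 0 \<in> M \<and> (\<forall>\<alpha> \<in> M. \<forall>\<beta> \<in> M. \<alpha> + \<beta> \<in> M) \<and> (\<forall>\<alpha> \<in> M. c \<alpha> 0 = 0 \<and> c 0 \<alpha> = 0) \<and>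
    (\<forall>\<alpha> \<in> M. \<forall>\<beta> \<in> M. \<forall>\<gamma> \<in> M. c \<alpha> \<beta> + c (\<alpha> + \<beta>) \<gamma> = c \<beta> \<gamma> + c \<alpha> (\<beta> + \<gamma>))"

definition coboundary_on :: "'a::ab_group_add set \<Rightarrow> ('a \<Rightarrow> 'a \<Rightarrow> real) \<Rightarrow> bool"
  where "coboundary_on M c \<longleftrightarrow> (\<exists>h. \<forall>\<alpha> \<in> M. \<forall>\<beta> \<in> M. c \<alpha> \<beta> = h (\<alpha> + \<beta>) - h \<alpha> - h \<beta>)"

text \<open>The cocycle defines an extension of \<open>M\<close> by the reals, which splits by injectivity.\<close>

lemma symmetric_cocycle_coboundary:
  fixes M :: "'a::ab_group_add set"
  assumes c: "cocycle_on M c" and sym: "\<And>\<alpha> \<beta>. \<alpha> \<in> M \<Longrightarrow> \<beta> \<in> M \<Longrightarrow> c \<alpha> \<beta> = c \<beta> \<alpha>"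
  shows "coboundary_on M c"
proof -
  have M: "0 \<in> M" "\<And>\<alpha> \<beta>. \<alpha> \<in> M \<Longrightarrow> \<beta> \<in> M \<Longrightarrow> \<alpha> + \<beta> \<in> M"
    and c0: "\<And>\<alpha>. \<alpha> \<in> M \<Longrightarrow> c \<alpha> 0 = 0" "\<And>\<alpha>. \<alpha> \<in> M \<Longrightarrow> c 0 \<alpha> = 0"
    and cc: "\<And>\<alpha> \<beta> \<gamma>. \<alpha> \<in> M \<Longrightarrow> \<beta> \<in> M \<Longrightarrow> \<gamma> \<in> M \<Longrightarrow> c \<alpha> \<beta> + c (\<alpha> + \<beta>) \<gamma> = c \<beta> \<gamma> + c \<alpha> (\<beta> + \<gamma>)"
    using c unfolding cocycle_on_def by blast+
  \<comment> \<open>Symmetry of \<open>c\<close> makes this extension commutative, and it is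
    cancellative because \<open>M\<close> lies in a group; both are required for extending additive
    maps.\<close>
  define E :: "('a \<times> real) monoid"
    where "E = \<lparr>carrier = M \<times> UNIV, mult = (\<lambda>p q. (fst p + fst q, snd p + snd q + c (fst p) (fst q))), one = (0, 0)\<rparr>"
  have E [simp]: "carrier E = M \<times> UNIV" "\<one>\<^bsub>E\<^esub> = (0, 0)"
      "p \<otimes>\<^bsub>E\<^esub> q = (fst p + fst q, snd p + snd q + c (fst p) (fst q))" for p q
    by (simp_all add: E_def)
  have cm: "comm_monoid E"
  proof (rule comm_monoidI)
    fix p q r assume "p \<in> carrier E" "q \<in> carrier E" "r \<in> carrier E"
    then show "p \<otimes>\<^bsub>E\<^esub> q \<otimes>\<^bsub>E\<^esub> r = p \<otimes>\<^bsub>E\<^esub> (q \<otimes>\<^bsub>E\<^esub> r)"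
      using cc[of "fst p" "fst q" "fst r"] by (auto simp: add.assoc)
  next
    fix p q assume "p \<in> carrier E" "q \<in> carrier E"
    then show "p \<otimes>\<^bsub>E\<^esub> q = q \<otimes>\<^bsub>E\<^esub> p" using sym[of "fst p" "fst q"] by (auto simp: add.commute)
  qed (use M c0 in auto)
  \<comment> \<open>An additive retraction of the extension onto its copy of the reals. Minus its
    value on the section \<open>(\<alpha>, 0)\<close> is the required cochain.\<close>
  have "\<exists>s. (\<forall>a \<in> carrier E. \<forall>a' \<in> carrier E. s (a \<otimes>\<^bsub>E\<^esub> a') = s a + s a') \<and> (\<forall>a \<in> {0} \<times> UNIV. s a = snd a)"
    using M c0 by (intro extend_additive_to_real[OF cm]) auto
  then obtain s where ss: "(\<forall>a \<in> carrier E. \<forall>a' \<in> carrier E. s (a \<otimes>\<^bsub>E\<^esub> a') = s a + s a') \<and>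
    (\<forall>a \<in> {0} \<times> UNIV. s a = snd a)" ..
  then have s: "s (a \<otimes>\<^bsub>E\<^esub> a') = s a + s a'" if "a \<in> carrier E" "a' \<in> carrier E" for a a'
    using that by blast
  have s0: "s (0, r) = r" for r using ss by simp
  have "c \<alpha> \<beta> = - s (\<alpha> + \<beta>, 0) - - s (\<alpha>, 0) - - s (\<beta>, 0)" if "\<alpha> \<in> M" "\<beta> \<in> M" for \<alpha> \<beta>
  proof -
    have "s (\<alpha>, 0) + s (\<beta>, 0) = s (\<alpha> + \<beta>, c \<alpha> \<beta>)"
      using s[of "(\<alpha>, 0)" "(\<beta>, 0)"] that by simp
    also have "\<dots> = s (\<alpha> + \<beta>, 0) + c \<alpha> \<beta>"
      using s[of "(\<alpha> + \<beta>, 0)" "(0, c \<alpha> \<beta>)"] that M c0 s0 by simp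
    finally show ?thesis by simp
  qed
  then show ?thesis unfolding coboundary_on_def by (intro exI[of _ "\<lambda>\<alpha>. - s (\<alpha>, 0)"]) blast
qed

text \<open>As 1 generates the monoid, the values \<open>c k 1\<close> determine \<open>h\<close> by
  recursion, and the cocycle identity with last argument 1 propagates the formula. No symmetry of
  \<open>c\<close> enters.\<close>

lemma nat_cocycle_coboundary:
  fixes c :: "nat \<Rightarrow> nat \<Rightarrow> real"
  assumes c0: "\<And>k. c k 0 = 0" and cc: "\<And>k l m. c k l + c (k + l) m = c l m + c k (l + m)"
  shows "\<exists>h. \<forall>k l. c k l = h (k + l) - h k - h l"
proof -
  define h where "h k = (\<Sum>i < k. c i 1)" for k
  have "c k l = h (k + l) - h k - h l" for k l
  proof (induction l)
    case 0
    then show ?case by (simp add: c0 h_def)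
  next
    case (Suc l)
    then show ?case using cc[of k l 1] by (simp add: h_def)
  qed
  then show ?thesis by blast
qed

lemma int_cocycle_coboundary:
  fixes c :: "int \<Rightarrow> int \<Rightarrow> real"
  assumes c0: "\<And>k. c k 0 = 0" and cc: "\<And>k l m. c k l + c (k + l) m = c l m + c k (l + m)"
  shows "\<exists>h. \<forall>k l. c k l = h (k + l) - h k - h l"
proof -
  \<comment> \<open>The solution of \<open>h (k + 1) = h k + c k 1\<close> with
    \<open>h 0 = 0\<close>, continued in both directions.\<close>
  define h where "h k = (if k \<ge> 0 then \<Sum>i \<in> {0..<k}. c i 1 else - (\<Sum>i \<in> {k..<0}. c i 1))" for k
  have h: "h (k + 1) = h k + c k 1" for k
  proof -
    consider "k \<ge> 0" | "k = -1" | "k < -1" by linarith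
    then show ?thesis
    proof cases
      case 1
      then have "{0..<k + 1} = insert k {0..<k}" by auto
      with 1 show ?thesis by (simp add: h_def)
    next
      case 2
      moreover have "{-1..<0} = {-1 :: int}" by auto
      ultimately show ?thesis by (simp add: h_def)
    next
      case 3
      then have "{k..<0} = insert k {k + 1..<0}" by auto
      with 3 show ?thesis by (simp add: h_def)
    qed
  qed
  have "c k l = h (k + l) - h k - h l" for k l
  proof (induction l rule: int_induct[where k = 0])
    case base
    then show ?case by (simp add: c0 h_def)
  next
    case (step1 l)
    then show ?case using cc[of k l 1] h[of l] h[of "k + l"] by (simp add: add.assoc)
  next
    case (step2 l)
    then show ?case using cc[of k "l - 1" 1] h[of "l - 1"] h[of "k + (l - 1)"] by (simp add: algebra_simps)
  qed
  then show ?thesis by blast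
qed

text \<open>Additivity of \<open>\<theta>\<close> gives \<open>\<theta> 0 = 0\<close> by
  cancellation in the target, which is why the target class is cancellative; it covers both the
  naturals and the integers.\<close>

lemma cocycle_transport:
  fixes \<theta> :: "'a::ab_group_add \<Rightarrow> 'b::cancel_comm_monoid_add"
  assumes c: "cocycle_on M c" and \<theta>: "bij_betw \<theta> M UNIV"
    and add: "\<And>\<alpha> \<beta>. \<alpha> \<in> M \<Longrightarrow> \<beta> \<in> M \<Longrightarrow> \<theta> (\<alpha> + \<beta>) = \<theta> \<alpha> + \<theta> \<beta>"
    and coboundary: "\<And>c' :: 'b \<Rightarrow> 'b \<Rightarrow> real. (\<And>k. c' k 0 = 0) \<Longrightarrow>
      (\<And>k l m. c' k l + c' (k + l) m = c' l m + c' k (l + m)) \<Longrightarrow> \<exists>h. \<forall>k l. c' k l = h (k + l) - h k - h l"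
  shows "coboundary_on M c"
proof -
  have M: "0 \<in> M" "\<And>\<alpha> \<beta>. \<alpha> \<in> M \<Longrightarrow> \<beta> \<in> M \<Longrightarrow> \<alpha> + \<beta> \<in> M"
    and c0: "\<And>\<alpha>. \<alpha> \<in> M \<Longrightarrow> c \<alpha> 0 = 0"
    and cc: "\<And>\<alpha> \<beta> \<gamma>. \<alpha> \<in> M \<Longrightarrow> \<beta> \<in> M \<Longrightarrow> \<gamma> \<in> M \<Longrightarrow> c \<alpha> \<beta> + c (\<alpha> + \<beta>) \<gamma> = c \<beta> \<gamma> + c \<alpha> (\<beta> + \<gamma>)"
    using c unfolding cocycle_on_def by blast+
  define \<psi> where "\<psi> = inv_into M \<theta>"
  have \<psi>M: "\<psi> k \<in> M" for k using \<theta> unfolding \<psi>_def bij_betw_def by (metis UNIV_I inv_into_into)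
  have \<psi>\<theta>: "\<psi> (\<theta> \<alpha>) = \<alpha>" if "\<alpha> \<in> M" for \<alpha> using \<theta> that by (simp add: \<psi>_def bij_betw_def)
  have \<theta>\<psi>: "\<theta> (\<psi> k) = k" for k using \<theta> unfolding \<psi>_def bij_betw_def by (metis UNIV_I f_inv_into_f)
  have \<psi>add: "\<psi> (k + l) = \<psi> k + \<psi> l" for k l
  proof -
    have "k + l = \<theta> (\<psi> k + \<psi> l)" by (simp add: add \<psi>M \<theta>\<psi>)
    then show ?thesis by (simp add: \<psi>\<theta> M \<psi>M)
  qed
  have "\<theta> 0 + \<theta> 0 = \<theta> 0 + 0" using add[of 0 0] M by simp
  then have "\<theta> 0 = 0" by (rule add_left_imp_eq)
  then have "\<psi> 0 = 0" using \<psi>\<theta>[OF M(1)] by simp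
  then have "\<exists>h. \<forall>k l. c (\<psi> k) (\<psi> l) = h (k + l) - h k - h l"
    by (intro coboundary) (simp_all add: \<psi>add c0 cc \<psi>M)
  then obtain h where h: "\<And>k l. c (\<psi> k) (\<psi> l) = h (k + l) - h k - h l" by blast
  have "c \<alpha> \<beta> = h (\<theta> (\<alpha> + \<beta>)) - h (\<theta> \<alpha>) - h (\<theta> \<beta>)" if "\<alpha> \<in> M" "\<beta> \<in> M" for \<alpha> \<beta>
    using h[of "\<theta> \<alpha>" "\<theta> \<beta>"] that by (simp add: \<psi>\<theta> add)
  then show ?thesis unfolding coboundary_on_def by (intro exI[of _ "\<lambda>\<alpha>. h (\<theta> \<alpha>)"]) blast
qed

section \<open>Uniform primitives\<close>

lemma subspace_Consv: "subspace (Consv \<phi> b)"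
proof (rule subspaceI)
  show "0 \<in> Consv \<phi> b" by (simp add: Consv_def)
  show "\<xi> + \<xi>' \<in> Consv \<phi> b" if "\<xi> \<in> Consv \<phi> b" "\<xi>' \<in> Consv \<phi> b" for \<xi> \<xi>' :: "'a \<Rightarrow> real"
    unfolding Consv_def
  proof (intro CollectI conjI allI impI)
    show "(\<xi> + \<xi>') b = 0" using that by (simp add: Consv_def)
    fix s1 s2 s1' s2' assume "(s1', s2') = \<phi> (s1, s2)"
    then have "\<xi> s1 + \<xi> s2 = \<xi> s1' + \<xi> s2'" "\<xi>' s1 + \<xi>' s2 = \<xi>' s1' + \<xi>' s2'"
      using that unfolding Consv_def by blast+
    then show "(\<xi> + \<xi>') s1 + (\<xi> + \<xi>') s2 = (\<xi> + \<xi>') s1' + (\<xi> + \<xi>') s2'" by simp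
  qed
  show "c *\<^sub>R \<xi> \<in> Consv \<phi> b" if "\<xi> \<in> Consv \<phi> b" for c and \<xi> :: "'a \<Rightarrow> real"
    unfolding Consv_def
  proof (intro CollectI conjI allI impI)
    show "(c *\<^sub>R \<xi>) b = 0" using that by (simp add: Consv_def)
    fix s1 s2 s1' s2' assume "(s1', s2') = \<phi> (s1, s2)"
    then have "\<xi> s1 + \<xi> s2 = \<xi> s1' + \<xi> s2'" using that unfolding Consv_def by blast
    then show "(c *\<^sub>R \<xi>) s1 + (c *\<^sub>R \<xi>) s2 = (c *\<^sub>R \<xi>) s1' + (c *\<^sub>R \<xi>) s2'"
      by (simp add: distrib_left[symmetric])
  qed
qed

context framed_system
begin

lemma additive_farE:
  assumes "additive_far q f"
  obtains C where "C \<ge> 0" and "\<And>\<eta> \<zeta>. \<eta> \<in> S \<Longrightarrow> \<zeta> \<in> S \<Longrightarrow> sep q C \<eta> \<zeta> \<Longrightarrow> f (merge \<eta> \<zeta>) = f \<eta> + f \<zeta>"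
  using assms unfolding additive_far_def by blast

section \<open>The vacuum and the monoid of charges\<close>

definition vac :: "'x \<Rightarrow> 's"
  where "vac = (\<lambda>x \<in> verts X. b)"

lemma supp_vac [simp]: "supp vac = {}"
  by (auto simp: supp_def vac_def)

lemma vac_in_S [simp]: "vac \<in> S"
  unfolding in_S_iff supp_vac by (simp add: vac_def)

lemma charge_vac [simp]: "charge vac = 0"
  by (auto simp: charge_def fun_eq_iff)

lemma supp_empty: "\<eta> \<in> S \<Longrightarrow> supp \<eta> = {} \<Longrightarrow> \<eta> = vac"
  by (rule config_eqI[OF _ vac_in_S]) (auto simp: vac_def supp_def)

lemma merge_vac [simp]: "\<eta> \<in> S \<Longrightarrow> merge \<eta> vac = \<eta>" "\<eta> \<in> S \<Longrightarrow> merge vac \<eta> = \<eta>"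
proof -
  assume \<eta>: "\<eta> \<in> S"
  show "merge \<eta> vac = \<eta>"
    by (rule config_eqI[OF merge_in_S[OF \<eta> vac_in_S] \<eta>]) (simp add: merge_apply vac_def)
  show "merge vac \<eta> = \<eta>"
    by (rule config_eqI[OF merge_in_S[OF vac_in_S \<eta>] \<eta>]) (simp add: merge_apply vac_def)
qed

lemma act_vac [simp]: "g \<in> carrier G \<Longrightarrow> act g vac = vac"
  by (intro supp_empty) (auto simp: act_in_S supp_act)

lemma direction_pos_1: "direction (pos 1)"
  using d_pos by (intro direction_pos) simp

text \<open>A translate of \<open>\<zeta>\<close> far away has the same charge and a support
  disjoint from that of \<open>\<eta>\<close>.\<close>

lemma charge_add_closed:
  assumes "\<eta> \<in> S" "\<zeta> \<in> S"
  shows "charge \<eta> + charge \<zeta> \<in> charge ` S"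
proof -
  obtain g where g: "g \<in> carrier G" "sep (pos 1) 0 \<eta> (act g \<zeta>)"
    using direction_sep[OF direction_pos_1 assms] by blast
  have "charge (merge \<eta> (act g \<zeta>)) = charge \<eta> + charge \<zeta>"
    using charge_merge[OF assms(1) act_in_S[OF g(1) assms(2)] sep_disjoint[OF g(2)]] charge_act[OF g(1) assms(2)]
    by simp
  then show ?thesis using merge_in_S[OF assms(1) act_in_S[OF g(1) assms(2)]] by (metis image_eqI)
qed

text \<open>The vacuum is separated from every configuration, and pairing with it gives
  \<open>- f vac\<close>. Hence \<open>f vac = 0\<close> normalises the cocycle.\<close>

lemma pairing_cocycle_on:
  assumes H: "has_pairing f q H" and q: "direction q" and f: "f vac = 0"
  shows "cocycle_on (charge ` S) H"
proof -
  obtain C where C: "C \<ge> 0" "\<And>\<eta> \<zeta>. \<eta> \<in> S \<Longrightarrow> \<zeta> \<in> S \<Longrightarrow> sep q C \<eta> \<zeta> \<Longrightarrow> pair f \<eta> \<zeta> = H (charge \<eta>) (charge \<zeta>)"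
    by (fact has_pairingE[OF H])
  have zero: "H (charge \<eta>) 0 = 0 \<and> H 0 (charge \<eta>) = 0" if "\<eta> \<in> S" for \<eta>
  proof -
    have "sep q C \<eta> vac" "sep q C vac \<eta>" by (simp_all add: sep_def)
    then show ?thesis
      using C(2)[OF that vac_in_S] C(2)[OF vac_in_S that] that f by (simp add: pair_def)
  qed
  show ?thesis unfolding cocycle_on_def
  proof (intro conjI ballI)
    show "0 \<in> charge ` S" using vac_in_S charge_vac by (metis image_eqI)
  next
    fix \<alpha> \<beta> assume "\<alpha> \<in> charge ` S" "\<beta> \<in> charge ` S"
    then show "\<alpha> + \<beta> \<in> charge ` S" using charge_add_closed by auto
  next
    fix \<alpha> assume "\<alpha> \<in> charge ` S"
    then show "H \<alpha> 0 = 0" "H 0 \<alpha> = 0" using zero by auto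
  next
    fix \<alpha> \<beta> \<gamma> assume "\<alpha> \<in> charge ` S" "\<beta> \<in> charge ` S" "\<gamma> \<in> charge ` S"
    then obtain \<eta> \<zeta> \<theta> where "\<eta> \<in> S" "\<zeta> \<in> S" "\<theta> \<in> S" "\<alpha> = charge \<eta>" "\<beta> = charge \<zeta>" "\<gamma> = charge \<theta>"
      by (elim imageE)
    then show "H \<alpha> \<beta> + H (\<alpha> + \<beta>) \<gamma> = H \<beta> \<gamma> + H \<alpha> (\<beta> + \<gamma>)"
      using pairing_cocycle[OF H q] by simp
  qed
qed

definition site :: 'x
  where "site = (SOME x. x \<in> verts X)"

lemma site [simp]: "site \<in> verts X"
proof -
  have "\<exists>x. x \<in> verts X" using connected_system by (auto simp: connected_graph_def)
  then show ?thesis unfolding site_def by (rule someI_ex)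
qed

text \<open>A particle at a fixed vertex; it turns functions of configurations into functions of
  states.\<close>

definition single :: "'s \<Rightarrow> 'x \<Rightarrow> 's"
  where "single s = vac(site := s)"

lemma single_in_S [simp]: "single s \<in> S"
  unfolding single_def by (intro update_in_S vac_in_S site)

lemma single_base: "single b = vac"
  by (auto simp: single_def vac_def fun_eq_iff)

lemma charge_single: "\<xi> \<in> Consv \<phi> b \<Longrightarrow> charge (single s) \<xi> = \<xi> s"
proof -
  assume \<xi>: "\<xi> \<in> Consv \<phi> b"
  have "supp (single s) \<subseteq> {site}" by (auto simp: supp_def single_def vac_def)
  then show ?thesis using charge_superset[OF \<xi>, of "{site}" "single s"] by (simp add: single_def)
qed

lemma charge_remove:
  assumes \<eta>: "\<eta> \<in> S" and x: "x \<in> supp \<eta>"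
  shows "charge \<eta> = charge (\<eta>(x := b)) + charge (single (\<eta> x))"
proof
  fix \<xi> :: "'s \<Rightarrow> real"
  show "charge \<eta> \<xi> = (charge (\<eta>(x := b)) + charge (single (\<eta> x))) \<xi>"
  proof (cases "\<xi> \<in> Consv \<phi> b")
    case True
    have "charge \<eta> \<xi> = \<xi> (\<eta> x) + (\<Sum>y \<in> supp \<eta> - {x}. \<xi> (\<eta> y))"
      using True x \<eta> by (simp add: charge_def sum.remove)
    also have "supp \<eta> - {x} = supp (\<eta>(x := b))" by (auto simp: supp_def)
    also have "(\<Sum>y \<in> supp (\<eta>(x := b)). \<xi> (\<eta> y)) = charge (\<eta>(x := b)) \<xi>"
      using True by (auto simp: charge_def supp_def intro!: sum.cong)
    finally show ?thesis using True by (simp add: charge_single)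
  qed (simp add: charge_def)
qed

text \<open>For \<open>c_dim \<phi> b = 1\<close> a charge is determined by its value at one nonzero
  conserved quantity \<open>\<xi>\<close>. These values fill exactly the submonoid generated by the
  range of \<open>\<xi>\<close>, which simplicity identifies with the naturals or the
  integers.\<close>

lemma simple_charges:
  assumes "simple_interaction \<phi> b"
  shows "(\<exists>\<theta> :: (('s \<Rightarrow> real) \<Rightarrow> real) \<Rightarrow> nat. bij_betw \<theta> (charge ` S) UNIV \<and>
      (\<forall>\<alpha> \<in> charge ` S. \<forall>\<beta> \<in> charge ` S. \<theta> (\<alpha> + \<beta>) = \<theta> \<alpha> + \<theta> \<beta>)) \<or>
    (\<exists>\<theta> :: (('s \<Rightarrow> real) \<Rightarrow> real) \<Rightarrow> int. bij_betw \<theta> (charge ` S) UNIV \<and>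
      (\<forall>\<alpha> \<in> charge ` S. \<forall>\<beta> \<in> charge ` S. \<theta> (\<alpha> + \<beta>) = \<theta> \<alpha> + \<theta> \<beta>))"
proof -
  obtain B where B: "B \<subseteq> Consv \<phi> b" "independent B" "Consv \<phi> b \<subseteq> span B" "card B = dim (Consv \<phi> b)"
    using basis_exists by blast
  have "card B = 1" using B(4) assms by (simp add: simple_interaction_def c_dim_def)
  then obtain \<xi> where B_eq: "B = {\<xi>}" by (rule card_1_singletonE)
  have \<xi>: "\<xi> \<in> Consv \<phi> b" using B(1) B_eq by simp
  have "\<xi> \<noteq> 0" using B(2) B_eq dependent_zero by auto
  define N where "N = generated_submonoid (range \<xi>)"
  define ev :: "(('s \<Rightarrow> real) \<Rightarrow> real) \<Rightarrow> real" where "ev \<alpha> = \<alpha> \<xi>" for \<alpha>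
  have inj: "inj_on ev (charge ` S)"
  proof (rule inj_onI)
    fix \<alpha> \<beta> assume "\<alpha> \<in> charge ` S" "\<beta> \<in> charge ` S" and eq: "ev \<alpha> = ev \<beta>"
    then obtain \<eta> \<zeta> where *: "\<alpha> = charge \<eta>" "\<beta> = charge \<zeta>" by (elim imageE)
    show "\<alpha> = \<beta>" unfolding *
    proof (rule charge_eqI)
      fix \<xi>' assume \<xi>': "\<xi>' \<in> Consv \<phi> b"
      then have "\<xi>' \<in> span {\<xi>}" using B(3) B_eq by auto
      then obtain k where k: "\<xi>' = k *\<^sub>R \<xi>" by (auto simp: span_singleton)
      have "charge \<theta> \<xi>' = k * charge \<theta> \<xi>" for \<theta>
        using \<xi> \<xi>' unfolding k by (simp add: charge_def sum_distrib_left)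
      then show "charge \<eta> \<xi>' = charge \<zeta> \<xi>'" using eq by (simp add: ev_def *)
    qed
  qed
  have mem: "charge \<eta> \<xi> \<in> T" if \<eta>: "\<eta> \<in> S" and T: "submonoid T (additive_monoid UNIV)" "range \<xi> \<subseteq> T" for T \<eta>
  proof -
    have add: "r + t \<in> T" if "r \<in> T" "t \<in> T" for r t
      using submonoid.m_closed[OF T(1) that] by (simp add: additive_monoid_def)
    have zero: "0 \<in> T" using submonoid.one_closed[OF T(1)] by (simp add: additive_monoid_def)
    have "(\<Sum>x \<in> A. \<xi> (\<eta> x)) \<in> T" if "finite A" for A
      using that
    proof (induction A rule: finite_induct)
      case (insert x A)
      have "\<xi> (\<eta> x) \<in> T" using T(2) by blast
      then show ?case using insert add by simp
    qed (simp add: zero)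
    then show ?thesis using \<xi> \<eta> by (simp add: charge_def)
  qed
  have "ev ` charge ` S = N"
  proof
    show "ev ` charge ` S \<subseteq> N"
      unfolding N_def generated_submonoid_def hull_def ev_def using mem by auto
    have "submonoid (ev ` charge ` S) (additive_monoid UNIV)"
    proof
      show "ev ` charge ` S \<subseteq> carrier (additive_monoid UNIV)" by (simp add: additive_monoid_def)
      have "ev (charge vac) \<in> ev ` charge ` S" by (intro imageI vac_in_S)
      then show "\<one>\<^bsub>additive_monoid UNIV\<^esub> \<in> ev ` charge ` S" by (simp add: additive_monoid_def ev_def)
      fix r t assume "r \<in> ev ` charge ` S" "t \<in> ev ` charge ` S"
      then obtain \<eta> \<zeta> where *: "\<eta> \<in> S" "\<zeta> \<in> S" "r = ev (charge \<eta>)" "t = ev (charge \<zeta>)" by (elim imageE) auto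
      have "ev (charge \<eta> + charge \<zeta>) \<in> ev ` charge ` S" by (intro imageI charge_add_closed *)
      then show "r \<otimes>\<^bsub>additive_monoid UNIV\<^esub> t \<in> ev ` charge ` S" by (simp add: additive_monoid_def ev_def *)
    qed
    moreover have "range \<xi> \<subseteq> ev ` charge ` S"
    proof
      fix r assume "r \<in> range \<xi>"
      then obtain s where "r = \<xi> s" by blast
      then have "r = ev (charge (single s))" using \<xi> by (simp add: ev_def charge_single)
      then show "r \<in> ev ` charge ` S" using single_in_S by blast
    qed
    ultimately show "N \<subseteq> ev ` charge ` S"
      unfolding N_def generated_submonoid_def by (intro hull_minimal)
  qed
  then have bij: "bij_betw ev (charge ` S) N" using inj by (simp add: bij_betw_def)
  \<comment> \<open>Stated for an arbitrary type, since it is used for both alternatives of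
    simplicity.\<close>
  have key: "\<exists>\<theta> :: _ \<Rightarrow> 'n::monoid_add. bij_betw \<theta> (charge ` S) UNIV \<and>
      (\<forall>\<alpha> \<in> charge ` S. \<forall>\<beta> \<in> charge ` S. \<theta> (\<alpha> + \<beta>) = \<theta> \<alpha> + \<theta> \<beta>)"
    if iso: "additive_monoid N \<cong> additive_monoid (UNIV :: 'n set)"
  proof -
    obtain k where k: "k \<in> iso (additive_monoid N) (additive_monoid (UNIV :: 'n set))"
      using iso unfolding is_iso_def by blast
    have k_bij: "bij_betw k N UNIV" using k by (simp add: iso_def additive_monoid_def)
    have k_add: "k (r + t) = k r + k t" if "r \<in> N" "t \<in> N" for r t
      using k that hom_mult[of k "additive_monoid N" "additive_monoid (UNIV :: 'n set)" r t]
      by (simp add: iso_def additive_monoid_def)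
    have "bij_betw (k \<circ> ev) (charge ` S) UNIV" by (rule bij_betw_trans[OF bij k_bij])
    moreover have "(k \<circ> ev) (\<alpha> + \<beta>) = (k \<circ> ev) \<alpha> + (k \<circ> ev) \<beta>"
      if "\<alpha> \<in> charge ` S" "\<beta> \<in> charge ` S" for \<alpha> \<beta>
    proof -
      have "ev \<alpha> \<in> N" "ev \<beta> \<in> N" using bij that unfolding bij_betw_def by blast+
      then show ?thesis using k_add[of "ev \<alpha>" "ev \<beta>"] by (simp add: ev_def)
    qed
    ultimately show ?thesis by blast
  qed
  have "additive_monoid N \<cong> additive_monoid (UNIV :: nat set) \<or>
      additive_monoid N \<cong> additive_monoid (UNIV :: int set)"
    using assms \<xi> \<open>\<xi> \<noteq> 0\<close> unfolding simple_interaction_def N_def by blast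
  then show ?thesis
  proof
    assume "additive_monoid N \<cong> additive_monoid (UNIV :: nat set)"
    from key[OF this] show ?thesis by (rule disjI1)
  next
    assume "additive_monoid N \<cong> additive_monoid (UNIV :: int set)"
    from key[OF this] show ?thesis by (rule disjI2)
  qed
qed

lemma pairing_coboundary:
  assumes f: "local_gradient R f" "f vac = 0" and H: "has_pairing f (pos 1) H"
    and simple: "d = 1 \<Longrightarrow> simple_interaction \<phi> b"
  shows "coboundary_on (charge ` S) H"
proof (cases "d = 1")
  case False
  then have d: "d \<ge> 2" using d_pos by simp
  show ?thesis
  proof (rule symmetric_cocycle_coboundary[OF pairing_cocycle_on[OF H direction_pos_1 f(2)]])
    fix \<alpha> \<beta> assume "\<alpha> \<in> charge ` S" "\<beta> \<in> charge ` S"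
    then obtain \<eta> \<zeta> where *: "\<eta> \<in> S" "\<zeta> \<in> S" "\<alpha> = charge \<eta>" "\<beta> = charge \<zeta>" by (elim imageE)
    show "H \<alpha> \<beta> = H \<beta> \<alpha>" unfolding *(3,4) by (rule pairing_symmetric[OF f(1) H d *(1,2)])
  qed
next
  case True
  note c = pairing_cocycle_on[OF H direction_pos_1 f(2)]
  from simple_charges[OF simple[OF True]] show ?thesis
  proof (elim disjE exE conjE)
    fix \<theta> :: "(('s \<Rightarrow> real) \<Rightarrow> real) \<Rightarrow> nat"
    assume \<theta>: "bij_betw \<theta> (charge ` S) UNIV"
      "\<forall>\<alpha> \<in> charge ` S. \<forall>\<beta> \<in> charge ` S. \<theta> (\<alpha> + \<beta>) = \<theta> \<alpha> + \<theta> \<beta>"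
    show ?thesis
    proof (rule cocycle_transport[OF c \<theta>(1)])
      show "\<theta> (\<alpha> + \<beta>) = \<theta> \<alpha> + \<theta> \<beta>" if "\<alpha> \<in> charge ` S" "\<beta> \<in> charge ` S" for \<alpha> \<beta>
        using \<theta>(2) that by blast
    qed (fact nat_cocycle_coboundary)
  next
    fix \<theta> :: "(('s \<Rightarrow> real) \<Rightarrow> real) \<Rightarrow> int"
    assume \<theta>: "bij_betw \<theta> (charge ` S) UNIV"
      "\<forall>\<alpha> \<in> charge ` S. \<forall>\<beta> \<in> charge ` S. \<theta> (\<alpha> + \<beta>) = \<theta> \<alpha> + \<theta> \<beta>"
    show ?thesis
    proof (rule cocycle_transport[OF c \<theta>(1)])
      show "\<theta> (\<alpha> + \<beta>) = \<theta> \<alpha> + \<theta> \<beta>" if "\<alpha> \<in> charge ` S" "\<beta> \<in> charge ` S" for \<alpha> \<beta>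
        using \<theta>(2) that by blast
    qed (fact int_cocycle_coboundary)
  qed
qed

section \<open>Existence of uniform primitives\<close>

lemma local_gradient_cong:
  assumes f: "local_gradient R f"
    and eq: "\<And>e \<eta>. e \<in> arcs X \<Longrightarrow> \<eta> \<in> S \<Longrightarrow> f' (step \<eta> e) - f' \<eta> = f (step \<eta> e) - f \<eta>"
  shows "local_gradient R f'"
  unfolding local_gradient_def
proof
  fix e assume e: "e \<in> arcs X"
  show "depends_on X b {x \<in> verts X. gdist X (tail X e) x \<le> enat R} (\<lambda>\<eta>. f' (step \<eta> e) - f' \<eta>)"
  proof (rule depends_onI)
    fix \<eta> \<zeta> assume a: "\<eta> \<in> S" "\<zeta> \<in> S" "\<forall>x \<in> {x \<in> verts X. gdist X (tail X e) x \<le> enat R}. \<eta> x = \<zeta> x"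
    then have "f (step \<eta> e) - f \<eta> = f (step \<zeta> e) - f \<zeta>" by (intro local_gradientD[OF f e]) auto
    then show "f' (step \<eta> e) - f' \<eta> = f' (step \<zeta> e) - f' \<zeta>" using eq[OF e a(1)] eq[OF e a(2)] by simp
  qed
qed

lemma uniform_primitive:
  assumes \<omega>: "\<omega> \<in> closed_uniform_forms X \<iota> \<phi> b" and simple: "d = 1 \<Longrightarrow> simple_interaction \<phi> b"
  shows "\<exists>f. f \<in> config_functions X b \<and> f vac = 0 \<and> (\<exists>R. short_range R f) \<and> additive_far (pos 1) f \<and>
    (\<forall>e \<in> arcs X. \<forall>\<eta> \<in> S. f (step \<eta> e) - f \<eta> = \<omega> e \<eta>)"
proof -
  obtain f0 where f0: "\<forall>e \<in> arcs X. \<forall>\<eta> \<in> S. f0 (step \<eta> e) - f0 \<eta> = \<omega> e \<eta>"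
    using closed_form_primitive[of \<omega>] \<omega> by (auto simp: closed_uniform_forms_def)
  obtain R where R: "\<forall>e \<in> arcs X. depends_on X b {x \<in> verts X. gdist X (tail X e) x \<le> enat R} (\<omega> e)"
    using \<omega> unfolding closed_uniform_forms_def uniform_form_def by blast
  have f0_grad: "local_gradient R f0" unfolding local_gradient_def
  proof
    fix e assume e: "e \<in> arcs X"
    show "depends_on X b {x \<in> verts X. gdist X (tail X e) x \<le> enat R} (\<lambda>\<eta>. f0 (step \<eta> e) - f0 \<eta>)"
    proof (rule depends_onI)
      fix \<eta> \<zeta> assume a: "\<eta> \<in> S" "\<zeta> \<in> S" "\<forall>x \<in> {x \<in> verts X. gdist X (tail X e) x \<le> enat R}. \<eta> x = \<zeta> x"
      have "\<omega> e \<eta> = \<omega> e \<zeta>" by (rule depends_onD[OF bspec[OF R e] a(1,2) bspec[OF a(3)]])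
      then show "f0 (step \<eta> e) - f0 \<eta> = f0 (step \<zeta> e) - f0 \<zeta>" using f0 e a by simp
    qed
  qed
  define f1 where "f1 \<eta> = f0 \<eta> - f0 vac" for \<eta>
  have f1: "local_gradient R f1" "f1 vac = 0"
    by (rule local_gradient_cong[OF f0_grad]) (simp_all add: f1_def)
  obtain H where H: "has_pairing f1 (pos 1) H" using pairing_exists[OF direction_pos_1 f1(1)] by blast
  obtain h where h: "\<forall>\<alpha> \<in> charge ` S. \<forall>\<beta> \<in> charge ` S. H \<alpha> \<beta> = h (\<alpha> + \<beta>) - h \<alpha> - h \<beta>"
    using pairing_coboundary[OF f1 H simple] unfolding coboundary_on_def by blast
  \<comment> \<open>At the vacuum the coboundary formula reads \<open>H 0 0 = - h 0\<close>, so
    subtracting \<open>h\<close> preserves the value 0 there.\<close>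
  have h0: "h 0 = 0"
  proof -
    have "0 \<in> charge ` S" "H 0 0 = 0"
      using pairing_cocycle_on[OF H direction_pos_1 f1(2)] unfolding cocycle_on_def by blast+
    then show ?thesis using h by fastforce
  qed
  define f where "f \<eta> = (if \<eta> \<in> S then f1 \<eta> - h (charge \<eta>) else 0)" for \<eta>
  have grad: "f (step \<eta> e) - f \<eta> = f1 (step \<eta> e) - f1 \<eta>" if "e \<in> arcs X" "\<eta> \<in> S" for e \<eta>
    using that by (simp add: f_def step_in_S charge_step)
  have lg: "local_gradient R f" by (rule local_gradient_cong[OF f1(1) grad])
  obtain C where C: "C \<ge> 0" "\<And>\<eta> \<zeta>. \<eta> \<in> S \<Longrightarrow> \<zeta> \<in> S \<Longrightarrow> sep (pos 1) C \<eta> \<zeta> \<Longrightarrow> pair f1 \<eta> \<zeta> = H (charge \<eta>) (charge \<zeta>)"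
    by (fact has_pairingE[OF H])
  have af: "additive_far (pos 1) f" unfolding additive_far_def
  proof (intro exI[of _ C] conjI ballI impI C(1))
    fix \<eta> \<zeta> assume S: "\<eta> \<in> S" "\<zeta> \<in> S" and sep: "sep (pos 1) C \<eta> \<zeta>"
    have "H (charge \<eta>) (charge \<zeta>) = h (charge \<eta> + charge \<zeta>) - h (charge \<eta>) - h (charge \<zeta>)"
      using h S by blast
    then show "f (merge \<eta> \<zeta>) = f \<eta> + f \<zeta>"
      using C(2)[OF S sep] S charge_merge[OF S sep_disjoint[OF sep C(1)]]
      by (simp add: f_def pair_def merge_in_S)
  qed
  have "f vac = 0" using f1(2) h0 by (simp add: f_def)
  moreover have "f \<in> config_functions X b" by (simp add: config_functions_def f_def)
  moreover have "\<forall>e \<in> arcs X. \<forall>\<eta> \<in> S. f (step \<eta> e) - f \<eta> = \<omega> e \<eta>" using grad f0 by (simp add: f1_def)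
  ultimately show ?thesis using additive_far_short_range[OF lg af] af by blast
qed

text \<open>Sums of charges are realised by separated configurations, so a function of the charge
  that is additive over distant configurations is additive on all charges. Every charge is a sum of
  charges of single particles, which determines \<open>T\<close>.\<close>

lemma additive_charge_function:
  assumes T: "\<And>\<eta> \<zeta>. \<eta> \<in> S \<Longrightarrow> \<zeta> \<in> S \<Longrightarrow> charge \<eta> = charge \<zeta> \<Longrightarrow> T \<eta> = T \<zeta>"
    and af: "additive_far (pos 1) T" and vac: "T vac = 0"
  shows "(\<lambda>s. T (single s)) \<in> Consv \<phi> b" and "\<eta> \<in> S \<Longrightarrow> T \<eta> = charge \<eta> (\<lambda>s. T (single s))"
proof -
  obtain C where C: "C \<ge> 0" "\<And>\<eta> \<zeta>. \<eta> \<in> S \<Longrightarrow> \<zeta> \<in> S \<Longrightarrow> sep (pos 1) C \<eta> \<zeta> \<Longrightarrow> T (merge \<eta> \<zeta>) = T \<eta> + T \<zeta>"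
    by (fact additive_farE[OF af])
  have sum: "\<exists>\<theta> \<in> S. charge \<theta> = charge \<eta> + charge \<zeta> \<and> T \<theta> = T \<eta> + T \<zeta>" if S: "\<eta> \<in> S" "\<zeta> \<in> S" for \<eta> \<zeta>
  proof -
    obtain g where g: "g \<in> carrier G" "sep (pos 1) C \<eta> (act g \<zeta>)"
      using direction_sep[OF direction_pos_1 S] by blast
    note gS = act_in_S[OF g(1) S(2)]
    have "T (act g \<zeta>) = T \<zeta>" by (rule T[OF gS S(2) charge_act[OF g(1) S(2)]])
    then show ?thesis
      using C(2)[OF S(1) gS g(2)] charge_merge[OF S(1) gS sep_disjoint[OF g(2) C(1)]]
        charge_act[OF g(1) S(2)] merge_in_S[OF S(1) gS]
      by (intro bexI[of _ "merge \<eta> (act g \<zeta>)"]) auto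
  qed
  have add: "T \<theta> = T \<eta> + T \<zeta>" if S: "\<theta> \<in> S" "\<eta> \<in> S" "\<zeta> \<in> S" and ch: "charge \<theta> = charge \<eta> + charge \<zeta>" for \<theta> \<eta> \<zeta>
  proof -
    obtain \<theta>' where "\<theta>' \<in> S" "charge \<theta>' = charge \<eta> + charge \<zeta>" "T \<theta>' = T \<eta> + T \<zeta>"
      using sum[OF S(2,3)] by (elim bexE conjE)
    then show ?thesis using T[of \<theta> \<theta>'] S(1) ch by simp
  qed
  let ?\<xi> = "\<lambda>s. T (single s)"
  show \<xi>: "?\<xi> \<in> Consv \<phi> b" unfolding Consv_def
  proof (intro CollectI conjI allI impI)
    show "T (single b) = 0" using vac by (simp add: single_base)
    fix s1 s2 s1' s2' assume \<phi>: "(s1', s2') = \<phi> (s1, s2)"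
    \<comment> \<open>The pairs of states before and after \<open>\<phi>\<close> have the same total
      charge, so the conservation law for \<open>?\<xi>\<close> follows from additivity, without
      realising the transition on an edge.\<close>
    have ch: "charge (single s1) + charge (single s2) = charge (single s1') + charge (single s2')"
    proof
      fix \<xi>
      show "(charge (single s1) + charge (single s2)) \<xi> = (charge (single s1') + charge (single s2')) \<xi>"
      proof (cases "\<xi> \<in> Consv \<phi> b")
        case True
        then have "\<xi> s1 + \<xi> s2 = \<xi> s1' + \<xi> s2'" using \<phi> unfolding Consv_def by blast
        then show ?thesis using True by (simp add: charge_single)
      qed (simp add: charge_def)
    qed
    obtain \<theta> where \<theta>: "\<theta> \<in> S" "charge \<theta> = charge (single s1) + charge (single s2)"
      "T \<theta> = T (single s1) + T (single s2)"
      using sum[OF single_in_S[of s1] single_in_S[of s2]] by (elim bexE conjE)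
    show "T (single s1) + T (single s2) = T (single s1') + T (single s2')"
      using add[OF \<theta>(1) single_in_S single_in_S, of s1' s2'] \<theta> ch by simp
  qed
  show "T \<eta> = charge \<eta> ?\<xi>" if "\<eta> \<in> S"
  proof -
    have "finite (supp \<eta>)" using that by simp
    then show ?thesis using that
    proof (induction "supp \<eta>" arbitrary: \<eta> rule: finite_induct)
      case empty
      then have "\<eta> = vac" using supp_empty by auto
      then show ?case by (simp add: vac)
    next
      case (insert x A)
      have x: "x \<in> supp \<eta>" "x \<in> verts X" using insert supp_verts by auto
      have "A = supp (\<eta>(x := b))" using insert by (auto simp: supp_def)
      moreover have in_S: "\<eta>(x := b) \<in> S" using insert x by (intro update_in_S)
      ultimately have "T (\<eta>(x := b)) = charge (\<eta>(x := b)) ?\<xi>" by (rule insert.hyps(3))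
      moreover have "T \<eta> = T (\<eta>(x := b)) + T (single (\<eta> x))"
        using insert.prems in_S charge_remove[OF insert.prems x(1)] by (intro add) auto
      moreover have "charge \<eta> ?\<xi> = charge (\<eta>(x := b)) ?\<xi> + T (single (\<eta> x))"
        using charge_remove[OF insert.prems x(1)] charge_single[OF \<xi>, of "\<eta> x"] by simp
      ultimately show ?case by simp
    qed
  qed
qed

end

section \<open>The decomposition\<close>

lemma sum_pointwise: "(\<Sum>i \<in> A. f i) x = (\<Sum>i \<in> A. f i x)"
  by (induction A rule: infinite_finite_induct) auto

context framed_system
begin

section \<open>Moments\<close>

definition weight :: "(nat \<Rightarrow> 's \<Rightarrow> real) \<Rightarrow> 'x \<Rightarrow> 's \<Rightarrow> real"
  where "weight \<xi>s x s = (\<Sum>j = 1..d. of_int (pos j x) * \<xi>s j s)"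

text \<open>The sum over \<open>j\<close> of the functions \<open>frakA\<close> for
  \<open>\<xi>s j\<close>, rewritten as a sum over particles in which each one carries the
  coordinates of its cell.\<close>

definition moment :: "(nat \<Rightarrow> 's \<Rightarrow> real) \<Rightarrow> ('x \<Rightarrow> 's) \<Rightarrow> real"
  where "moment \<xi>s = (\<lambda>\<eta>. if \<eta> \<in> S then \<Sum>x \<in> supp \<eta>. weight \<xi>s x (\<eta> x) else 0)"

abbreviation D :: "(('x \<Rightarrow> 's) \<Rightarrow> real) \<Rightarrow> 'e \<Rightarrow> ('x \<Rightarrow> 's) \<Rightarrow> real"
  where "D \<equiv> differential X \<phi> b"

abbreviation \<AA> :: "nat \<Rightarrow> ('s \<Rightarrow> real) \<Rightarrow> ('x \<Rightarrow> 's) \<Rightarrow> real"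
  where "\<AA> \<equiv> frakA X G aV b n \<Lambda>0"

definition slot :: "nat \<Rightarrow> ('s \<Rightarrow> real) \<Rightarrow> nat \<Rightarrow> 's \<Rightarrow> real"
  where "slot j \<xi> = (\<lambda>i. if i = j then \<xi> else 0)"

text \<open>Such a tuple encodes a homomorphism from \<open>G\<close> to the conserved quantities by
  its values on the \<open>\<sigma> j\<close>. Vanishing off \<open>{1..d}\<close> makes the
  encoding unique.\<close>

definition Consv_tuples :: "(nat \<Rightarrow> 's \<Rightarrow> real) set"
  where "Consv_tuples = {\<xi>s. (\<forall>j \<in> {1..d}. \<xi>s j \<in> Consv \<phi> b) \<and> (\<forall>j. j \<notin> {1..d} \<longrightarrow> \<xi>s j = 0)}"

lemma Consv_tuplesD: "\<xi>s \<in> Consv_tuples \<Longrightarrow> j \<in> {1..d} \<Longrightarrow> \<xi>s j \<in> Consv \<phi> b"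
  by (simp add: Consv_tuples_def)

lemma moment_config: "moment \<xi>s \<in> config_functions X b"
  by (simp add: config_functions_def moment_def)

lemma weight_base: "\<xi>s \<in> Consv_tuples \<Longrightarrow> weight \<xi>s x b = 0"
  unfolding weight_def by (intro sum.neutral) (auto simp: Consv_base dest: Consv_tuplesD)

lemma moment_superset:
  assumes "\<xi>s \<in> Consv_tuples" "\<eta> \<in> S" "finite U" "supp \<eta> \<subseteq> U" "U \<subseteq> verts X"
  shows "moment \<xi>s \<eta> = (\<Sum>x \<in> U. weight \<xi>s x (\<eta> x))"
proof -
  have "(\<Sum>x \<in> supp \<eta>. weight \<xi>s x (\<eta> x)) = (\<Sum>x \<in> U. weight \<xi>s x (\<eta> x))"
  proof (rule sum.mono_neutral_left[OF assms(3,4)], intro ballI)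
    fix x assume "x \<in> U - supp \<eta>"
    then have "\<eta> x = b" using assms(5) by (intro not_supp) auto
    then show "weight \<xi>s x (\<eta> x) = 0" using weight_base[OF assms(1)] by simp
  qed
  then show ?thesis using assms(2) by (simp add: moment_def)
qed

text \<open>Translation by \<open>g\<close> raises \<open>pos j\<close> by \<open>n j g\<close> at
  every particle. The moment is thus not invariant, but its defect is a function of the charge, and
  this makes its differential invariant.\<close>

lemma moment_act:
  assumes \<xi>s: "\<xi>s \<in> Consv_tuples" and g: "g \<in> carrier G" and \<eta>: "\<eta> \<in> S"
  shows "moment \<xi>s (act g \<eta>) = moment \<xi>s \<eta> + (\<Sum>j = 1..d. of_int (n j g) * charge \<eta> (\<xi>s j))"
proof -
  have inj: "inj_on (aV g) (supp \<eta>)"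
    using g by (auto simp: inj_on_def act_eq_iff supp_verts)
  have "moment \<xi>s (act g \<eta>) = (\<Sum>x \<in> aV g ` supp \<eta>. weight \<xi>s x (act g \<eta> x))"
    using g \<eta> by (simp add: moment_def act_in_S supp_act)
  also have "\<dots> = (\<Sum>x \<in> supp \<eta>. weight \<xi>s (aV g x) (act g \<eta> (aV g x)))"
    using inj by (simp add: sum.reindex)
  also have "\<dots> = (\<Sum>x \<in> supp \<eta>. weight \<xi>s x (\<eta> x) + (\<Sum>j = 1..d. of_int (n j g) * \<xi>s j (\<eta> x)))"
  proof (rule sum.cong[OF refl])
    fix x assume "x \<in> supp \<eta>"
    then have x: "x \<in> verts X" by (rule supp_verts)
    have "act g \<eta> (aV g x) = \<eta> x" using g x by (simp add: act_apply)
    moreover have "weight \<xi>s (aV g x) s = weight \<xi>s x s + (\<Sum>j = 1..d. of_int (n j g) * \<xi>s j s)" for s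
      unfolding weight_def sum.distrib[symmetric]
      using g x by (intro sum.cong) (auto simp: pos_act distrib_right)
    ultimately show "weight \<xi>s (aV g x) (act g \<eta> (aV g x))
        = weight \<xi>s x (\<eta> x) + (\<Sum>j = 1..d. of_int (n j g) * \<xi>s j (\<eta> x))" by simp
  qed
  also have "\<dots> = moment \<xi>s \<eta> + (\<Sum>x \<in> supp \<eta>. \<Sum>j = 1..d. of_int (n j g) * \<xi>s j (\<eta> x))"
    using \<eta> by (simp add: moment_def sum.distrib)
  also have "(\<Sum>x \<in> supp \<eta>. \<Sum>j = 1..d. of_int (n j g) * \<xi>s j (\<eta> x))
      = (\<Sum>j = 1..d. of_int (n j g) * charge \<eta> (\<xi>s j))"
    by (subst sum.swap, rule sum.cong[OF refl])
      (simp add: charge_def Consv_tuplesD[OF \<xi>s] sum_distrib_left)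
  finally show ?thesis .
qed

lemma moment_short_range:
  assumes \<xi>s: "\<xi>s \<in> Consv_tuples"
  shows "short_range 0 (moment \<xi>s)"
  unfolding short_range_def
proof (intro ballI impI)
  fix \<eta> x y assume \<eta>: "\<eta> \<in> S" and x: "x \<in> verts X" and y: "y \<in> verts X"
    and far: "\<not> gdist X x y \<le> enat 0"
  \<comment> \<open>Moments have no interaction between distinct sites, and range 0 only has to
    exclude \<open>x = y\<close>.\<close>
  have xy: "x \<noteq> y" using far gdist_self[OF x] by blast
  have expand: "moment \<xi>s \<zeta> = (\<Sum>z \<in> supp \<eta>. weight \<xi>s z (\<zeta> z))" if "\<zeta> \<in> S" "supp \<zeta> \<subseteq> supp \<eta>" for \<zeta>
    using moment_superset[OF \<xi>s that(1) finite_supp[OF \<eta>] that(2) supp_subset_verts] .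
  have S: "\<eta>(x := b) \<in> S" "\<eta>(y := b) \<in> S" "\<eta>(x := b, y := b) \<in> S"
    using \<eta> x y by (auto intro!: update_in_S)
  have sub: "supp (\<eta>(x := b)) \<subseteq> supp \<eta>" "supp (\<eta>(y := b)) \<subseteq> supp \<eta>"
    "supp (\<eta>(x := b, y := b)) \<subseteq> supp \<eta>" by (auto simp: supp_def)
  show "moment \<xi>s \<eta> + moment \<xi>s (\<eta>(x := b, y := b)) = moment \<xi>s (\<eta>(x := b)) + moment \<xi>s (\<eta>(y := b))"
    unfolding expand[OF \<eta> order_refl] expand[OF S(1) sub(1)] expand[OF S(2) sub(2)]
      expand[OF S(3) sub(3)] sum.distrib[symmetric]
    using xy by (intro sum.cong) auto
qed

lemma cell_fibre: "g \<in> carrier G \<Longrightarrow> aV g ` \<Lambda>0 = {x \<in> verts X. cell x = g}"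
  using cell cell_eqI domain_verts by auto

text \<open>The translate of \<open>\<Lambda>0\<close> by \<open>g\<close> is the fibre of
  \<open>cell\<close> over \<open>g\<close>, so the sum over the group regroups into a sum over
  occupied vertices.\<close>

lemma frakA_moment:
  assumes \<xi>: "\<xi> \<in> Consv \<phi> b" and j: "j \<in> {1..d}"
  shows "\<AA> j \<xi> = moment (slot j \<xi>)"
proof
  fix \<eta>
  show "\<AA> j \<xi> \<eta> = moment (slot j \<xi>) \<eta>"
  proof (cases "\<eta> \<in> S")
    case True
    let ?t = "\<lambda>g. of_int (n j g) * xi_sum \<xi> (aV g ` \<Lambda>0) \<eta>"
    have inner: "xi_sum \<xi> (aV g ` \<Lambda>0) \<eta> = (\<Sum>x \<in> {x \<in> supp \<eta>. cell x = g}. \<xi> (\<eta> x))" if g: "g \<in> carrier G" for g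
    proof -
      have fin: "finite (aV g ` \<Lambda>0)" using finite_domain by simp
      show ?thesis unfolding xi_sum_def using fin unfolding cell_fibre[OF g]
      proof (rule sum.mono_neutral_right)
        show "{x \<in> supp \<eta>. cell x = g} \<subseteq> {x \<in> verts X. cell x = g}" using supp_verts by auto
        show "\<forall>x \<in> {x \<in> verts X. cell x = g} - {x \<in> supp \<eta>. cell x = g}. \<xi> (\<eta> x) = 0"
        proof
          fix x assume "x \<in> {x \<in> verts X. cell x = g} - {x \<in> supp \<eta>. cell x = g}"
          then have "\<eta> x = b" by (intro not_supp) auto
          then show "\<xi> (\<eta> x) = 0" using Consv_base[OF \<xi>] by simp
        qed
      qed
    qed
    have cells: "cell ` supp \<eta> \<subseteq> carrier G" using cell supp_verts by blast
    have "\<AA> j \<xi> \<eta> = (\<Sum>g \<in> {g \<in> carrier G. ?t g \<noteq> 0}. ?t g)" using True by (simp add: frakA_def)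
    also have "\<dots> = (\<Sum>g \<in> cell ` supp \<eta>. ?t g)"
    proof (rule sum.mono_neutral_left)
      show "finite (cell ` supp \<eta>)" using True by simp
      show "{g \<in> carrier G. ?t g \<noteq> 0} \<subseteq> cell ` supp \<eta>"
      proof
        fix g assume g: "g \<in> {g \<in> carrier G. ?t g \<noteq> 0}"
        then have "{x \<in> supp \<eta>. cell x = g} \<noteq> {}" using inner[of g] by force
        then show "g \<in> cell ` supp \<eta>" by blast
      qed
      show "\<forall>g \<in> cell ` supp \<eta> - {g \<in> carrier G. ?t g \<noteq> 0}. ?t g = 0" using cells by blast
    qed
    also have "\<dots> = (\<Sum>g \<in> cell ` supp \<eta>. \<Sum>x \<in> {x \<in> supp \<eta>. cell x = g}. of_int (pos j x) * \<xi> (\<eta> x))"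
    proof (rule sum.cong[OF refl])
      fix g assume "g \<in> cell ` supp \<eta>"
      then have g: "g \<in> carrier G" using cells by blast
      show "?t g = (\<Sum>x \<in> {x \<in> supp \<eta>. cell x = g}. of_int (pos j x) * \<xi> (\<eta> x))"
        unfolding inner[OF g] sum_distrib_left by (intro sum.cong) (auto simp: pos_def)
    qed
    also have "\<dots> = (\<Sum>x \<in> supp \<eta>. of_int (pos j x) * \<xi> (\<eta> x))"
      using True by (intro sum.group) auto
    also have "\<dots> = (\<Sum>x \<in> supp \<eta>. weight (slot j \<xi>) x (\<eta> x))"
    proof (rule sum.cong[OF refl])
      fix x
      have "weight (slot j \<xi>) x (\<eta> x) = (\<Sum>i = 1..d. if i = j then of_int (pos j x) * \<xi> (\<eta> x) else 0)"
        unfolding weight_def slot_def by (intro sum.cong) auto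
      then show "of_int (pos j x) * \<xi> (\<eta> x) = weight (slot j \<xi>) x (\<eta> x)" using j by simp
    qed
    finally show ?thesis using True by (simp add: moment_def)
  qed (simp add: frakA_def moment_def)
qed

section \<open>Linear parametrisation of the complement\<close>

lemma linear_D: "linear D"
  by (rule linearI) (auto simp: differential_def fun_eq_iff algebra_simps)

lemma linear_moment: "linear moment"
proof (rule linearI)
  show "moment (\<xi>s + \<xi>s') = moment \<xi>s + moment \<xi>s'" for \<xi>s \<xi>s'
    by (auto simp: moment_def weight_def fun_eq_iff sum.distrib[symmetric] distrib_left)
  show "moment (c *\<^sub>R \<xi>s) = c *\<^sub>R moment \<xi>s" for c \<xi>s
    by (auto simp: moment_def weight_def fun_eq_iff sum_distrib_left mult.left_commute)
qed

definition D_moment :: "(nat \<Rightarrow> 's \<Rightarrow> real) \<Rightarrow> 'e \<Rightarrow> ('x \<Rightarrow> 's) \<Rightarrow> real"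
  where "D_moment \<xi>s = D (moment \<xi>s)"

lemma linear_D_moment: "linear D_moment"
  using linear_compose[OF linear_moment linear_D] unfolding D_moment_def comp_def .

lemma linear_slot: "linear (slot j)"
  by (rule linearI) (auto simp: slot_def fun_eq_iff)

lemma slot_tuples: "\<xi> \<in> Consv \<phi> b \<Longrightarrow> j \<in> {1..d} \<Longrightarrow> slot j \<xi> \<in> Consv_tuples"
  using subspace_0[OF subspace_Consv] by (auto simp: Consv_tuples_def slot_def)

lemma subspace_Consv_tuples: "subspace Consv_tuples"
  using subspace_Consv[of \<phi> b]
  by (auto simp: subspace_def Consv_tuples_def)

lemma tuple_sum_slots: "\<xi>s \<in> Consv_tuples \<Longrightarrow> \<xi>s = (\<Sum>j = 1..d. slot j (\<xi>s j))"
proof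
  fix i assume \<xi>s: "\<xi>s \<in> Consv_tuples"
  have "(\<Sum>j = 1..d. slot j (\<xi>s j)) i = (\<Sum>j = 1..d. slot j (\<xi>s j) i)" by (rule sum_pointwise)
  also have "\<dots> = (\<Sum>j = 1..d. if i = j then \<xi>s i else 0)"
    by (rule sum.cong) (simp_all add: slot_def)
  also have "\<dots> = \<xi>s i" using \<xi>s by (simp add: Consv_tuples_def)
  finally show "\<xi>s i = (\<Sum>j = 1..d. slot j (\<xi>s j)) i" by simp
qed

text \<open>Moving a particle by \<open>\<sigma>\<^sub>i\<close> does not change the charge, but changes the moment by its \<open>i\<close>-th
  entry.\<close>

lemma moment_not_invariant:
  assumes \<xi>s: "\<xi>s \<in> Consv_tuples" and inv: "\<And>g \<eta>. g \<in> carrier G \<Longrightarrow> \<eta> \<in> S \<Longrightarrow> f (act g \<eta>) = f \<eta>"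
    and eq: "D_moment \<xi>s = D f"
  shows "\<xi>s = 0"
proof
  fix i
  show "\<xi>s i = 0 i"
  proof (cases "i \<in> {1..d}")
    case True
    have "\<xi>s i s = 0" for s
    proof -
      \<comment> \<open>Equal differentials mean that this difference has zero gradient, so its
        values depend on the charge alone.\<close>
      let ?K = "\<lambda>\<eta>. moment \<xi>s \<eta> - f \<eta>"
      have step: "?K (step \<eta> e) = ?K \<eta>" if "e \<in> arcs X" "\<eta> \<in> S" for e \<eta>
        using fun_cong[OF fun_cong[OF eq, of e], of \<eta>] that by (simp add: D_moment_def differential_def)
      have \<sigma>: "\<sigma> i \<in> carrier G" using True by simp
      have "?K (act (\<sigma> i) (single s)) = ?K (single s)"
        by (rule constant_on_charge[OF step act_in_S[OF \<sigma> single_in_S] single_in_S charge_act[OF \<sigma> single_in_S]])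
      then have "(\<Sum>j = 1..d. of_int (n j (\<sigma> i)) * charge (single s) (\<xi>s j)) = 0"
        using moment_act[OF \<xi>s \<sigma> single_in_S] inv[OF \<sigma> single_in_S] by simp
      also have "(\<Sum>j = 1..d. of_int (n j (\<sigma> i)) * charge (single s) (\<xi>s j)) = (\<Sum>j = 1..d. if i = j then \<xi>s i s else 0)"
        using True by (intro sum.cong) (auto simp: n_sigma charge_single Consv_tuplesD[OF \<xi>s])
      finally show ?thesis using True by simp
    qed
    then show ?thesis by (simp add: fun_eq_iff)
  qed (use \<xi>s in \<open>simp add: Consv_tuples_def\<close>)
qed

text \<open>This is \<open>moment_not_invariant\<close> for \<open>f = 0\<close>, applied to the
  difference of the tuples.\<close>

lemma inj_D_moment: "inj_on D_moment Consv_tuples"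
proof (rule inj_onI)
  fix \<xi>s \<xi>s' assume a: "\<xi>s \<in> Consv_tuples" "\<xi>s' \<in> Consv_tuples" "D_moment \<xi>s = D_moment \<xi>s'"
  have "D_moment (\<xi>s - \<xi>s') = D 0"
    using a(3) linear_diff[OF linear_D_moment] linear_0[OF linear_D] by simp
  then have "\<xi>s - \<xi>s' = 0"
    by (rule moment_not_invariant[OF subspace_diff[OF subspace_Consv_tuples a(1,2)], rotated]) simp
  then show "\<xi>s = \<xi>s'" by simp
qed

abbreviation dV :: "('e \<Rightarrow> ('x \<Rightarrow> 's) \<Rightarrow> real) set"
  where "dV \<equiv> dV_space X G aV \<phi> b d n \<Lambda>0"

lemma dV_generators:
  "{D (\<AA> j \<xi>) |\<xi> j. \<xi> \<in> Consv \<phi> b \<and> j \<in> {1..d}} = {D_moment (slot j \<xi>) |\<xi> j. \<xi> \<in> Consv \<phi> b \<and> j \<in> {1..d}}"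
proof -
  have *: "\<omega> = D (\<AA> j \<xi>) \<and> \<xi> \<in> Consv \<phi> b \<and> j \<in> {1..d} \<longleftrightarrow>
      \<omega> = D_moment (slot j \<xi>) \<and> \<xi> \<in> Consv \<phi> b \<and> j \<in> {1..d}" for \<omega> \<xi> j
    using frakA_moment[of \<xi> j] by (auto simp: D_moment_def)
  show ?thesis by (simp only: *)
qed

lemma dV_eq: "dV = D_moment ` Consv_tuples"
proof
  have "{D_moment (slot j \<xi>) |\<xi> j. \<xi> \<in> Consv \<phi> b \<and> j \<in> {1..d}} \<subseteq> D_moment ` Consv_tuples"
    using slot_tuples by blast
  then show "dV \<subseteq> D_moment ` Consv_tuples"
    unfolding dV_space_def dV_generators
    by (intro span_minimal linear_subspace_image[OF linear_D_moment subspace_Consv_tuples])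
  show "D_moment ` Consv_tuples \<subseteq> dV"
  proof
    fix \<omega> assume "\<omega> \<in> D_moment ` Consv_tuples"
    then obtain \<xi>s where \<xi>s: "\<xi>s \<in> Consv_tuples" "\<omega> = D_moment \<xi>s" by blast
    have "\<omega> = D_moment (\<Sum>j = 1..d. slot j (\<xi>s j))" using tuple_sum_slots[OF \<xi>s(1)] \<xi>s(2) by simp
    also have "\<dots> = (\<Sum>j = 1..d. D_moment (slot j (\<xi>s j)))" by (rule linear_sum[OF linear_D_moment])
    also have "\<dots> \<in> dV"
      unfolding dV_space_def dV_generators
    proof (intro span_sum span_base)
      fix j assume "j \<in> {1..d}"
      then show "D_moment (slot j (\<xi>s j)) \<in> {D_moment (slot j \<xi>) |\<xi> j. \<xi> \<in> Consv \<phi> b \<and> j \<in> {1..d}}"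
        using Consv_tuplesD[OF \<xi>s(1)] by blast
    qed
    finally show "\<omega> \<in> dV" .
  qed
qed

section \<open>Bases and dimension of the complement\<close>

lemma slots_basis:
  assumes B: "independent B" "span B = Consv \<phi> b"
  defines "Z \<equiv> (\<lambda>(\<xi>, j). slot j \<xi>) ` (B \<times> {1..d})"
  shows "independent Z" and "span Z = Consv_tuples" and "inj_on (\<lambda>(\<xi>, j). slot j \<xi>) (B \<times> {1..d})"
proof -
  \<comment> \<open>Needed for injectivity: \<open>slot j 0\<close> would not determine
    \<open>j\<close>.\<close>
  have nz: "\<xi> \<noteq> 0" if "\<xi> \<in> B" for \<xi> using B(1) that dependent_zero by blast
  have slot_eq: "slot j \<xi> = slot j' \<xi>' \<Longrightarrow> \<xi> = \<xi>' \<and> j = j'" if "\<xi> \<in> B" "\<xi>' \<in> B" for \<xi> \<xi>' j j'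
    using nz[OF that(1)] nz[OF that(2)] by (auto simp: slot_def fun_eq_iff split: if_splits)
  then show inj: "inj_on (\<lambda>(\<xi>, j). slot j \<xi>) (B \<times> {1..d})"
    by (auto intro!: inj_onI)
  show "independent Z" unfolding dependent_explicit
  proof (rule notI, elim exE conjE bexE)
    fix T u v assume T: "finite T" "T \<subseteq> Z" and rel: "(\<Sum>v \<in> T. u v *\<^sub>R v) = 0" and v: "v \<in> T" "u v \<noteq> 0"
    obtain \<xi>0 j0 where v_eq: "v = slot j0 \<xi>0" "\<xi>0 \<in> B" using v T unfolding Z_def by auto
    \<comment> \<open>Evaluation at \<open>j0\<close> annihilates the vectors of all other slots and
      turns the relation into one among elements of \<open>B\<close>.\<close>
    let ?T0 = "{w \<in> T. w j0 \<noteq> 0}"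
    have form: "\<exists>\<xi> \<in> B. w = slot j0 \<xi>" if w0: "w \<in> ?T0" for w
    proof -
      obtain \<xi> j where w: "w = slot j \<xi>" "\<xi> \<in> B" using w0 T unfolding Z_def by auto
      then have "j = j0" using w0 by (auto simp: slot_def split: if_splits)
      then show ?thesis using w by blast
    qed
    have val: "slot j0 \<xi> j0 = \<xi>" for \<xi> by (simp add: slot_def)
    have inj0: "inj_on (\<lambda>w. w j0) ?T0"
    proof (rule inj_onI)
      fix w w' assume "w \<in> ?T0" "w' \<in> ?T0" "w j0 = w' j0"
      then show "w = w'" using form[of w] form[of w'] val by auto
    qed
    have "(\<Sum>\<xi> \<in> (\<lambda>w. w j0) ` ?T0. u (slot j0 \<xi>) *\<^sub>R \<xi>) = (\<Sum>w \<in> ?T0. u (slot j0 (w j0)) *\<^sub>R w j0)"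
      using inj0 by (simp add: sum.reindex)
    also have "\<dots> = (\<Sum>w \<in> ?T0. u w *\<^sub>R w j0)"
    proof (rule sum.cong[OF refl])
      fix w assume "w \<in> ?T0"
      from form[OF this] have "slot j0 (w j0) = w" using val by auto
      then show "u (slot j0 (w j0)) *\<^sub>R w j0 = u w *\<^sub>R w j0" by simp
    qed
    also have "\<dots> = (\<Sum>w \<in> T. u w *\<^sub>R w j0)" using T(1) by (intro sum.mono_neutral_left) auto
    also have "\<dots> = (\<Sum>w \<in> T. (u w *\<^sub>R w) j0)" by (rule sum.cong[OF refl]) (rule scaleR_fun_apply[symmetric])
    also have "\<dots> = (\<Sum>w \<in> T. u w *\<^sub>R w) j0" by (rule sum_pointwise[symmetric])
    also have "\<dots> = 0" by (simp add: rel)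
    finally have rel0: "(\<Sum>\<xi> \<in> (\<lambda>w. w j0) ` ?T0. u (slot j0 \<xi>) *\<^sub>R \<xi>) = 0" .
    have sub: "(\<lambda>w. w j0) ` ?T0 \<subseteq> B"
    proof
      fix \<xi> assume "\<xi> \<in> (\<lambda>w. w j0) ` ?T0"
      then obtain w where "w \<in> ?T0" "\<xi> = w j0" by blast
      then show "\<xi> \<in> B" using form[of w] val by auto
    qed
    have "\<xi>0 \<in> (\<lambda>w. w j0) ` ?T0"
      using v(1) nz[OF v_eq(2)] v_eq(1) val[of \<xi>0] by (intro image_eqI[of _ _ v]) auto
    then have "u (slot j0 \<xi>0) = 0"
      using T(1) by (intro independentD[OF B(1) _ sub rel0]) auto
    then show False using v(2) v_eq(1) by simp
  qed
  show "span Z = Consv_tuples"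
  proof
    have "B \<subseteq> Consv \<phi> b" using B(2) span_superset by blast
    then have "Z \<subseteq> Consv_tuples" unfolding Z_def using slot_tuples by auto
    then show "span Z \<subseteq> Consv_tuples" by (rule span_minimal[OF _ subspace_Consv_tuples])
    show "Consv_tuples \<subseteq> span Z"
    proof
      fix \<xi>s assume \<xi>s: "\<xi>s \<in> Consv_tuples"
      have "slot j (\<xi>s j) \<in> span Z" if j: "j \<in> {1..d}" for j
      proof -
        have "\<xi>s j \<in> span B" using Consv_tuplesD[OF \<xi>s j] B(2) by simp
        then have "slot j (\<xi>s j) \<in> span (slot j ` B)" unfolding linear_span_image[OF linear_slot] by blast
        moreover have "slot j ` B \<subseteq> Z" unfolding Z_def using j by force
        ultimately show ?thesis using span_mono by blast
      qed
      then have "(\<Sum>j = 1..d. slot j (\<xi>s j)) \<in> span Z" by (rule span_sum)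
      then show "\<xi>s \<in> span Z" using tuple_sum_slots[OF \<xi>s] by simp
    qed
  qed
qed

text \<open>An explicit bijection serves both notions of dimension, the cardinal one of
  \<open>has_dimension_of\<close> and the natural number \<open>dim\<close>.\<close>

lemma dV_basis:
  assumes B: "independent B" "span B = Consv \<phi> b"
  shows "\<exists>Y. independent Y \<and> span Y = dV \<and> bij_betw (\<lambda>(\<xi>, j). D_moment (slot j \<xi>)) (B \<times> {1..d}) Y"
proof -
  let ?Z = "(\<lambda>(\<xi>, j). slot j \<xi>) ` (B \<times> {1..d})"
  note Z = slots_basis[OF B]
  have "independent (D_moment ` ?Z)"
    using inj_D_moment Z(1,2) by (intro linear_independent_injective_image[OF linear_D_moment]) auto
  moreover have "span (D_moment ` ?Z) = dV"
    using Z(2) by (simp add: linear_span_image[OF linear_D_moment] dV_eq)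
  moreover have "bij_betw (D_moment \<circ> (\<lambda>(\<xi>, j). slot j \<xi>)) (B \<times> {1..d}) (D_moment ` ?Z)"
  proof (rule bij_betw_trans)
    show "bij_betw (\<lambda>(\<xi>, j). slot j \<xi>) (B \<times> {1..d}) ?Z" using Z(3) by (simp add: bij_betw_def)
    have "?Z \<subseteq> Consv_tuples" using span_superset[of ?Z] unfolding Z(2) .
    then show "bij_betw D_moment ?Z (D_moment ` ?Z)" by (intro inj_on_imp_bij_betw inj_on_subset[OF inj_D_moment])
  qed
  moreover have "D_moment \<circ> (\<lambda>(\<xi>, j). slot j \<xi>) = (\<lambda>(\<xi>, j). D_moment (slot j \<xi>))" by auto
  ultimately show ?thesis by (intro exI[of _ "D_moment ` ?Z"]) simp
qed

lemma dV_has_dimension: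
  "independent B \<Longrightarrow> span B = Consv \<phi> b \<Longrightarrow> has_dimension_of dV (B \<times> {1..d})"
proof -
  assume "independent B" "span B = Consv \<phi> b"
  from dV_basis[OF this] obtain Y where Y: "independent Y" "span Y = dV"
      "bij_betw (\<lambda>(\<xi>, j). D_moment (slot j \<xi>)) (B \<times> {1..d}) Y"
    by (elim exE conjE)
  have "B \<times> {1..d} \<approx> Y" unfolding eqpoll_def
    by (intro exI[of _ "\<lambda>(\<xi>, j). D_moment (slot j \<xi>)"] Y(3))
  then show ?thesis unfolding has_dimension_of_def using Y(1,2) eqpoll_sym by blast
qed

text \<open>If the basis \<open>B\<close> is infinite, both sides are 0 by the conventions for
  \<open>card\<close> and \<open>dim\<close>; the statement on cardinals is
  \<open>dV_has_dimension\<close>.\<close>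

lemma dim_dV: "dim dV = c_dim \<phi> b * d"
proof -
  obtain B where B: "B \<subseteq> Consv \<phi> b" "independent B" "Consv \<phi> b \<subseteq> span B" "card B = dim (Consv \<phi> b)"
    using basis_exists by blast
  then have span: "span B = Consv \<phi> b" using span_minimal[OF B(1) subspace_Consv] by blast
  obtain Y where Y: "independent Y" "span Y = dV" "bij_betw (\<lambda>(\<xi>, j). D_moment (slot j \<xi>)) (B \<times> {1..d}) Y"
    using dV_basis[OF B(2) span] by blast
  have "dim dV = card Y" using Y(1,2) dim_eq_card_independent[OF Y(1)] dim_span[of Y] by simp
  also have "\<dots> = card (B \<times> {1..d})" using bij_betw_same_card[OF Y(3)] by simp
  finally show ?thesis using B(4) by (simp add: c_dim_def card_cartesian_product)
qed

section \<open>Invariant functions and forms\<close>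

abbreviation \<C> :: "('e \<Rightarrow> ('x \<Rightarrow> 's) \<Rightarrow> real) set"
  where "\<C> \<equiv> invariant_closed_uniform_forms X \<iota> G aV aE \<phi> b"

abbreviation \<U> :: "(('x \<Rightarrow> 's) \<Rightarrow> real) set"
  where "\<U> \<equiv> invariant_uniform_functions X G aV b"

lemma invariant_uniform_iff:
  "f \<in> \<U> \<longleftrightarrow> f \<in> config_functions X b \<and> (\<exists>R. short_range R f) \<and> (\<forall>g \<in> carrier G. \<forall>\<eta> \<in> S. f (act g \<eta>) = f \<eta>)"
proof -
  have "(\<forall>g \<in> carrier G. act_function X G aV b g f = f) \<longleftrightarrow> (\<forall>g \<in> carrier G. \<forall>\<eta> \<in> S. f (act g \<eta>) = f \<eta>)"
    if f: "f \<in> config_functions X b"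
  proof (intro iffI ballI)
    fix g \<eta> assume a: "\<forall>g \<in> carrier G. act_function X G aV b g f = f" and g: "g \<in> carrier G" and \<eta>: "\<eta> \<in> S"
    have "act_function X G aV b (inv g) f = f" using a g by simp
    from fun_cong[OF this, of \<eta>] show "f (act g \<eta>) = f \<eta>" using g \<eta> by (simp add: act_function_def)
  next
    fix g assume a: "\<forall>g \<in> carrier G. \<forall>\<eta> \<in> S. f (act g \<eta>) = f \<eta>" and g: "g \<in> carrier G"
    have "f (act (inv g) \<eta>) = f \<eta>" if "\<eta> \<in> S" for \<eta> using a that inv_closed[OF g] by blast
    then show "act_function X G aV b g f = f"
      using f by (auto simp: act_function_def config_functions_def fun_eq_iff)
  qed
  then show ?thesis
    unfolding invariant_uniform_functions_def uniform_functions_iff mem_Collect_eq by blast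
qed

lemma subspace_invariant_uniform: "subspace \<U>"
proof (rule subspaceI)
  show "0 \<in> \<U>" by (auto simp: invariant_uniform_iff config_functions_def short_range_def)
next
  fix f f' assume f: "f \<in> \<U>" and f': "f' \<in> \<U>"
  obtain R R' where "short_range R f" "short_range R' f'" using f f' by (auto simp: invariant_uniform_iff)
  then have R: "short_range (max R R') f" "short_range (max R R') f'"
    using short_range_mono[of R "max R R'"] short_range_mono[of R' "max R R'"] by auto
  have "short_range (max R R') (f + f')"
    unfolding short_range_def
  proof (intro ballI impI)
    fix \<eta> x y assume a: "\<eta> \<in> S" "x \<in> verts X" "y \<in> verts X" "\<not> gdist X x y \<le> enat (max R R')"
    have "f \<eta> + f (\<eta>(x := b, y := b)) = f (\<eta>(x := b)) + f (\<eta>(y := b))"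
      using R(1) a unfolding short_range_def by blast
    moreover have "f' \<eta> + f' (\<eta>(x := b, y := b)) = f' (\<eta>(x := b)) + f' (\<eta>(y := b))"
      using R(2) a unfolding short_range_def by blast
    ultimately show "(f + f') \<eta> + (f + f') (\<eta>(x := b, y := b)) = (f + f') (\<eta>(x := b)) + (f + f') (\<eta>(y := b))"
      by simp
  qed
  then show "f + f' \<in> \<U>"
    using f f' by (auto simp: invariant_uniform_iff intro: subspace_add[OF subspace_config_functions])
next
  fix c :: real and f assume f: "f \<in> \<U>"
  obtain R where R: "short_range R f" using f by (auto simp: invariant_uniform_iff)
  have "short_range R (c *\<^sub>R f)"
    unfolding short_range_def
  proof (intro ballI impI)
    fix \<eta> x y assume a: "\<eta> \<in> S" "x \<in> verts X" "y \<in> verts X" "\<not> gdist X x y \<le> enat R"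
    have "f \<eta> + f (\<eta>(x := b, y := b)) = f (\<eta>(x := b)) + f (\<eta>(y := b))"
      using R a unfolding short_range_def by blast
    then show "(c *\<^sub>R f) \<eta> + (c *\<^sub>R f) (\<eta>(x := b, y := b)) = (c *\<^sub>R f) (\<eta>(x := b)) + (c *\<^sub>R f) (\<eta>(y := b))"
      by (simp add: distrib_left[symmetric])
  qed
  then show "c *\<^sub>R f \<in> \<U>"
    using f by (auto simp: invariant_uniform_iff intro: subspace_scale[OF subspace_config_functions])
qed

lemma subspace_invariant_forms: "subspace \<C>"
proof (rule subspaceI)
  have "act_form X G aV aE b g 0 = (0 :: 'e \<Rightarrow> ('x \<Rightarrow> 's) \<Rightarrow> real)" for g
    by (auto simp: act_form_def fun_eq_iff)
  then show "0 \<in> \<C>"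
    using subspace_0[OF subspace_closed_uniform_forms] by (simp add: invariant_closed_uniform_forms_def)
next
  fix \<omega> \<omega>' assume "\<omega> \<in> \<C>" "\<omega>' \<in> \<C>"
  moreover have "act_form X G aV aE b g (\<omega> + \<omega>') = act_form X G aV aE b g \<omega> + act_form X G aV aE b g \<omega>'" for g
    by (auto simp: act_form_def fun_eq_iff)
  ultimately show "\<omega> + \<omega>' \<in> \<C>"
    using subspace_add[OF subspace_closed_uniform_forms] by (simp add: invariant_closed_uniform_forms_def)
next
  fix c :: real and \<omega> assume "\<omega> \<in> \<C>"
  moreover have "act_form X G aV aE b g (c *\<^sub>R \<omega>) = c *\<^sub>R act_form X G aV aE b g \<omega>" for g
    by (auto simp: act_form_def fun_eq_iff)
  ultimately show "c *\<^sub>R \<omega> \<in> \<C>"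
    using subspace_scale[OF subspace_closed_uniform_forms] by (simp add: invariant_closed_uniform_forms_def)
qed

text \<open>Transitions preserve the charge, so a defect of invariance that depends on the charge
  alone cancels in the differential. Invariant functions are the case \<open>k = 0\<close>; moments
  have a nonzero defect.\<close>

lemma D_invariant_form:
  assumes sr: "short_range R f"
    and inv: "\<And>g \<eta>. g \<in> carrier G \<Longrightarrow> \<eta> \<in> S \<Longrightarrow> f (act g \<eta>) = f \<eta> + k g (charge \<eta>)"
  shows "D f \<in> \<C>"
proof -
  have "act_form X G aV aE b g (D f) = D f" if g: "g \<in> carrier G" for g
  proof (intro ext)
    fix e \<eta>
    show "act_form X G aV aE b g (D f) e \<eta> = D f e \<eta>"
    proof (cases "e \<in> arcs X \<and> \<eta> \<in> S")
      case True
      then have e: "e \<in> arcs X" "\<eta> \<in> S" by auto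
      have g': "inv g \<in> carrier G" using g by simp
      have "f (step (act (inv g) \<eta>) (aE (inv g) e)) = f (step \<eta> e) + k (inv g) (charge \<eta>)"
        using step_act[OF g' e] inv[OF g' step_in_S[OF e(2,1)]] charge_step[OF e(2,1)] by simp
      then show ?thesis
        using e g' inv[OF g' e(2)] by (simp add: act_form_def differential_def act_in_S)
    next
      case False
      then show ?thesis by (auto simp: act_form_def differential_def)
    qed
  qed
  then show ?thesis
    using differential_closed_uniform[OF short_range_local_gradient[OF sr]]
    by (simp add: invariant_closed_uniform_forms_def)
qed

lemma D_uniform_subset: "D ` \<U> \<subseteq> \<C>"
proof
  fix \<omega> assume "\<omega> \<in> D ` \<U>"
  then obtain f where f: "f \<in> \<U>" "\<omega> = D f" by blast
  then obtain R where "short_range R f" by (auto simp: invariant_uniform_iff)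
  then show "\<omega> \<in> \<C>" unfolding f(2)
    by (rule D_invariant_form[where k = "\<lambda>_ _. 0"]) (use f in \<open>simp add: invariant_uniform_iff\<close>)
qed

lemma dV_subset: "dV \<subseteq> \<C>"
proof
  fix \<omega> assume "\<omega> \<in> dV"
  then obtain \<xi>s where \<xi>s: "\<xi>s \<in> Consv_tuples" "\<omega> = D (moment \<xi>s)"
    unfolding dV_eq D_moment_def by blast
  show "\<omega> \<in> \<C>" unfolding \<xi>s(2)
    by (rule D_invariant_form[OF moment_short_range[OF \<xi>s(1)],
        where k = "\<lambda>g \<alpha>. \<Sum>j = 1..d. of_int (n j g) * \<alpha> (\<xi>s j)"]) (rule moment_act[OF \<xi>s(1)])
qed

lemma uniform_dV_disjoint: "D ` \<U> \<inter> dV = {0}"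
proof
  show "D ` \<U> \<inter> dV \<subseteq> {0}"
  proof
    fix \<omega> assume "\<omega> \<in> D ` \<U> \<inter> dV"
    then obtain f \<xi>s where *: "f \<in> \<U>" "\<omega> = D f" "\<xi>s \<in> Consv_tuples" "\<omega> = D_moment \<xi>s"
      unfolding dV_eq by blast
    have "\<xi>s = 0"
      by (rule moment_not_invariant[OF *(3), of f]) (use * in \<open>auto simp: invariant_uniform_iff\<close>)
    then show "\<omega> \<in> {0}" using *(4) linear_0[OF linear_D_moment] by simp
  qed
  show "{0} \<subseteq> D ` \<U> \<inter> dV"
    using subspace_0[OF linear_subspace_image[OF linear_D subspace_invariant_uniform]]
      subspace_0[OF subspace_span] unfolding dV_space_def by auto
qed

text \<open>The difference of the two sides is a homomorphism that vanishes on the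
  \<open>\<sigma> j\<close>, hence on \<open>F\<close>, and on torsion elements, since the reals are
  torsion-free.\<close>

lemma additive_hom_coordinates:
  assumes hom: "\<And>g h. g \<in> carrier G \<Longrightarrow> h \<in> carrier G \<Longrightarrow> \<psi> (g \<otimes> h) = \<psi> g + (\<psi> h :: real)"
    and g: "g \<in> carrier G"
  shows "\<psi> g = (\<Sum>j = 1..d. of_int (n j g) * \<psi> (\<sigma> j))"
proof -
  define \<delta> where "\<delta> g = \<psi> g - (\<Sum>j = 1..d. of_int (n j g) * \<psi> (\<sigma> j))" for g
  have \<delta>_hom: "\<delta> (g \<otimes> h) = \<delta> g + \<delta> h" if "g \<in> carrier G" "h \<in> carrier G" for g h
  proof -
    have "(\<Sum>j = 1..d. of_int (n j (g \<otimes> h)) * \<psi> (\<sigma> j))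
        = (\<Sum>j = 1..d. of_int (n j g) * \<psi> (\<sigma> j)) + (\<Sum>j = 1..d. of_int (n j h) * \<psi> (\<sigma> j))"
      unfolding sum.distrib[symmetric] using that by (intro sum.cong) (auto simp: n_mult distrib_right)
    then show ?thesis using hom that by (simp add: \<delta>_def)
  qed
  have \<delta>_one: "\<delta> \<one> = 0" using \<delta>_hom[of \<one> \<one>] by simp
  have \<delta>_inv: "\<delta> (inv h) = - \<delta> h" if "h \<in> carrier G" for h
    using \<delta>_hom[of h "inv h"] that \<delta>_one by simp
  have \<delta>_\<sigma>: "\<delta> (\<sigma> i) = 0" if i: "i \<in> {1..d}" for i
  proof -
    have "(\<Sum>j = 1..d. of_int (n j (\<sigma> i)) * \<psi> (\<sigma> j)) = (\<Sum>j = 1..d. if i = j then \<psi> (\<sigma> i) else 0)"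
      using i by (intro sum.cong) (auto simp: n_sigma)
    then show ?thesis using i by (simp add: \<delta>_def)
  qed
  have "subgroup {h \<in> carrier G. \<delta> h = 0} G"
    using \<delta>_one by (intro subgroupI) (auto simp: \<delta>_hom \<delta>_inv)
  then have F: "F \<subseteq> {h \<in> carrier G. \<delta> h = 0}" by (rule subgroup_sigma_F) (auto simp: \<delta>_\<sigma>)
  have torsion: "\<delta> t = 0" if t: "t \<in> torsion_subgroup G" for t
  proof -
    obtain N :: nat where N: "t \<in> carrier G" "N > 0" "t [^] N = \<one>" using t by (auto simp: torsion_subgroup_def)
    have "\<delta> (t [^] k) = real k * \<delta> t" for k :: nat
      using N(1) by (induction k) (auto simp: \<delta>_one \<delta>_hom algebra_simps)
    from this[of N] show ?thesis using N \<delta>_one by simp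
  qed
  obtain f t where ft: "f \<in> F" "t \<in> torsion_subgroup G" "g = f \<otimes> t" using decompose[OF g] by blast
  have "\<delta> g = \<delta> f + \<delta> t" unfolding ft(3) using F_carrier[OF ft(1)] torsion_carrier[OF ft(2)] by (rule \<delta>_hom)
  then have "\<delta> g = 0" using F ft torsion by auto
  then show ?thesis by (simp add: \<delta>_def)
qed

lemma merge_act:
  "g \<in> carrier G \<Longrightarrow> \<eta> \<in> S \<Longrightarrow> \<zeta> \<in> S \<Longrightarrow> act g (merge \<eta> \<zeta>) = merge (act g \<eta>) (act g \<zeta>)"
  by (rule config_eqI) (auto simp: act_in_S merge_in_S act_apply merge_apply)

lemma sep_act:
  assumes q: "equivariant q \<nu>" and g: "g \<in> carrier G" and sep: "sep q C \<eta> \<zeta>"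
  shows "sep q C (act g \<eta>) (act g \<zeta>)"
  unfolding sep_def supp_act[OF g]
proof (intro ballI)
  fix x y assume "x \<in> aV g ` supp \<eta>" "y \<in> aV g ` supp \<zeta>"
  then obtain x' y' where *: "x = aV g x'" "y = aV g y'" "x' \<in> supp \<eta>" "y' \<in> supp \<zeta>" by blast
  have "q x' + C < q y'" using sep * unfolding sep_def by blast
  then show "q x + C < q y" using * q g by (simp add: equivariantD supp_verts)
qed

text \<open>The defect of invariance of a uniform primitive is a homomorphism from \<open>G\<close> to the conserved
  quantities, and the moments realise all of these.\<close>

lemma invariant_form_decompose:
  assumes \<omega>: "\<omega> \<in> \<C>" and simple: "d = 1 \<Longrightarrow> simple_interaction \<phi> b"
  shows "\<exists>f \<in> \<U>. \<exists>\<xi>s \<in> Consv_tuples. \<omega> = D f + D_moment \<xi>s"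
proof -
  have cu: "\<omega> \<in> closed_uniform_forms X \<iota> \<phi> b"
    and inv: "\<And>g. g \<in> carrier G \<Longrightarrow> act_form X G aV aE b g \<omega> = \<omega>"
    using \<omega> by (auto simp: invariant_closed_uniform_forms_def)
  obtain f R where f: "f \<in> config_functions X b" "f vac = 0" "short_range R f" "additive_far (pos 1) f"
    and grad: "\<forall>e \<in> arcs X. \<forall>\<eta> \<in> S. f (step \<eta> e) - f \<eta> = \<omega> e \<eta>"
    using uniform_primitive[OF cu simple] by blast
  have 1: "1 \<in> {1..d}" using d_pos by simp
  define T where "T g \<eta> = f (act g \<eta>) - f \<eta>" for g \<eta>
  define \<kappa> where "\<kappa> g = (\<lambda>s. T g (single s))" for g
  have T: "\<kappa> g \<in> Consv \<phi> b \<and> (\<forall>\<eta> \<in> S. T g \<eta> = charge \<eta> (\<kappa> g))" if g: "g \<in> carrier G" for g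
  proof -
    \<comment> \<open>Invariance of \<open>\<omega>\<close> makes
      \<open>\<lambda>\<eta>. f (act g \<eta>)\<close> another primitive of \<open>\<omega>\<close>,
      so the defect has zero gradient.\<close>
    have step: "T g (step \<eta> e) = T g \<eta>" if e: "e \<in> arcs X" "\<eta> \<in> S" for e \<eta>
    proof -
      have "\<omega> (aE g e) (act g \<eta>) = \<omega> e \<eta>"
        using fun_cong[OF fun_cong[OF inv[OF inv_closed[OF g]], of e], of \<eta>] e g by (simp add: act_form_def)
      moreover have "f (step (act g \<eta>) (aE g e)) - f (act g \<eta>) = \<omega> (aE g e) (act g \<eta>)"
        using grad e g by (simp add: act_in_S)
      moreover have "f (step \<eta> e) - f \<eta> = \<omega> e \<eta>" using grad e by simp
      ultimately show ?thesis using step_act[OF g e] by (simp add: T_def)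
    qed
    have const: "T g \<eta> = T g \<zeta>" if "\<eta> \<in> S" "\<zeta> \<in> S" "charge \<eta> = charge \<zeta>" for \<eta> \<zeta>
      using step that by (rule constant_on_charge)
    have af: "additive_far (pos 1) (T g)"
    proof -
      obtain C where C: "C \<ge> 0" "\<And>\<eta> \<zeta>. \<eta> \<in> S \<Longrightarrow> \<zeta> \<in> S \<Longrightarrow> sep (pos 1) C \<eta> \<zeta> \<Longrightarrow> f (merge \<eta> \<zeta>) = f \<eta> + f \<zeta>"
        by (fact additive_farE[OF f(4)])
      show ?thesis unfolding additive_far_def
      proof (intro exI[of _ C] conjI ballI impI C(1))
        fix \<eta> \<zeta> assume S: "\<eta> \<in> S" "\<zeta> \<in> S" and sep: "sep (pos 1) C \<eta> \<zeta>"
        show "T g (merge \<eta> \<zeta>) = T g \<eta> + T g \<zeta>"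
          using C(2)[OF S sep] C(2)[OF act_in_S[OF g S(1)] act_in_S[OF g S(2)] sep_act[OF pos_equivariant[OF 1] g sep]]
          by (simp add: T_def merge_act[OF g S])
      qed
    qed
    have vac: "T g vac = 0" using g f(2) by (simp add: T_def)
    show ?thesis
      using additive_charge_function(1)[OF const af vac] additive_charge_function(2)[OF const af vac]
      unfolding \<kappa>_def by blast
  qed
  \<comment> \<open>The defect for \<open>g\<close> depends only on the charge, which
    \<open>act h\<close> preserves; so the obvious rule for a product of group elements becomes
    additivity.\<close>
  have hom: "\<kappa> (g \<otimes> h) s = \<kappa> g s + \<kappa> h s" if gh: "g \<in> carrier G" "h \<in> carrier G" for g h s
  proof -
    have hS: "act h (single s) \<in> S" using gh by (simp add: act_in_S)
    have "\<kappa> (g \<otimes> h) s = T g (act h (single s)) + T h (single s)"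
      using gh by (simp add: \<kappa>_def T_def act_act)
    also have "T g (act h (single s)) = charge (act h (single s)) (\<kappa> g)" using T[OF gh(1)] hS by blast
    also have "\<dots> = \<kappa> g s" using T[OF gh(1)] gh(2) by (simp add: charge_act charge_single)
    finally show ?thesis by (simp add: \<kappa>_def)
  qed
  have \<kappa>_eq: "\<kappa> g s = (\<Sum>j = 1..d. of_int (n j g) * \<kappa> (\<sigma> j) s)" if "g \<in> carrier G" for g s
    using hom that by (rule additive_hom_coordinates)
  define \<xi>s where "\<xi>s j = (if j \<in> {1..d} then \<kappa> (\<sigma> j) else 0)" for j
  have \<xi>s: "\<xi>s \<in> Consv_tuples" using T by (auto simp: Consv_tuples_def \<xi>s_def)
  define f0 where "f0 = f - moment \<xi>s"
  have inv0: "f0 (act g \<eta>) = f0 \<eta>" if g: "g \<in> carrier G" and \<eta>: "\<eta> \<in> S" for g \<eta>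
  proof -
    have "f (act g \<eta>) - f \<eta> = charge \<eta> (\<kappa> g)" using T[OF g] \<eta> by (simp add: T_def)
    also have "\<dots> = (\<Sum>x \<in> supp \<eta>. \<kappa> g (\<eta> x))" using T[OF g] by (simp add: charge_def)
    also have "\<dots> = (\<Sum>x \<in> supp \<eta>. \<Sum>j = 1..d. of_int (n j g) * \<kappa> (\<sigma> j) (\<eta> x))"
      by (rule sum.cong[OF refl]) (rule \<kappa>_eq[OF g])
    also have "\<dots> = (\<Sum>j = 1..d. of_int (n j g) * charge \<eta> (\<xi>s j))"
    proof (subst sum.swap, rule sum.cong[OF refl])
      fix j assume j: "j \<in> {1..d}"
      have "charge \<eta> (\<xi>s j) = (\<Sum>x \<in> supp \<eta>. \<kappa> (\<sigma> j) (\<eta> x))"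
        using T[OF sigma_closed[OF j]] j by (simp add: charge_def \<xi>s_def)
      then show "(\<Sum>x \<in> supp \<eta>. of_int (n j g) * \<kappa> (\<sigma> j) (\<eta> x)) = of_int (n j g) * charge \<eta> (\<xi>s j)"
        by (simp add: sum_distrib_left)
    qed
    finally show ?thesis using moment_act[OF \<xi>s g \<eta>] by (simp add: f0_def)
  qed
  have "short_range R f0" unfolding short_range_def
  proof (intro ballI impI)
    fix \<eta> x y assume a: "\<eta> \<in> S" "x \<in> verts X" "y \<in> verts X" "\<not> gdist X x y \<le> enat R"
    have "f \<eta> + f (\<eta>(x := b, y := b)) = f (\<eta>(x := b)) + f (\<eta>(y := b))"
      using f(3) a unfolding short_range_def by blast
    moreover have "moment \<xi>s \<eta> + moment \<xi>s (\<eta>(x := b, y := b)) = moment \<xi>s (\<eta>(x := b)) + moment \<xi>s (\<eta>(y := b))"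
      using short_range_mono[OF _ moment_short_range[OF \<xi>s], of R] a unfolding short_range_def by blast
    ultimately show "f0 \<eta> + f0 (\<eta>(x := b, y := b)) = f0 (\<eta>(x := b)) + f0 (\<eta>(y := b))" by (simp add: f0_def)
  qed
  moreover have "f0 \<in> config_functions X b"
    unfolding f0_def by (rule subspace_diff[OF subspace_config_functions f(1) moment_config])
  ultimately have "f0 \<in> \<U>" using inv0 by (auto simp: invariant_uniform_iff)
  moreover have "\<omega> = D f"
    using cu grad by (intro differential_eqI[symmetric]) (auto simp: closed_uniform_forms_def)
  then have "\<omega> = D f0 + D_moment \<xi>s"
    using linear_diff[OF linear_D, of f "moment \<xi>s"] by (simp add: f0_def D_moment_def)
  ultimately show ?thesis using \<xi>s by blast
qed

lemma Varadhan_decomposition: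
  assumes simple: "d = 1 \<Longrightarrow> simple_interaction \<phi> b"
  shows "direct_sum_decomposition \<C> (D ` \<U>) dV"
  unfolding direct_sum_decomposition_def
proof (intro conjI)
  show "subspace \<C>" by (rule subspace_invariant_forms)
  show "subspace (D ` \<U>)" by (rule linear_subspace_image[OF linear_D subspace_invariant_uniform])
  show "subspace dV" unfolding dV_space_def by (rule subspace_span)
  show "D ` \<U> \<inter> dV = {0}" by (rule uniform_dV_disjoint)
  show "\<C> = {u + v |u v. u \<in> D ` \<U> \<and> v \<in> dV}"
  proof
    show "\<C> \<subseteq> {u + v |u v. u \<in> D ` \<U> \<and> v \<in> dV}"
    proof
      fix \<omega> assume "\<omega> \<in> \<C>"
      then obtain f \<xi>s where "f \<in> \<U>" "\<xi>s \<in> Consv_tuples" "\<omega> = D f + D_moment \<xi>s"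
        using invariant_form_decompose[OF _ simple] by blast
      then show "\<omega> \<in> {u + v |u v. u \<in> D ` \<U> \<and> v \<in> dV}" unfolding dV_eq by blast
    qed
    show "{u + v |u v. u \<in> D ` \<U> \<and> v \<in> dV} \<subseteq> \<C>"
      using D_uniform_subset dV_subset subspace_add[OF subspace_invariant_forms] by blast
  qed
qed

end

theorem theorem1p1:
  fixes X :: "('x, 'e) pre_digraph" and \<iota> :: "'e \<Rightarrow> 'e"
    and G :: "'g monoid" and aV :: "'g \<Rightarrow> 'x \<Rightarrow> 'x" and aE :: "'g \<Rightarrow> 'e \<Rightarrow> 'e"
    and \<phi> :: "'s \<times> 's \<Rightarrow> 's \<times> 's" and b :: 's
    and d :: nat and F :: "'g set" and \<sigma> :: "nat \<Rightarrow> 'g" and n :: "nat \<Rightarrow> 'g \<Rightarrow> int"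
    and \<Lambda>0 :: "'x set"
  assumes "crystal_lattice X \<iota> G aV aE"
    and "d = abelian_rank G"
    and "is_interaction \<phi>"
    and "irreducibly_quantified \<phi> b"
    and "d = 1 \<Longrightarrow> simple_interaction \<phi> b"
    and "free_part G F d \<sigma>"
    and "free_coordinates G d \<sigma> n"
    and "fundamental_domain X G aV \<Lambda>0"
  shows "let C = invariant_closed_uniform_forms X \<iota> G aV aE \<phi> b;
             E = differential X \<phi> b ` invariant_uniform_functions X G aV b;
             dV = dV_space X G aV \<phi> b d n \<Lambda>0
         in subspace dV \<and> dV \<subseteq> C \<and>
            dim dV = c_dim \<phi> b * d \<and>
            (\<forall>B. independent B \<and> span B = Consv \<phi> b \<longrightarrow> has_dimension_of dV (B \<times> {1..d})) \<and>
            direct_sum_decomposition C E dV"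
proof -
  interpret framed_system X \<iota> G aV aE \<phi> b d F \<sigma> n \<Lambda>0
    using assms(1-4,6-8) by (simp add: framed_system_def framed_system_axioms_def)
  have "subspace dV" unfolding dV_space_def by (rule subspace_span)
  then show ?thesis
    unfolding Let_def
    using dV_subset dim_dV dV_has_dimension Varadhan_decomposition[OF assms(5)] by blast
qed

end
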